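(* There is an algorithm that, given an $n$-vertex graph $G$, a positive integer $\rho$, and a distance-$\rho$ tree-partition-decomposition of $G$ of width at most $k$ and degree at most $\Delta$, computes $\gamma_\rho(G)$ in time $n^{\mathcal{O}(\Delta^2 k)}$.
   Context: Graphs are finite, undirected and unweighted, with shortest-path distance $\mathrm{dist}$. For $A\subseteq V(G)$, $\gamma_\rho(A,G)$ is the minimum size of a set $D\subseteq V(G)$ such that every $u\in A$ has some $d\in D$ with $\mathrm{dist}(u,d)\le\rho$ (a distance-$\rho$ dominating set of $A$); $\gamma_\rho(G)=\gamma_\rho(V(G),G)$. A distance-$\rho$ tree-partition-decomposition of $G$ consists of a tree $T$ and sets $C_x\subseteq V(G)$ for $x\in V(T)$ such that $\{C_x\}$ is a partition of $V(G)$ and whenever $\mathrm{dist}(u,v)\le\rho$ with $u\in C_x$, $v\in C_y$, the nodes $x,y$ are equal or adjacent in $T$. Its width is $\max_x \gamma_\rho(C_x,G)$ and its degree is the maximum degree of $T$. *)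

theory Defs
  imports "Graph_Theory.Graph_Theory" "HOL-Library.Disjoint_Sets"
begin

section \<open>Distance domination and tree-partition-decompositions\<close>

text \<open>
  A finite simple undirected graph is a \<open>pair_graph\<close>: a finite symmetric loop-free digraph
  without parallel arcs. The distance is that of the library with all arcs of weight 1; it is
  infinite between different components.
\<close>

definition gdist :: "'a pair_pre_digraph \<Rightarrow> 'a \<Rightarrow> 'a \<Rightarrow> ereal" where
  "gdist G u v = wf_digraph.\<mu> (with_proj G) (\<lambda>_. 1) u v"

definition dominating :: "nat \<Rightarrow> 'a pair_pre_digraph \<Rightarrow> 'a set \<Rightarrow> 'a set \<Rightarrow> bool" where
  "dominating \<rho> G A D \<longleftrightarrow>
     D \<subseteq> pverts G \<and> (\<forall>u\<in>A. \<exists>d\<in>D. gdist G u d \<le> ereal (real \<rho>))"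

definition dom_number_of :: "nat \<Rightarrow> 'a set \<Rightarrow> 'a pair_pre_digraph \<Rightarrow> nat" where
  "dom_number_of \<rho> A G = (LEAST m. \<exists>D. dominating \<rho> G A D \<and> card D = m)"

definition dom_number :: "nat \<Rightarrow> 'a pair_pre_digraph \<Rightarrow> nat" where
  "dom_number \<rho> G = dom_number_of \<rho> (pverts G) G"

text \<open>
  The library predicate \<open>tree\<close> is meant for directed graphs: in a symmetric digraph every
  edge \<open>ab\<close> gives the directed cycle \<open>a, b, a\<close>. The cycles of the undirected graph are the
  directed cycles of length at least 3. Library connectedness includes that the graph has
  at least one vertex.
\<close>

definition undirected_tree :: "'a pair_pre_digraph \<Rightarrow> bool" where
  "undirected_tree T \<longleftrightarrow>
     pair_graph T \<and> Digraph_Component.connected (with_proj T) \<and>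
     (\<nexists>p. pre_digraph.cycle (with_proj T) p \<and> 3 \<le> length p)"

text \<open>
  As usual for a partition, the parts are nonempty; \<open>inj_on\<close> makes parts with different
  indices disjoint.
\<close>

definition tree_partition_decomposition ::
  "nat \<Rightarrow> 'a pair_pre_digraph \<Rightarrow> 'b pair_pre_digraph \<Rightarrow> ('b \<Rightarrow> 'a set) \<Rightarrow> bool" where
  "tree_partition_decomposition \<rho> G T C \<longleftrightarrow>
     undirected_tree T \<and>
     inj_on C (pverts T) \<and> partition_on (pverts G) (C ` pverts T) \<and>
     (\<forall>x\<in>pverts T. \<forall>y\<in>pverts T. \<forall>u\<in>C x. \<forall>v\<in>C y.
        gdist G u v \<le> ereal (real \<rho>) \<longrightarrow> x = y \<or> (x, y) \<in> parcs T)"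

definition decomposition_width ::
  "nat \<Rightarrow> 'a pair_pre_digraph \<Rightarrow> 'b pair_pre_digraph \<Rightarrow> ('b \<Rightarrow> 'a set) \<Rightarrow> nat" where
  "decomposition_width \<rho> G T C = Max ((\<lambda>x. dom_number_of \<rho> (C x) G) ` pverts T)"

definition max_degree :: "'b pair_pre_digraph \<Rightarrow> nat" where
  "max_degree T = Max (out_degree (with_proj T) ` pverts T)"


section \<open>Random access machine\<close>

text \<open>
  Algorithms are programs of a random access machine with uniform cost, in structured form.
  The memory consists of arrays \<open>a = 0, 1, 2, \<dots>\<close>, each with infinitely many cells that hold
  natural numbers. A program names only finitely many arrays, since array names are constants
  in it, whereas cells are addressed by computed indices; an unindexed variable is a cell with
  a constant index. The arithmetic operations are addition and truncated subtraction only.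
  Without multiplication the bit length of the cell contents grows by at most one per
  operation, so that uniform cost agrees with the cost on a Turing machine up to a polynomial.
\<close>

type_synonym memory = "nat \<Rightarrow> nat \<Rightarrow> nat"

datatype expr =
    Const nat
  | Cell nat expr
  | Add expr expr
  | Sub expr expr

datatype com =
    Skip
  | Assign nat expr expr
  | Seq com com
  | IfNZ expr com com
  | WhileNZ expr com

fun val :: "memory \<Rightarrow> expr \<Rightarrow> nat" where
  "val s (Const c) = c"
| "val s (Cell a e) = s a (val s e)"
| "val s (Add e f) = val s e + val s f"
| "val s (Sub e f) = val s e - val s f"

fun cost :: "expr \<Rightarrow> nat" where
  "cost (Const c) = 1"
| "cost (Cell a e) = 1 + cost e"
| "cost (Add e f) = 1 + cost e + cost f"
| "cost (Sub e f) = 1 + cost e + cost f"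

text \<open>
  \<open>exec p s t s'\<close>: started in memory \<open>s\<close>, the program \<open>p\<close> halts after \<open>t\<close> steps in memory \<open>s'\<close>.
  \<open>Assign a e f\<close> stores the value of \<open>f\<close> in the cell of array \<open>a\<close> whose index is the value
  of \<open>e\<close>.
\<close>

inductive exec :: "com \<Rightarrow> memory \<Rightarrow> nat \<Rightarrow> memory \<Rightarrow> bool" where
  Skip: "exec Skip s 1 s"
| Assign: "exec (Assign a e f) s (1 + cost e + cost f) (s(a := (s a)(val s e := val s f)))"
| Seq: "exec p s t s' \<Longrightarrow> exec q s' t' s'' \<Longrightarrow> exec (Seq p q) s (t + t') s''"
| IfTrue: "val s e \<noteq> 0 \<Longrightarrow> exec p s t s' \<Longrightarrow> exec (IfNZ e p q) s (1 + cost e + t) s'"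
| IfFalse: "val s e = 0 \<Longrightarrow> exec q s t s' \<Longrightarrow> exec (IfNZ e p q) s (1 + cost e + t) s'"
| WhileTrue: "val s e \<noteq> 0 \<Longrightarrow> exec p s t s' \<Longrightarrow> exec (WhileNZ e p) s' t' s'' \<Longrightarrow>
    exec (WhileNZ e p) s (1 + cost e + t + t') s''"
| WhileFalse: "val s e = 0 \<Longrightarrow> exec (WhileNZ e p) s (1 + cost e) s"

inductive_cases exec_SkipE: "exec Skip s t s'"
inductive_cases exec_AssignE: "exec (Assign a e f) s t s'"
inductive_cases exec_SeqE: "exec (Seq p q) s t s'"
inductive_cases exec_IfE: "exec (IfNZ e p q) s t s'"
inductive_cases exec_WhileE: "exec (WhileNZ e p) s t s'"

lemma exec_deterministic:
  assumes "exec p s t s'" "exec p s u s''"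
  shows "t = u \<and> s' = s''"
  using assms
proof (induction arbitrary: u s'' rule: exec.induct)
  case (Skip s)
  then show ?case by (rule exec_SkipE) simp
next
  case (Assign a e f s)
  then show ?case by (rule exec_AssignE) simp
next
  case (Seq p s t s' q t' s2)
  from Seq.prems show ?case
  proof (rule exec_SeqE)
    fix v m v'
    assume "u = v + v'" and v: "exec p s v m" "exec q m v' s''"
    moreover have eq: "t = v" "s' = m" using Seq.IH(1)[OF v(1)] by blast+
    moreover have "t' = v'" "s2 = s''"
      using Seq.IH(2)[OF v(2)[folded eq(2)]] by blast+
    ultimately show ?thesis by simp
  qed
next
  case (IfTrue s e p t s' q)
  from IfTrue.prems show ?case 
  proof (rule exec_IfE)
    fix v assume "u = Suc (cost e + v)" "exec p s v s''"
    with IfTrue.IH[of v s''] show ?thesis by simp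
  qed (use IfTrue.hyps in simp_all)
next
  case (IfFalse s e q t s' p)
  from IfFalse.prems show ?case 
  proof (rule exec_IfE)
    fix v assume "u = Suc (cost e + v)" "exec q s v s''"
    with IfFalse.IH[of v s''] show ?thesis by simp
  qed (use IfFalse.hyps in simp_all)
next
  case (WhileTrue s e p t s' t' s2)
  from WhileTrue.prems show ?case
  proof (rule exec_WhileE)
    fix v m v'
    assume "u = Suc (cost e + v + v')" and v: "exec p s v m" "exec (WhileNZ e p) m v' s''"
    moreover have eq: "t = v" "s' = m" using WhileTrue.IH(1)[OF v(1)] by blast+
    moreover have "t' = v'" "s2 = s''"
      using WhileTrue.IH(2)[OF v(2)[folded eq(2)]] by blast+
    ultimately show ?thesis by simp
  next
    assume "val s e = 0"
    with WhileTrue.hyps show ?thesis by simp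
  qed
next
  case (WhileFalse s e p)
  from WhileFalse.prems show ?case by (rule exec_WhileE) (use WhileFalse in simp_all)
qed

text \<open>
  Encoding of an instance in which \<open>G\<close> has the vertices \<open>0, \<dots>, n - 1\<close> and \<open>T\<close> has the nodes
  \<open>0, \<dots>, m - 1\<close>. Array 0 holds \<open>n\<close>, \<open>\<rho>\<close>, \<open>m\<close>; arrays 1 and 2 hold the adjacency matrices of
  \<open>G\<close> and \<open>T\<close> row by row; array 3 holds the characteristic vectors of \<open>C 0, \<dots>, C (m - 1)\<close>
  one after another. All other cells are 0.
\<close>

definition instance_memory ::
  "nat pair_pre_digraph \<Rightarrow> nat \<Rightarrow> nat pair_pre_digraph \<Rightarrow> (nat \<Rightarrow> nat set) \<Rightarrow> memory" where
  "instance_memory G \<rho> T C a i =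
     (let n = card (pverts G); m = card (pverts T) in
      if a = 0 then (if i = 0 then n else if i = 1 then \<rho> else if i = 2 then m else 0)
      else if a = 1 then of_bool ((i div n, i mod n) \<in> parcs G)
      else if a = 2 then of_bool ((i div m, i mod m) \<in> parcs T)
      else if a = 3 then of_bool (i div n < m \<and> i mod n \<in> C (i div n))
      else 0)"

definition result :: "memory \<Rightarrow> nat" where
  "result s = s 0 0"

end

theory Submission
  imports Defs
begin

text \<open>
  Let \<open>W\<close> be the width. A minimum dominating set \<open>D\<close> has at most \<open>(\<Delta> + 1) W\<close> elements in each bag:
  these elements dominate only vertices in the closed neighbourhood of the bag, so that otherwise
  they could be exchanged for a union of at most \<open>\<Delta> + 1\<close> sets of size \<open>W\<close>. Hence the part of \<open>D\<close> in the
  closed neighbourhood of a bag has at most \<open>(\<Delta> + 1)\<^sup>2 W\<close> elements and is one of \<open>n ^ O(\<Delta>\<^sup>2 W)\<close> sets.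
  Assign such a set to every node of the tree. It has to dominate the bag of its node, the sets at
  adjacent nodes have to agree on both bags, and the cost of a set is the number of its elements in
  the bag of its node. The minimum total cost is the domination number, and since the conditions
  between nodes are binary, it is found by repeatedly eliminating a leaf of the tree: the cost table
  of its neighbour absorbs the minimum over the consistent sets of the leaf.

  \<open>W\<close> and \<open>\<Delta>\<close> are not part of the input. The program computes \<open>\<Delta>\<close> directly and \<open>W\<close> by trying the sizes
  \<open>0, 1, 2, \<dots>\<close> in turn. It is written in a language whose expressions contain bounded sums, which
  express quantifiers, minima and arithmetic; all of its loops have at most \<open>n ^ O(\<Delta>\<^sup>2 W)\<close> rounds.
\<close>

section \<open>Expressions with bounded sums\<close>

text \<open>The program and the constant are fixed before the instance, so time is measured by one
  number \<open>X\<close> that bounds the rounds of every loop: a fixed program takes at most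
  \<open>X ^ d\<close> steps with \<open>d\<close> read off its syntax, and
  \<open>X = Suc n ^ (set_size + 3)\<close> is large enough. Three obstacles shape the program. The
  machine cannot multiply, so products and quotients are themselves bounded sums, and powers of
  \<open>n\<close> come from a table. The number \<rho> is not bounded in terms of \<open>n\<close>
  and has to be capped before it can serve as a loop bound. Minima are counts truncated at
  \<open>n + 1\<close>; hence statements about costs compare with thresholds
  \<open>c \<le> n\<close> only, which suffices because the domination number is at most
  \<open>n\<close>. The local sets can be glued because a vertex has its dominators in its own bag
  or an adjacent one, and agreement along tree edges hands each dominator over to the node of the
  bag that contains it.\<close>

definition upd :: "memory \<Rightarrow> nat \<Rightarrow> nat \<Rightarrow> nat \<Rightarrow> memory" where
  "upd s a i v = s(a := (s a)(i := v))"

lemma upd_this [simp]: "upd s a i v a = (s a)(i := v)"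
  by (simp add: upd_def)

lemma upd_other [simp]: "b \<noteq> a \<Longrightarrow> upd s a i v b = s b"
  by (simp add: upd_def)

lemma upd_cong: "s b = s' b \<Longrightarrow> upd s a i v b = upd s' a i v b"
  by (cases "b = a") simp_all

text \<open>Arrays from \<open>r\<close> on are scratch space of compiled code, so states are
  compared only below \<open>r\<close>.\<close>

definition agree :: "nat \<Rightarrow> memory \<Rightarrow> memory \<Rightarrow> bool" where
  "agree r s s' \<longleftrightarrow> (\<forall>a<r. s a = s' a)"

lemma agree_refl [simp]: "agree r s s"
  by (simp add: agree_def)

lemma agree_trans: "agree r s s' \<Longrightarrow> agree r s' s'' \<Longrightarrow> agree r s s''"
  by (simp add: agree_def)

lemma agree_mono: "agree r' s s' \<Longrightarrow> r \<le> r' \<Longrightarrow> agree r s s'"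
  by (simp add: agree_def)

lemma agree_upd: "agree r s s' \<Longrightarrow> agree r (upd s a i v) (upd s' a i v)"
  by (simp add: agree_def upd_def)

text \<open>Inside a loop two states agree except for the loop variable; writing the same value to
  it on both sides restores full agreement.\<close>

lemma agree_upd_change: "agree r (upd s a i v) s' \<Longrightarrow> agree r (upd s a i w) (upd s' a i w)"
  by (drule agree_upd[where a = a and i = i and v = w]) (simp add: upd_def)

lemma agree_upd_scratch: "agree r s s' \<Longrightarrow> r \<le> a \<Longrightarrow> agree r s (upd s' a i v)"
  by (simp add: agree_def upd_def)

datatype tm =
    TConst nat
  | TCell nat tm
  | TAdd tm tm
  | TSub tm tm
  | TIte tm tm tm
  | TSum nat tm tm

primrec ev :: "memory \<Rightarrow> tm \<Rightarrow> nat" where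
  "ev s (TConst c) = c"
| "ev s (TCell a t) = s a (ev s t)"
| "ev s (TAdd t u) = ev s t + ev s u"
| "ev s (TSub t u) = ev s t - ev s u"
| "ev s (TIte b t u) = (if ev s b \<noteq> 0 then ev s t else ev s u)"
| "ev s (TSum i b t) = (\<Sum>j<ev s b. ev (upd s i 0 j) t)"

text \<open>A conditional constrains only the branch that is evaluated, so its guard can protect a
  sum.\<close>

primrec sums_bounded :: "nat \<Rightarrow> memory \<Rightarrow> tm \<Rightarrow> bool" where
  "sums_bounded X s (TConst c) \<longleftrightarrow> True"
| "sums_bounded X s (TCell a t) \<longleftrightarrow> sums_bounded X s t"
| "sums_bounded X s (TAdd t u) \<longleftrightarrow> sums_bounded X s t \<and> sums_bounded X s u"
| "sums_bounded X s (TSub t u) \<longleftrightarrow> sums_bounded X s t \<and> sums_bounded X s u"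
| "sums_bounded X s (TIte b t u) \<longleftrightarrow> sums_bounded X s b \<and>
     (if ev s b \<noteq> 0 then sums_bounded X s t else sums_bounded X s u)"
| "sums_bounded X s (TSum i b t) \<longleftrightarrow> sums_bounded X s b \<and> ev s b \<le> X \<and>
     (\<forall>j<ev s b. sums_bounded X (upd s i 0 j) t)"

primrec arrays :: "tm \<Rightarrow> nat set" where
  "arrays (TConst c) = {}"
| "arrays (TCell a t) = insert a (arrays t)"
| "arrays (TAdd t u) = arrays t \<union> arrays u"
| "arrays (TSub t u) = arrays t \<union> arrays u"
| "arrays (TIte b t u) = arrays b \<union> arrays t \<union> arrays u"
| "arrays (TSum i b t) = insert i (arrays b \<union> arrays t)"

lemma ev_cong: "(\<And>a. a \<in> arrays t \<Longrightarrow> s a = s' a) \<Longrightarrow> ev s t = ev s' t"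
proof (induction t arbitrary: s s')
  case (TSum i b t)
  have "ev (upd s i 0 j) t = ev (upd s' i 0 j) t" for j
    by (rule TSum.IH(2)) (rule upd_cong, use TSum.prems in simp)
  moreover have "ev s b = ev s' b" by (rule TSum.IH(1)) (use TSum.prems in simp)
  ultimately show ?case by simp
next
  case (TIte b t u)
  have "ev s b = ev s' b" by (rule TIte.IH) (use TIte.prems in simp)
  moreover have "ev s t = ev s' t" by (rule TIte.IH) (use TIte.prems in simp)
  moreover have "ev s u = ev s' u" by (rule TIte.IH) (use TIte.prems in simp)
  ultimately show ?case by simp
next
  case (TAdd t u)
  have "ev s t = ev s' t" by (rule TAdd.IH) (use TAdd.prems in simp)
  moreover have "ev s u = ev s' u" by (rule TAdd.IH) (use TAdd.prems in simp)
  ultimately show ?case by simp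
next
  case (TSub t u)
  have "ev s t = ev s' t" by (rule TSub.IH) (use TSub.prems in simp)
  moreover have "ev s u = ev s' u" by (rule TSub.IH) (use TSub.prems in simp)
  ultimately show ?case by simp
next
  case (TCell a t)
  have "ev s t = ev s' t" by (rule TCell.IH) (use TCell.prems in simp)
  then show ?case using TCell.prems by simp
qed simp

lemma sums_bounded_cong:
  "(\<And>a. a \<in> arrays t \<Longrightarrow> s a = s' a) \<Longrightarrow> sums_bounded X s t \<longleftrightarrow> sums_bounded X s' t"
proof (induction t arbitrary: s s')
  case (TIte b t u)
  have "ev s b = ev s' b" by (rule ev_cong) (use TIte.prems in simp)
  moreover have "sums_bounded X s b \<longleftrightarrow> sums_bounded X s' b"
    by (rule TIte.IH) (use TIte.prems in simp)
  moreover have "sums_bounded X s t \<longleftrightarrow> sums_bounded X s' t"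
    by (rule TIte.IH) (use TIte.prems in simp)
  moreover have "sums_bounded X s u \<longleftrightarrow> sums_bounded X s' u"
    by (rule TIte.IH) (use TIte.prems in simp)
  ultimately show ?case by simp
next
  case (TSum i b t)
  have "sums_bounded X (upd s i 0 j) t \<longleftrightarrow> sums_bounded X (upd s' i 0 j) t" for j
    by (rule TSum.IH(2)) (rule upd_cong, use TSum.prems in simp)
  moreover have "ev s b = ev s' b" by (rule ev_cong) (use TSum.prems in simp)
  moreover have "sums_bounded X s b \<longleftrightarrow> sums_bounded X s' b"
    by (rule TSum.IH(1)) (use TSum.prems in simp)
  ultimately show ?case by simp
next
  case (TAdd t u)
  have "sums_bounded X s t \<longleftrightarrow> sums_bounded X s' t"
    by (rule TAdd.IH) (use TAdd.prems in simp)
  moreover have "sums_bounded X s u \<longleftrightarrow> sums_bounded X s' u"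
    by (rule TAdd.IH) (use TAdd.prems in simp)
  ultimately show ?case by simp
next
  case (TSub t u)
  have "sums_bounded X s t \<longleftrightarrow> sums_bounded X s' t"
    by (rule TSub.IH) (use TSub.prems in simp)
  moreover have "sums_bounded X s u \<longleftrightarrow> sums_bounded X s' u"
    by (rule TSub.IH) (use TSub.prems in simp)
  ultimately show ?case by simp
next
  case (TCell a t)
  have "sums_bounded X s t \<longleftrightarrow> sums_bounded X s' t"
    by (rule TCell.IH) (use TCell.prems in simp)
  then show ?case by simp
qed simp

lemma ev_upd: "a \<notin> arrays t \<Longrightarrow> ev (upd s a i v) t = ev s t"
  by (rule ev_cong) (rule upd_other, blast)

lemma sums_bounded_upd: "a \<notin> arrays t \<Longrightarrow> sums_bounded X (upd s a i v) t \<longleftrightarrow> sums_bounded X s t"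
  by (rule sums_bounded_cong) (rule upd_other, blast)

lemma ev_agree: "agree r s s' \<Longrightarrow> arrays t \<subseteq> {..<r} \<Longrightarrow> ev s t = ev s' t"
  by (rule ev_cong) (auto simp: agree_def)

lemma sums_bounded_agree:
  "agree r s s' \<Longrightarrow> arrays t \<subseteq> {..<r} \<Longrightarrow> sums_bounded X s t \<Longrightarrow> sums_bounded X s' t"
  using sums_bounded_cong[of t s s' X] by (auto simp: agree_def)


section \<open>Running time\<close>

text \<open>If every loop is left after at most \<open>X \<ge> 2\<close> rounds, a program \<open>p\<close> needs at most
  \<open>X ^ time_exponent p\<close> steps.\<close>

primrec time_exponent :: "com \<Rightarrow> nat" where
  "time_exponent Skip = 0"
| "time_exponent (Assign a e f) = 1 + cost e + cost f"
| "time_exponent (Seq p q) = 1 + max (time_exponent p) (time_exponent q)"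
| "time_exponent (IfNZ e p q) = 1 + max (1 + cost e) (max (time_exponent p) (time_exponent q))"
| "time_exponent (WhileNZ e p) = 3 + max (1 + cost e) (time_exponent p)"

definition runs :: "nat \<Rightarrow> com \<Rightarrow> memory \<Rightarrow> (memory \<Rightarrow> bool) \<Rightarrow> bool" where
  "runs X p s Q \<longleftrightarrow> (\<exists>t s'. exec p s t s' \<and> t \<le> X ^ time_exponent p \<and> Q s')"

lemma runs_mono: "runs X p s Q \<Longrightarrow> (\<And>s'. Q s' \<Longrightarrow> R s') \<Longrightarrow> runs X p s R"
  unfolding runs_def by blast

lemma le_power_self:
  fixes X a :: nat
  assumes "2 \<le> X"
  shows "a \<le> X ^ a"
  using less_imp_le[OF less_exp[of a]] power_mono[OF assms, of a] by linarith

lemma add_power_le: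
  fixes X a b :: nat
  assumes "2 \<le> X" "x \<le> X ^ a" "y \<le> X ^ b"
  shows "x + y \<le> X ^ (1 + max a b)"
proof -
  have "X ^ a \<le> X ^ max a b" "X ^ b \<le> X ^ max a b"
    using assms(1) by (auto intro!: power_increasing)
  then have "x + y \<le> 2 * X ^ max a b" using assms by linarith
  also have "\<dots> \<le> X * X ^ max a b" using assms(1) by simp
  finally show ?thesis by simp
qed

lemma runs_Assign:
  assumes "2 \<le> X" "Q (upd s a (val s e) (val s f))"
  shows "runs X (Assign a e f) s Q"
  unfolding runs_def
  using exec.Assign[of a e f s] le_power_self[OF assms(1), of "1 + cost e + cost f"] assms(2)
  by (auto simp: upd_def)

lemma runs_Seq:
  assumes "2 \<le> X" "runs X p s R" "\<And>s'. R s' \<Longrightarrow> runs X q s' Q"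
  shows "runs X (Seq p q) s Q"
proof -
  obtain t s' where p: "exec p s t s'" "t \<le> X ^ time_exponent p" "R s'"
    using assms(2) unfolding runs_def by blast
  obtain t' s'' where q: "exec q s' t' s''" "t' \<le> X ^ time_exponent q" "Q s''"
    using assms(3)[OF p(3)] unfolding runs_def by blast
  from exec.Seq[OF p(1) q(1)] add_power_le[OF assms(1) p(2) q(2)] q(3)
  show ?thesis unfolding runs_def by auto
qed

lemma runs_Seq_eq:
  assumes "2 \<le> X" "runs X p s (\<lambda>s'. s' = s1)" "runs X q s1 Q"
  shows "runs X (Seq p q) s Q"
  using runs_Seq[OF assms(1,2)] assms(3) by blast

lemma runs_IfNZ:
  assumes "2 \<le> X" "val s e \<noteq> 0 \<Longrightarrow> runs X p s Q" "val s e = 0 \<Longrightarrow> runs X q s Q"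
  shows "runs X (IfNZ e p q) s Q"
proof -
  have c: "1 + cost e \<le> X ^ (1 + cost e)" using le_power_self[OF assms(1)] .
  show ?thesis
  proof (cases "val s e = 0")
    case True
    then obtain t s' where q: "exec q s t s'" "t \<le> X ^ time_exponent q" "Q s'"
      using assms(3) unfolding runs_def by blast
    have "t \<le> X ^ max (time_exponent p) (time_exponent q)"
      using q(2) assms(1) by (meson le_trans max.cobounded2 power_increasing one_le_numeral)
    from add_power_le[OF assms(1) c this] exec.IfFalse[OF True q(1), of p] q(3)
    show ?thesis unfolding runs_def by auto
  next
    case False
    then obtain t s' where p: "exec p s t s'" "t \<le> X ^ time_exponent p" "Q s'"
      using assms(2) unfolding runs_def by blast
    have "t \<le> X ^ max (time_exponent p) (time_exponent q)"
      using p(2) assms(1) by (meson le_trans max.cobounded1 power_increasing one_le_numeral)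
    from add_power_le[OF assms(1) c this] exec.IfTrue[OF False p(1), of q] p(3)
    show ?thesis unfolding runs_def by auto
  qed
qed

text \<open>This is the source of the 3 in \<open>time_exponent\<close>: one factor \<open>X\<close>
  absorbs the addition of guard and body within a round, two more absorb the number of guard
  evaluations, \<open>Suc N \<le> Suc X \<le> X ^ 2\<close>.\<close>

lemma runs_WhileNZ:
  assumes X: "2 \<le> X" and N: "N \<le> X"
    and init: "I 0 s"
    and step: "\<And>j s. j < N \<Longrightarrow> I j s \<Longrightarrow> val s e \<noteq> 0 \<and> runs X p s (I (Suc j))"
    and stop: "\<And>s. I N s \<Longrightarrow> val s e = 0 \<and> Q s"
  shows "runs X (WhileNZ e p) s Q"
proof -
  let ?b = "1 + cost e + X ^ time_exponent p"
  \<comment> \<open>Induction on the number \<open>d\<close> of rounds that remain.\<close>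
  have *: "I (N - d) s \<Longrightarrow> d \<le> N \<Longrightarrow>
      \<exists>t s'. exec (WhileNZ e p) s t s' \<and> t \<le> d * ?b + 1 + cost e \<and> Q s'" for d s
  proof (induction d arbitrary: s)
    case 0
    then show ?case using stop exec.WhileFalse[of s e p] by fastforce
  next
    case (Suc d)
    then have "N - Suc d < N" "Suc (N - Suc d) = N - d" by auto
    with step[of "N - Suc d" s] Suc.prems(1)
    have nz: "val s e \<noteq> 0" and "runs X p s (I (N - d))" by auto
    then obtain t s' where p: "exec p s t s'" "t \<le> X ^ time_exponent p" "I (N - d) s'"
      unfolding runs_def by blast
    obtain t' s'' where w: "exec (WhileNZ e p) s' t' s''" "t' \<le> d * ?b + 1 + cost e" "Q s''"
      using Suc.IH[OF p(3)] Suc.prems(2) by auto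
    have "1 + cost e + t + t' \<le> Suc d * ?b + 1 + cost e" using p(2) w(2) by simp
    with exec.WhileTrue[OF nz p(1) w(1)] w(3) show ?case by blast
  qed
  obtain t s' where w: "exec (WhileNZ e p) s t s'" "t \<le> N * ?b + 1 + cost e" "Q s'"
    using *[of N s] init by auto
  have "?b \<le> X ^ (1 + max (1 + cost e) (time_exponent p))" (is "_ \<le> ?c")
    using add_power_le[OF X le_power_self[OF X] order_refl] .
  have "t \<le> Suc N * ?b" using w(2) by simp
  also have "\<dots> \<le> Suc X * ?c" using \<open>?b \<le> ?c\<close> N by (intro mult_mono) auto
  also have "\<dots> \<le> X ^ 2 * ?c"
  proof (intro mult_right_mono)
    have "Suc X \<le> 2 * X" using X by simp
    also have "\<dots> \<le> X ^ 2" using X by (simp add: power2_eq_square)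
    finally show "Suc X \<le> X ^ 2" .
  qed simp
  also have "\<dots> = X ^ time_exponent (WhileNZ e p)"
    by (simp add: power_add power2_eq_square power3_eq_cube del: max_Suc_Suc)
  finally show ?thesis using w unfolding runs_def by blast
qed


section \<open>Compilation of expressions\<close>

abbreviation Var :: "nat \<Rightarrow> expr" where "Var a \<equiv> Cell a (Const 0)"

text \<open>The result of \<open>compile_tm r t\<close> is in cell 0 of array \<open>r\<close>; the arrays from \<open>r\<close> on are scratch
  space.\<close>

primrec compile_tm :: "nat \<Rightarrow> tm \<Rightarrow> com" where
  "compile_tm r (TConst c) = Assign r (Const 0) (Const c)"
| "compile_tm r (TCell a t) = Seq (compile_tm r t) (Assign r (Const 0) (Cell a (Var r)))"
| "compile_tm r (TAdd t u) = Seq (compile_tm r t) (Seq (compile_tm (Suc r) u)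
     (Assign r (Const 0) (Add (Var r) (Var (Suc r)))))"
| "compile_tm r (TSub t u) = Seq (compile_tm r t) (Seq (compile_tm (Suc r) u)
     (Assign r (Const 0) (Sub (Var r) (Var (Suc r)))))"
| "compile_tm r (TIte b t u) = Seq (compile_tm r b) (IfNZ (Var r) (compile_tm r t) (compile_tm r u))"
| "compile_tm r (TSum i b t) =
     Seq (compile_tm r b)
    (Seq (Assign (r + 1) (Const 0) (Const 0))
    (Seq (Assign (r + 2) (Const 0) (Var i))
    (Seq (Assign (r + 3) (Const 0) (Const 0))
    (Seq (WhileNZ (Sub (Var r) (Var (r + 3)))
           (Seq (Assign i (Const 0) (Var (r + 3)))
           (Seq (compile_tm (r + 4) t)
           (Seq (Assign (r + 1) (Const 0) (Add (Var (r + 1)) (Var (r + 4))))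
                (Assign (r + 3) (Const 0) (Add (Var (r + 3)) (Const 1)))))))
    (Seq (Assign i (Const 0) (Var (r + 2)))
         (Assign r (Const 0) (Var (r + 1))))))))"

text \<open>The second operand is computed from \<open>Suc r\<close> on, so that array
  \<open>r\<close> keeps the value of the first. Agreement below \<open>r\<close> includes that
  every summation variable gets its old value back.\<close>

lemma runs_compile_tm:
  assumes X: "2 \<le> X"
  shows "arrays t \<subseteq> {..<r} \<Longrightarrow> sums_bounded X s t \<Longrightarrow>
    runs X (compile_tm r t) s (\<lambda>s'. s' r 0 = ev s t \<and> agree r s s')"
proof (induction t arbitrary: r s)
  case (TConst c)
  then show ?case by (auto intro!: runs_Assign[OF X] agree_upd_scratch)
next
  case (TCell a t)
  then have "runs X (compile_tm r t) s (\<lambda>s'. s' r 0 = ev s t \<and> agree r s s')" by simp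
  then show ?case unfolding compile_tm.simps
  proof (rule runs_Seq[OF X])
    fix s' assume "s' r 0 = ev s t \<and> agree r s s'"
    with TCell.prems
    show "runs X (Assign r (Const 0) (Cell a (Var r))) s'
      (\<lambda>s'. s' r 0 = ev s (TCell a t) \<and> agree r s s')"
      by (intro runs_Assign[OF X]) (auto simp: agree_def)
  qed
next
  case (TAdd t u)
  then have "runs X (compile_tm r t) s (\<lambda>s'. s' r 0 = ev s t \<and> agree r s s')" by simp
  then show ?case unfolding compile_tm.simps
  proof (rule runs_Seq[OF X])
    fix s1 assume s1: "s1 r 0 = ev s t \<and> agree r s s1"
    have u: "arrays u \<subseteq> {..<r}" "sums_bounded X s1 u" "ev s1 u = ev s u"
      using TAdd.prems s1 sums_bounded_agree[of r s s1 u] ev_agree[of r s s1 u] by auto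
    have "runs X (compile_tm (Suc r) u) s1 (\<lambda>s'. s' (Suc r) 0 = ev s1 u \<and> agree (Suc r) s1 s')"
      by (intro TAdd.IH) (use u in auto)
    then show "runs X (Seq (compile_tm (Suc r) u) (Assign r (Const 0) (Add (Var r) (Var (Suc r)))))
      s1 (\<lambda>s'. s' r 0 = ev s (TAdd t u) \<and> agree r s s')"
    proof (rule runs_Seq[OF X])
      fix s2 assume "s2 (Suc r) 0 = ev s1 u \<and> agree (Suc r) s1 s2"
      with s1 u(3) show "runs X (Assign r (Const 0) (Add (Var r) (Var (Suc r)))) s2
        (\<lambda>s'. s' r 0 = ev s (TAdd t u) \<and> agree r s s')"
        by (intro runs_Assign[OF X]) (auto simp: agree_def)
    qed
  qed
next
  case (TSub t u)
  then have "runs X (compile_tm r t) s (\<lambda>s'. s' r 0 = ev s t \<and> agree r s s')" by simp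
  then show ?case unfolding compile_tm.simps
  proof (rule runs_Seq[OF X])
    fix s1 assume s1: "s1 r 0 = ev s t \<and> agree r s s1"
    have u: "arrays u \<subseteq> {..<r}" "sums_bounded X s1 u" "ev s1 u = ev s u"
      using TSub.prems s1 sums_bounded_agree[of r s s1 u] ev_agree[of r s s1 u] by auto
    have "runs X (compile_tm (Suc r) u) s1 (\<lambda>s'. s' (Suc r) 0 = ev s1 u \<and> agree (Suc r) s1 s')"
      by (intro TSub.IH) (use u in auto)
    then show "runs X (Seq (compile_tm (Suc r) u) (Assign r (Const 0) (Sub (Var r) (Var (Suc r)))))
      s1 (\<lambda>s'. s' r 0 = ev s (TSub t u) \<and> agree r s s')"
    proof (rule runs_Seq[OF X])
      fix s2 assume "s2 (Suc r) 0 = ev s1 u \<and> agree (Suc r) s1 s2"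
      with s1 u(3) show "runs X (Assign r (Const 0) (Sub (Var r) (Var (Suc r)))) s2
        (\<lambda>s'. s' r 0 = ev s (TSub t u) \<and> agree r s s')"
        by (intro runs_Assign[OF X]) (auto simp: agree_def)
    qed
  qed
next
  case (TIte b t u)
  then have "runs X (compile_tm r b) s (\<lambda>s'. s' r 0 = ev s b \<and> agree r s s')" by simp
  then show ?case unfolding compile_tm.simps
  proof (rule runs_Seq[OF X])
    fix s1 assume s1: "s1 r 0 = ev s b \<and> agree r s s1"
    have t: "runs X (compile_tm r t) s1 (\<lambda>s'. s' r 0 = ev s t \<and> agree r s s')" if "ev s b \<noteq> 0"
    proof (rule runs_mono)
      show "runs X (compile_tm r t) s1 (\<lambda>s'. s' r 0 = ev s1 t \<and> agree r s1 s')"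
        using TIte.prems s1 that by (intro TIte.IH sums_bounded_agree[of r s s1 t]) auto
    qed (use s1 TIte.prems ev_agree[of r s s1 t] agree_trans[of r s s1] in auto)
    have u: "runs X (compile_tm r u) s1 (\<lambda>s'. s' r 0 = ev s u \<and> agree r s s')" if "ev s b = 0"
    proof (rule runs_mono)
      show "runs X (compile_tm r u) s1 (\<lambda>s'. s' r 0 = ev s1 u \<and> agree r s1 s')"
        using TIte.prems s1 that by (intro TIte.IH sums_bounded_agree[of r s s1 u]) auto
    qed (use s1 TIte.prems ev_agree[of r s s1 u] agree_trans[of r s s1] in auto)
    show "runs X (IfNZ (Var r) (compile_tm r t) (compile_tm r u)) s1
      (\<lambda>s'. s' r 0 = ev s (TIte b t u) \<and> agree r s s')"
      using s1 t u by (intro runs_IfNZ[OF X]) simp_all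
  qed
next
  case (TSum i b t)
  let ?N = "ev s b"
  let ?g = "\<lambda>j. ev (upd s i 0 j) t"
  let ?Q = "\<lambda>s'. s' r 0 = ev s (TSum i b t) \<and> agree r s s'"
  \<comment> \<open>Arrays \<open>r\<close> to \<open>r + 3\<close> hold the bound, the partial sum,
    the saved value of the summation variable and the counter. The summation variable is the only
    cell below \<open>r\<close> that may differ from \<open>s\<close>; its value is left open
    because each round overwrites it.\<close>
  define I where "I j s' \<longleftrightarrow> agree r (upd s i 0 (s' i 0)) s' \<and> s' r 0 = ?N \<and>
    s' (r + 1) 0 = (\<Sum>j'<j. ?g j') \<and> s' (r + 2) 0 = s i 0 \<and> s' (r + 3) 0 = j" for j s'
  have i: "i < r" and N: "?N \<le> X" using TSum.prems by auto
  have "runs X (compile_tm r b) s (\<lambda>s'. s' r 0 = ?N \<and> agree r s s')" using TSum by simp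
  then show ?case unfolding compile_tm.simps
  proof (rule runs_Seq[OF X])
    fix s1 assume 2: "s1 r 0 = ?N \<and> agree r s s1"
    show "runs X
      (Seq (Assign (r + 1) (Const 0) (Const 0))
      (Seq (Assign (r + 2) (Const 0) (Var i))
      (Seq (Assign (r + 3) (Const 0) (Const 0))
      (Seq (WhileNZ (Sub (Var r) (Var (r + 3)))
             (Seq (Assign i (Const 0) (Var (r + 3)))
             (Seq (compile_tm (r + 4) t)
             (Seq (Assign (r + 1) (Const 0) (Add (Var (r + 1)) (Var (r + 4))))
                  (Assign (r + 3) (Const 0) (Add (Var (r + 3)) (Const 1)))))))
      (Seq (Assign i (Const 0) (Var (r + 2)))
           (Assign r (Const 0) (Var (r + 1)))))))) s1 ?Q"
    proof (rule runs_Seq[OF X, where R = "\<lambda>s'. s' r 0 = ?N \<and> agree r s s' \<and> s' (r + 1) 0 = 0"],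
        goal_cases)
      case 1
      show ?case using 2 by (intro runs_Assign[OF X]) (auto simp: agree_def)
    next
      case (2 s2)
      show ?case
      proof (rule runs_Seq[OF X, where R = "\<lambda>s'. s' r 0 = ?N \<and> agree r s s' \<and>
            s' (r + 1) 0 = 0 \<and> s' (r + 2) 0 = s i 0"], goal_cases)
        case 1
        show ?case using 2 i by (intro runs_Assign[OF X]) (auto simp: agree_def)
      next
        case (2 s3)
        show ?case
        proof (rule runs_Seq[OF X, where R = "I 0"], goal_cases)
          case 1
          show ?case using 2 i
            by (intro runs_Assign[OF X]) (auto simp: agree_def I_def upd_def)
        next
          case (2 s4)
          show ?case
          proof (rule runs_Seq[OF X, where R = "I ?N"], goal_cases)
            case 1
            show ?case
            proof (rule runs_WhileNZ[where I = I, OF X N 2], goal_cases)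
              case (1 j s5)
              let ?s6 = "upd s5 i 0 j"
              have ag: "agree r (upd s i 0 j) ?s6"
                using 1(2) agree_upd_change unfolding I_def by blast
              have t: "arrays t \<subseteq> {..<r}" "sums_bounded X ?s6 t" "ev ?s6 t = ?g j"
                using TSum.prems 1(1) sums_bounded_agree[OF ag] ev_agree[OF ag] by auto
              have 3: "runs X (compile_tm (r + 4) t) ?s6
                  (\<lambda>s'. s' (r + 4) 0 = ev ?s6 t \<and> agree (r + 4) ?s6 s')"
                by (rule TSum.IH(2)[OF _ t(2)]) (use t(1) in auto)
              have "runs X (Assign i (Const 0) (Var (r + 3))) s5 (\<lambda>s'. s' = ?s6)"
                using 1(2) by (intro runs_Assign[OF X]) (simp add: I_def)
              moreover have "runs X (Seq (compile_tm (r + 4) t)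
                 (Seq (Assign (r + 1) (Const 0) (Add (Var (r + 1)) (Var (r + 4))))
                      (Assign (r + 3) (Const 0) (Add (Var (r + 3)) (Const 1))))) ?s6 (I (Suc j))"
              proof (rule runs_Seq[OF X 3])
                fix s7 assume 7: "s7 (r + 4) 0 = ev ?s6 t \<and> agree (r + 4) ?s6 s7"
                have "runs X (Assign (r + 1) (Const 0) (Add (Var (r + 1)) (Var (r + 4)))) s7
                  (\<lambda>s'. s' = upd s7 (r + 1) 0 (s7 (r + 1) 0 + s7 (r + 4) 0))"
                  by (intro runs_Assign[OF X]) simp
                then show "runs X (Seq (Assign (r + 1) (Const 0) (Add (Var (r + 1)) (Var (r + 4))))
                  (Assign (r + 3) (Const 0) (Add (Var (r + 3)) (Const 1)))) s7 (I (Suc j))"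
                proof (rule runs_Seq[OF X], intro runs_Assign[OF X])
                  fix s8 assume 8: "s8 = upd s7 (r + 1) 0 (s7 (r + 1) 0 + s7 (r + 4) 0)"
                  have s7: "s7 a = ?s6 a" if "a < r + 4" for a
                    using 7 that by (simp add: agree_def)
                  show "I (Suc j) (upd s8 (r + 3) (val s8 (Const 0))
                    (val s8 (Add (Var (r + 3)) (Const 1))))"
                    using 1(2) i 7 t(3) ag unfolding I_def 8
                    by (auto simp: s7 agree_def upd_def)
                qed
              qed
              ultimately have inner: "runs X (Seq (Assign i (Const 0) (Var (r + 3)))
                 (Seq (compile_tm (r + 4) t)
                 (Seq (Assign (r + 1) (Const 0) (Add (Var (r + 1)) (Var (r + 4))))
                      (Assign (r + 3) (Const 0) (Add (Var (r + 3)) (Const 1)))))) s5 (I (Suc j))"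
                by (rule runs_Seq_eq[OF X])
              show ?case
                by (rule conjI[OF _ inner]) (use 1 in \<open>simp add: I_def\<close>)
            qed (simp add: I_def)
          next
            case (2 s5)
            have "runs X (Assign i (Const 0) (Var (r + 2))) s5 (\<lambda>s'. s' = upd s5 i 0 (s i 0))"
              using 2 by (intro runs_Assign[OF X]) (simp add: I_def)
            then show ?case
            proof (rule runs_Seq[OF X], intro runs_Assign[OF X])
              fix s6 assume s6: "s6 = upd s5 i 0 (s i 0)"
              have "upd s i 0 (s i 0) = s" by (simp add: upd_def)
              moreover have "agree r (upd s i 0 (s i 0)) s6"
                using 2 agree_upd_change unfolding I_def s6 by blast
              ultimately have "agree r s s6" by simp
              then show "upd s6 r (val s6 (Const 0)) (val s6 (Var (r + 1))) r 0 = ev s (TSum i b t)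
                \<and> agree r s (upd s6 r (val s6 (Const 0)) (val s6 (Var (r + 1))))"
                using 2 i agree_upd_scratch[of r s s6 r] by (simp add: I_def s6)
            qed
          qed
        qed
      qed
    qed
  qed
qed


section \<open>Structured programs over these expressions\<close>

datatype prog =
    PSkip
  | PSet nat tm tm
  | PSeq prog prog
  | PIf tm prog prog
  | PFor nat tm prog

primrec prog_arrays :: "prog \<Rightarrow> nat set" where
  "prog_arrays PSkip = {}"
| "prog_arrays (PSet a t u) = insert a (arrays t \<union> arrays u)"
| "prog_arrays (PSeq c d) = prog_arrays c \<union> prog_arrays d"
| "prog_arrays (PIf t c d) = arrays t \<union> prog_arrays c \<union> prog_arrays d"
| "prog_arrays (PFor i b c) = insert i (arrays b \<union> prog_arrays c)"

primrec written :: "prog \<Rightarrow> nat set" where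
  "written PSkip = {}"
| "written (PSet a t u) = {a}"
| "written (PSeq c d) = written c \<union> written d"
| "written (PIf t c d) = written c \<union> written d"
| "written (PFor i b c) = insert i (written c)"

text \<open>The precondition includes that no loop has more than \<open>X\<close> rounds. A loop bound is evaluated only
  once, and \<open>I j\<close> holds after \<open>j\<close> rounds.\<close>

primrec wp :: "nat \<Rightarrow> prog \<Rightarrow> memory \<Rightarrow> (memory \<Rightarrow> bool) \<Rightarrow> bool" where
  "wp X PSkip s Q \<longleftrightarrow> Q s"
| "wp X (PSet a t u) s Q \<longleftrightarrow>
     sums_bounded X s t \<and> sums_bounded X s u \<and> Q (upd s a (ev s t) (ev s u))"
| "wp X (PSeq c d) s Q \<longleftrightarrow> wp X c s (\<lambda>s'. wp X d s' Q)"
| "wp X (PIf t c d) s Q \<longleftrightarrow>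
     sums_bounded X s t \<and> (if ev s t \<noteq> 0 then wp X c s Q else wp X d s Q)"
| "wp X (PFor i b c) s Q \<longleftrightarrow> sums_bounded X s b \<and> ev s b \<le> X \<and>
     (\<exists>I. I 0 s \<and> (\<forall>j<ev s b. \<forall>s'. I j s' \<longrightarrow> wp X c (upd s' i 0 j) (I (Suc j))) \<and>
          (\<forall>s'. I (ev s b) s' \<longrightarrow> Q s'))"

lemma wp_mono: "wp X c s Q \<Longrightarrow> (\<And>s'. Q s' \<Longrightarrow> R s') \<Longrightarrow> wp X c s R"
proof (induction c arbitrary: s Q R)
  case (PSeq c d)
  have "wp X c s (\<lambda>s'. wp X d s' Q)" using PSeq.prems(1) by simp
  then have "wp X c s (\<lambda>s'. wp X d s' R)"
    by (rule PSeq.IH(1)) (rule PSeq.IH(2)[OF _ PSeq.prems(2)])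
  then show ?case by simp
next
  case (PIf t c d)
  have "wp X c s R" if "wp X c s Q" using PIf.IH(1)[OF that PIf.prems(2)] .
  moreover have "wp X d s R" if "wp X d s Q" using PIf.IH(2)[OF that PIf.prems(2)] .
  ultimately show ?case using PIf.prems(1) by (auto split: if_splits)
next
  case (PFor i b c)
  then show ?case by (simp only: wp.simps) blast
qed auto

lemma wp_PForD:
  assumes "wp X (PFor i b c) s Q"
  shows "sums_bounded X s b" "ev s b \<le> X"
    "\<exists>I. I 0 s \<and> (\<forall>j<ev s b. \<forall>s'. I j s' \<longrightarrow> wp X c (upd s' i 0 j) (I (Suc j))) \<and>
      (\<forall>s'. I (ev s b) s' \<longrightarrow> Q s')"
  using assms by (simp_all only: wp.simps)

lemma wp_PForI:
  assumes "sums_bounded X s b" "ev s b \<le> X" "I 0 s"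
    and "\<And>j s'. j < ev s b \<Longrightarrow> I j s' \<Longrightarrow> wp X c (upd s' i 0 j) (I (Suc j))"
    and "\<And>s'. I (ev s b) s' \<Longrightarrow> Q s'"
  shows "wp X (PFor i b c) s Q"
  unfolding wp.simps using assms by (intro conjI exI[of _ I] allI impI)

lemma wp_frame: "wp X c s Q \<Longrightarrow> wp X c s (\<lambda>s'. Q s' \<and> (\<forall>a. a \<notin> written c \<longrightarrow> s' a = s a))"
proof (induction c arbitrary: s Q)
  case (PSeq c d)
  have "wp X c s (\<lambda>s'. wp X d s' Q)" using PSeq.prems by simp
  from PSeq.IH(1)[OF this]
  have "wp X c s (\<lambda>s'. wp X d s' (\<lambda>s'. Q s' \<and> (\<forall>a. a \<notin> written (PSeq c d) \<longrightarrow> s' a = s a)))"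
  proof (rule wp_mono)
    fix s' assume *: "wp X d s' Q \<and> (\<forall>a. a \<notin> written c \<longrightarrow> s' a = s a)"
    then have "wp X d s' (\<lambda>s''. Q s'' \<and> (\<forall>a. a \<notin> written d \<longrightarrow> s'' a = s' a))"
      using PSeq.IH(2) by blast
    then show "wp X d s' (\<lambda>s'. Q s' \<and> (\<forall>a. a \<notin> written (PSeq c d) \<longrightarrow> s' a = s a))"
      by (rule wp_mono) (use * in auto)
  qed
  then show ?case by simp
next
  case (PIf t c d)
  have "wp X c s (\<lambda>s'. Q s' \<and> (\<forall>a. a \<notin> written (PIf t c d) \<longrightarrow> s' a = s a))" if "wp X c s Q"
    using PIf.IH(1)[OF that] by (rule wp_mono) auto
  moreover have "wp X d s (\<lambda>s'. Q s' \<and> (\<forall>a. a \<notin> written (PIf t c d) \<longrightarrow> s' a = s a))"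
    if "wp X d s Q" using PIf.IH(2)[OF that] by (rule wp_mono) auto
  ultimately show ?case using PIf.prems by (auto split: if_splits)
next
  case (PFor i b c)
  obtain I where I_raw: "I 0 s"
    "\<forall>j<ev s b. \<forall>s'. I j s' \<longrightarrow> wp X c (upd s' i 0 j) (I (Suc j))"
    "\<forall>s'. I (ev s b) s' \<longrightarrow> Q s'"
    using wp_PForD(3)[OF PFor.prems] by (elim exE conjE)
  note I = wp_PForD(1,2)[OF PFor.prems] I_raw[rule_format]
  define J where "J j s' \<longleftrightarrow> I j s' \<and> (\<forall>a. a \<notin> insert i (written c) \<longrightarrow> s' a = s a)" for j s'
  have step_J: "wp X c (upd s' i 0 j) (J (Suc j))" if "j < ev s b" "J j s'" for j s'
  proof -
    have "wp X c (upd s' i 0 j) (I (Suc j))" using I(4) that by (simp add: J_def)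
    from PFor.IH[OF this] show ?thesis
      by (rule wp_mono) (use that(2) in \<open>auto simp: J_def\<close>)
  qed
  have J0: "J 0 s" using I(3) by (simp add: J_def)
  have stop_J: "Q s' \<and> (\<forall>a. a \<notin> written (PFor i b c) \<longrightarrow> s' a = s a)" if "J (ev s b) s'" for s'
    using that I(5) by (simp add: J_def)
  show ?case by (rule wp_PForI[where I = J, OF I(1,2) J0 step_J stop_J])
qed simp_all

text \<open>The frame is conjoined to the invariant, so that \<open>I\<close> only has to mention
  what the body writes; all other arrays are as before the loop.\<close>

lemma wp_PFor:
  assumes "sums_bounded X s b" "ev s b = N" "N \<le> X" "I 0 s"
    and step: "\<And>j s'. j < N \<Longrightarrow> I j s' \<Longrightarrow> (\<And>a. a \<notin> insert i (written c) \<Longrightarrow> s' a = s a) \<Longrightarrow>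
      wp X c (upd s' i 0 j) (I (Suc j))"
    and stop: "\<And>s'. I N s' \<Longrightarrow> (\<And>a. a \<notin> insert i (written c) \<Longrightarrow> s' a = s a) \<Longrightarrow> Q s'"
  shows "wp X (PFor i b c) s Q"
proof -
  define J where "J j s' \<longleftrightarrow> I j s' \<and> (\<forall>a. a \<notin> insert i (written c) \<longrightarrow> s' a = s a)" for j s'
  have step_J: "wp X c (upd s' i 0 j) (J (Suc j))" if "j < N" "J j s'" for j s'
  proof -
    have "wp X c (upd s' i 0 j) (I (Suc j))" using step that by (simp add: J_def)
    from wp_frame[OF this] show ?thesis
      by (rule wp_mono) (use that(2) in \<open>auto simp: J_def\<close>)
  qed
  have J0: "J 0 s" using assms by (simp add: J_def)
  have stop_J: "Q s'" if "J N s'" for s' using that stop by (simp add: J_def)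
  show ?thesis
    by (rule wp_PForI[where I = J]) (use J0 step_J stop_J assms(1-3) in simp_all)
qed

lemma wp_PSeq_frame:
  assumes "wp X c s R"
    and "\<And>s'. R s' \<Longrightarrow> (\<And>a. a \<notin> written c \<Longrightarrow> s' a = s a) \<Longrightarrow> wp X d s' Q"
  shows "wp X (PSeq c d) s Q"
  using wp_mono[OF wp_frame[OF assms(1)]] assms(2) by simp

primrec compile :: "nat \<Rightarrow> prog \<Rightarrow> com" where
  "compile r PSkip = Skip"
| "compile r (PSet a t u) = Seq (compile_tm r t) (Seq (compile_tm (Suc r) u)
     (Assign a (Var r) (Var (Suc r))))"
| "compile r (PSeq c d) = Seq (compile r c) (compile r d)"
| "compile r (PIf t c d) = Seq (compile_tm r t) (IfNZ (Var r) (compile r c) (compile r d))"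
| "compile r (PFor i b c) = Seq (compile_tm r b) (Seq (Assign (r + 1) (Const 0) (Const 0))
     (WhileNZ (Sub (Var r) (Var (r + 1)))
       (Seq (Assign i (Const 0) (Var (r + 1)))
       (Seq (compile (r + 2) c)
            (Assign (r + 1) (Const 0) (Add (Var (r + 1)) (Const 1)))))))"

text \<open>The source program owns the arrays below \<open>r\<close>, and those from
  \<open>q\<close> on are free. In between lie the bounds and counters of the enclosing loops, which
  the compiled code must preserve; hence the two parameters.\<close>

lemma runs_compile:
  assumes X: "2 \<le> X"
  shows "wp X c s Q \<Longrightarrow> prog_arrays c \<subseteq> {..<r} \<Longrightarrow> agree r s z \<Longrightarrow> r \<le> q \<Longrightarrow>
    runs X (compile q c) z
      (\<lambda>z'. (\<forall>a. r \<le> a \<and> a < q \<longrightarrow> z' a = z a) \<and> (\<exists>s'. agree r s' z' \<and> Q s'))"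
proof (induction c arbitrary: q s z Q)
  case PSkip
  then show ?case unfolding runs_def using exec.Skip by fastforce
next
  case (PSet a t u)
  have t: "arrays t \<subseteq> {..<r}" "sums_bounded X z t" "ev z t = ev s t"
    and u: "arrays u \<subseteq> {..<r}" "sums_bounded X z u" "ev z u = ev s u"
    using PSet.prems sums_bounded_agree[OF PSet.prems(3)] ev_agree[OF PSet.prems(3)] by auto
  have "runs X (compile_tm q t) z (\<lambda>z'. z' q 0 = ev z t \<and> agree q z z')"
    using t PSet.prems(4) by (intro runs_compile_tm[OF X]) auto
  then show ?case unfolding compile.simps
  proof (rule runs_Seq[OF X])
    fix z1 assume z1: "z1 q 0 = ev z t \<and> agree q z z1"
    have r1: "agree r z z1" using z1 agree_mono PSet.prems(4) by blast
    have "runs X (compile_tm (Suc q) u) z1 (\<lambda>z'. z' (Suc q) 0 = ev z1 u \<and> agree (Suc q) z1 z')"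
      using u PSet.prems(4) sums_bounded_agree[OF r1] by (intro runs_compile_tm[OF X]) auto
    then show "runs X (Seq (compile_tm (Suc q) u) (Assign a (Var q) (Var (Suc q)))) z1
      (\<lambda>z'. (\<forall>a. r \<le> a \<and> a < q \<longrightarrow> z' a = z a) \<and> (\<exists>s'. agree r s' z' \<and> Q s'))"
    proof (rule runs_Seq[OF X], intro runs_Assign[OF X])
      fix z2 assume z2: "z2 (Suc q) 0 = ev z1 u \<and> agree (Suc q) z1 z2"
      let ?v = "upd z2 a (val z2 (Var q)) (val z2 (Var (Suc q)))"
      have v: "val z2 (Var q) = ev s t" "val z2 (Var (Suc q)) = ev s u"
        using z1 z2 t(3) u ev_agree[OF r1] by (auto simp: agree_def)
      have "agree r (upd s a (ev s t) (ev s u)) ?v"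
        unfolding v using PSet.prems(3,4) z1 z2 by (intro agree_upd) (auto simp: agree_def)
      moreover have "\<forall>a'. r \<le> a' \<and> a' < q \<longrightarrow> ?v a' = z a'"
        using PSet.prems(2) z1 z2 by (auto simp: agree_def)
      ultimately show "(\<forall>a'. r \<le> a' \<and> a' < q \<longrightarrow> ?v a' = z a') \<and> (\<exists>s'. agree r s' ?v \<and> Q s')"
        using PSet.prems(1) by auto
    qed
  qed
next
  case (PSeq c d)
  have "runs X (compile q c) z (\<lambda>z'. (\<forall>a. r \<le> a \<and> a < q \<longrightarrow> z' a = z a) \<and>
      (\<exists>s'. agree r s' z' \<and> wp X d s' Q))"
    using PSeq.prems by (intro PSeq.IH(1)[where s = s]) auto
  then show ?case unfolding compile.simps
  proof (rule runs_Seq[OF X], elim conjE exE)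
    fix z1 s1 assume z1: "\<forall>a. r \<le> a \<and> a < q \<longrightarrow> z1 a = z a" "agree r s1 z1" "wp X d s1 Q"
    have "runs X (compile q d) z1 (\<lambda>z'. (\<forall>a. r \<le> a \<and> a < q \<longrightarrow> z' a = z1 a) \<and>
      (\<exists>s'. agree r s' z' \<and> Q s'))"
      using PSeq.prems z1 by (intro PSeq.IH(2)[where s = s1]) auto
    then show "runs X (compile q d) z1 (\<lambda>z'. (\<forall>a. r \<le> a \<and> a < q \<longrightarrow> z' a = z a) \<and>
      (\<exists>s'. agree r s' z' \<and> Q s'))"
      by (rule runs_mono) (use z1(1) in auto)
  qed
next
  case (PIf t c d)
  let ?Q = "\<lambda>z'. (\<forall>a. r \<le> a \<and> a < q \<longrightarrow> z' a = z a) \<and> (\<exists>s'. agree r s' z' \<and> Q s')"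
  have t: "arrays t \<subseteq> {..<r}" "sums_bounded X z t" "ev z t = ev s t"
    using PIf.prems sums_bounded_agree[OF PIf.prems(3)] ev_agree[OF PIf.prems(3)] by auto
  have "runs X (compile_tm q t) z (\<lambda>z'. z' q 0 = ev z t \<and> agree q z z')"
    using t PIf.prems(4) by (intro runs_compile_tm[OF X]) auto
  then show ?case unfolding compile.simps
  proof (rule runs_Seq[OF X])
    fix z1 assume z1: "z1 q 0 = ev z t \<and> agree q z z1"
    have r1: "agree r s z1" using z1 PIf.prems(3,4) by (auto simp: agree_def)
    have eq: "\<forall>a. r \<le> a \<and> a < q \<longrightarrow> z1 a = z a" using z1 by (simp add: agree_def)
    have "runs X (compile q c) z1 ?Q" if "ev s t \<noteq> 0"
    proof (rule runs_mono)
      show "runs X (compile q c) z1 (\<lambda>z'. (\<forall>a. r \<le> a \<and> a < q \<longrightarrow> z' a = z1 a) \<and>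
        (\<exists>s'. agree r s' z' \<and> Q s'))"
        using PIf.prems r1 that by (intro PIf.IH(1)[where s = s]) auto
    qed (use eq in auto)
    moreover have "runs X (compile q d) z1 ?Q" if "ev s t = 0"
    proof (rule runs_mono)
      show "runs X (compile q d) z1 (\<lambda>z'. (\<forall>a. r \<le> a \<and> a < q \<longrightarrow> z' a = z1 a) \<and>
        (\<exists>s'. agree r s' z' \<and> Q s'))"
        using PIf.prems r1 that by (intro PIf.IH(2)[where s = s]) auto
    qed (use eq in auto)
    ultimately show "runs X (IfNZ (Var q) (compile q c) (compile q d)) z1 ?Q"
      using z1 t(3) by (intro runs_IfNZ[OF X]) simp_all
  qed
next
  case (PFor i b c)
  let ?N = "ev s b"
  let ?Q = "\<lambda>z'. (\<forall>a. r \<le> a \<and> a < q \<longrightarrow> z' a = z a) \<and> (\<exists>s'. agree r s' z' \<and> Q s')"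
  obtain I where I_raw: "I 0 s"
    "\<forall>j<ev s b. \<forall>s'. I j s' \<longrightarrow> wp X c (upd s' i 0 j) (I (Suc j))"
    "\<forall>s'. I (ev s b) s' \<longrightarrow> Q s'"
    using wp_PForD(3)[OF PFor.prems(1)] by (elim exE conjE)
  note I = wp_PForD(1,2)[OF PFor.prems(1)] I_raw[rule_format]
  define J where "J j z' \<longleftrightarrow> z' q 0 = ?N \<and> z' (q + 1) 0 = j \<and>
    (\<forall>a. r \<le> a \<and> a < q \<longrightarrow> z' a = z a) \<and> (\<exists>s'. agree r s' z' \<and> I j s')" for j z'
  have i: "i < r" using PFor.prems by auto
  have b: "arrays b \<subseteq> {..<r}" "sums_bounded X z b" "ev z b = ?N"
    using PFor.prems sums_bounded_agree[OF PFor.prems(3)] ev_agree[OF PFor.prems(3)] by auto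
  have "runs X (compile_tm q b) z (\<lambda>z'. z' q 0 = ev z b \<and> agree q z z')"
    using b PFor.prems(4) by (intro runs_compile_tm[OF X]) auto
  then show ?case unfolding compile.simps
  proof (rule runs_Seq[OF X])
    fix z1 assume z1: "z1 q 0 = ev z b \<and> agree q z z1"
    have "runs X (Assign (q + 1) (Const 0) (Const 0)) z1 (J 0)"
      using z1 b(3) I(3) PFor.prems(3,4)
      by (intro runs_Assign[OF X]) (auto simp: J_def agree_def intro!: exI[of _ s])
    then show "runs X (Seq (Assign (q + 1) (Const 0) (Const 0))
     (WhileNZ (Sub (Var q) (Var (q + 1)))
       (Seq (Assign i (Const 0) (Var (q + 1)))
       (Seq (compile (q + 2) c)
            (Assign (q + 1) (Const 0) (Add (Var (q + 1)) (Const 1))))))) z1 ?Q"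
    proof (rule runs_Seq[OF X])
      fix z2 assume z2: "J 0 z2"
      show "runs X (WhileNZ (Sub (Var q) (Var (q + 1)))
       (Seq (Assign i (Const 0) (Var (q + 1)))
       (Seq (compile (q + 2) c)
            (Assign (q + 1) (Const 0) (Add (Var (q + 1)) (Const 1)))))) z2 ?Q"
      proof (rule runs_WhileNZ[where I = J, OF X I(2) z2])
        fix j z3 assume j: "j < ?N" and z3: "J j z3"
        then obtain s3 where s3: "agree r s3 z3" "I j s3" by (auto simp: J_def)
        let ?z4 = "upd z3 i 0 j"
        have "runs X (Assign i (Const 0) (Var (q + 1))) z3 (\<lambda>z'. z' = ?z4)"
          using z3 by (intro runs_Assign[OF X]) (simp add: J_def)
        moreover have "runs X (Seq (compile (q + 2) c)
            (Assign (q + 1) (Const 0) (Add (Var (q + 1)) (Const 1)))) ?z4 (J (Suc j))"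
        proof (rule runs_Seq[OF X])
          show "runs X (compile (q + 2) c) ?z4
            (\<lambda>z'. (\<forall>a. r \<le> a \<and> a < q + 2 \<longrightarrow> z' a = ?z4 a) \<and> (\<exists>s'. agree r s' z' \<and> I (Suc j) s'))"
            by (rule PFor.IH[OF I(4)[OF j s3(2)] _ agree_upd[OF s3(1)]]) (use PFor.prems in auto)
          fix z5 assume z5: "(\<forall>a. r \<le> a \<and> a < q + 2 \<longrightarrow> z5 a = ?z4 a) \<and>
            (\<exists>s'. agree r s' z5 \<and> I (Suc j) s')"
          then have z5': "z5 a = z3 a" if "r \<le> a" "a < q + 2" for a
            using that i by auto
          let ?z6 = "upd z5 (q + 1) 0 (Suc j)"
          obtain s5 where "agree r s5 z5" "I (Suc j) s5" using z5 by blast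
          then have "\<exists>s'. agree r s' ?z6 \<and> I (Suc j) s'"
            using agree_upd_scratch[of r s5 z5 "q + 1"] PFor.prems(4) by auto
          then have "J (Suc j) ?z6" using z3 PFor.prems(4) by (simp add: J_def z5')
          then show "runs X (Assign (q + 1) (Const 0) (Add (Var (q + 1)) (Const 1))) z5 (J (Suc j))"
            using z3 PFor.prems(4) by (intro runs_Assign[OF X]) (simp add: J_def z5')
        qed
        ultimately have "runs X
          (Seq (Assign i (Const 0) (Var (q + 1))) (Seq (compile (q + 2) c)
            (Assign (q + 1) (Const 0) (Add (Var (q + 1)) (Const 1))))) z3 (J (Suc j))"
          by (rule runs_Seq_eq[OF X])
        then show "val z3 (Sub (Var q) (Var (q + 1))) \<noteq> 0 \<and> runs X
          (Seq (Assign i (Const 0) (Var (q + 1))) (Seq (compile (q + 2) c)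
            (Assign (q + 1) (Const 0) (Add (Var (q + 1)) (Const 1))))) z3 (J (Suc j))"
          by (rule conjI[rotated]) (use z3 j in \<open>simp add: J_def\<close>)
      qed (use I(5) in \<open>auto simp: J_def\<close>)
    qed
  qed
qed

section \<open>Binary constraints on a forest\<close>

text \<open>A threshold instead of a minimum: the cost tables will be truncated, so that only
  comparisons with small \<open>c\<close> are meaningful.\<close>

definition feasible ::
  "(nat \<Rightarrow> nat \<Rightarrow> bool) \<Rightarrow> (nat \<Rightarrow> nat \<Rightarrow> nat \<Rightarrow> nat \<Rightarrow> bool) \<Rightarrow> nat \<Rightarrow> nat set \<Rightarrow> (nat \<Rightarrow> nat \<Rightarrow> nat) \<Rightarrow> nat \<Rightarrow> bool"
  where
  "feasible adj consistent M A f c \<longleftrightarrow>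
     (\<exists>g. (\<forall>x\<in>A. g x < M) \<and> (\<forall>x\<in>A. \<forall>y\<in>A. adj x y \<longrightarrow> consistent x y (g x) (g y)) \<and>
          (\<Sum>x\<in>A. f x (g x)) \<le> c)"

lemma feasible_cong:
  assumes "\<And>x j. x \<in> A \<Longrightarrow> j < M \<Longrightarrow> f x j = f' x j"
  shows "feasible adj consistent M A f c \<longleftrightarrow> feasible adj consistent M A f' c"
proof -
  have *: "(\<Sum>x\<in>A. f x (g x)) = (\<Sum>x\<in>A. f' x (g x))" if "\<forall>x\<in>A. g x < M" for g
    using assms that by (intro sum.cong) auto
  show ?thesis unfolding feasible_def by (rule iff_exI) (use * in auto)
qed

text \<open>Since \<open>p\<close> is the only neighbour of \<open>x\<close> in \<open>A\<close>,
  the value at \<open>p\<close> alone decides which values \<open>x\<close> may take, and the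
  cheapest of them can be charged to \<open>p\<close>. The table \<mu> has to be right only up to
  \<open>N\<close>: a larger entry cannot occur in a solution of cost at most
  \<open>c \<le> N\<close>.\<close>

lemma feasible_eliminate:
  assumes A: "finite A" "x \<in> A" "p \<in> A" "x \<noteq> p" "adj x p" "\<And>q. q \<in> A \<Longrightarrow> adj x q \<Longrightarrow> q = p"
    and sym: "\<And>x y. adj x y \<Longrightarrow> adj y x" "\<And>x y j k. consistent x y j k \<Longrightarrow> consistent y x k j"
    and mu: "\<And>k c. k < M \<Longrightarrow> c \<le> N \<Longrightarrow> \<mu> k \<le> c \<longleftrightarrow> (\<exists>j<M. consistent x p j k \<and> f x j \<le> c)"
    and f': "\<And>k. k < M \<Longrightarrow> f' p k = f p k + \<mu> k"
      "\<And>y k. y \<in> A \<Longrightarrow> y \<noteq> x \<Longrightarrow> y \<noteq> p \<Longrightarrow> k < M \<Longrightarrow> f' y k = f y k"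
    and c: "c \<le> N"
  shows "feasible adj consistent M (A - {x}) f' c \<longleftrightarrow> feasible adj consistent M A f c"
proof -
  have split: "(\<Sum>y\<in>A. h y) = h x + (h p + (\<Sum>y\<in>A - {x} - {p}. h y))"
    "(\<Sum>y\<in>A - {x}. h y) = h p + (\<Sum>y\<in>A - {x} - {p}. h y)" for h :: "nat \<Rightarrow> nat"
    using sum.remove[OF A(1,2), of h] sum.remove[of "A - {x}" p h] A(1-4) by simp_all
  have rest: "(\<Sum>y\<in>A - {x} - {p}. f' y (g y)) = (\<Sum>y\<in>A - {x} - {p}. f y (g y))"
    if "\<forall>y\<in>A - {x}. g y < M" for g
    using f'(2) that by (intro sum.cong) auto
  show ?thesis
  proof
    assume "feasible adj consistent M (A - {x}) f' c"
    then obtain g where g: "\<forall>y\<in>A - {x}. g y < M"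
      "\<forall>y\<in>A - {x}. \<forall>z\<in>A - {x}. adj y z \<longrightarrow> consistent y z (g y) (g z)"
      "(\<Sum>y\<in>A - {x}. f' y (g y)) \<le> c" unfolding feasible_def by blast
    have gp: "g p < M" using g(1) A(2-4) by auto
    have le: "f p (g p) + \<mu> (g p) + (\<Sum>y\<in>A - {x} - {p}. f y (g y)) \<le> c"
      using g(3) rest[OF g(1)] f'(1)[OF gp] by (simp add: split(2))
    then have "\<mu> (g p) \<le> N" using c by simp
    \<comment> \<open>The threshold here is \<open>\<mu> (g p)\<close> itself, which turns the
      comparison into a witness attaining it.\<close>
    with mu[OF gp] obtain j where j: "j < M" "consistent x p j (g p)" "f x j \<le> \<mu> (g p)" by blast
    let ?g = "g(x := j)"
    have "(\<Sum>y\<in>A - {x} - {p}. f y (?g y)) = (\<Sum>y\<in>A - {x} - {p}. f y (g y))"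
      by (intro sum.cong) auto
    then have "(\<Sum>y\<in>A. f y (?g y)) \<le> c" using le j(3) A(4) by (simp add: split(1))
    moreover have "\<forall>y\<in>A. ?g y < M" using g(1) j(1) by auto
    moreover have "consistent y z (?g y) (?g z)" if yz: "y \<in> A" "z \<in> A" "adj y z" for y z
    proof (cases "y = x \<or> z = x")
      case True
      then consider "y = x" "z = p" | "z = x" "y = p"
        using A(6)[OF yz(1)] A(6)[OF yz(2)] sym(1)[OF yz(3)] yz(3) by metis
      then show ?thesis
      proof cases
        case 1
        then show ?thesis using j(2) A(4) by simp
      next
        case 2
        then show ?thesis using sym(2)[OF j(2)] A(4) by simp
      qed
    next
      case False
      then have "y \<in> A - {x}" "z \<in> A - {x}" using yz by auto
      then have "consistent y z (g y) (g z)" using g(2) yz(3) by blast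
      then show ?thesis using False by simp
    qed
    ultimately show "feasible adj consistent M A f c" unfolding feasible_def by blast
  next
    assume "feasible adj consistent M A f c"
    then obtain g where g: "\<forall>y\<in>A. g y < M"
      "\<forall>y\<in>A. \<forall>z\<in>A. adj y z \<longrightarrow> consistent y z (g y) (g z)"
      "(\<Sum>y\<in>A. f y (g y)) \<le> c" unfolding feasible_def by blast
    have gp: "g p < M" "g x < M" using g(1) A(2-4) by auto
    have "f x (g x) \<le> N" using g(3) c by (simp add: split(1))
    with mu[OF gp(1)] have "\<mu> (g p) \<le> f x (g x)" using gp(2) g(2) A(2,3,5) by blast
    then have "(\<Sum>y\<in>A - {x}. f' y (g y)) \<le> c"
      using g(1,3) rest[of g] f'(1)[OF gp(1)] by (simp add: split)
    then show "feasible adj consistent M (A - {x}) f' c"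
      unfolding feasible_def using g(1,2) by (intro exI[of _ g]) simp
  qed
qed

text \<open>Without edges the nodes choose independently, so the minimum of the sum is the sum of
  the minima.\<close>

lemma feasible_no_edges:
  assumes "finite A" "\<And>x y. x \<in> A \<Longrightarrow> y \<in> A \<Longrightarrow> \<not> adj x y"
    and mu: "\<And>x c. x \<in> A \<Longrightarrow> c \<le> N \<Longrightarrow> \<mu> x \<le> c \<longleftrightarrow> (\<exists>j<M. f x j \<le> c)"
    and c: "c \<le> N"
  shows "feasible adj consistent M A f c \<longleftrightarrow> (\<Sum>x\<in>A. \<mu> x) \<le> c"
proof
  assume "feasible adj consistent M A f c"
  then obtain g where g: "\<forall>y\<in>A. g y < M" "(\<Sum>y\<in>A. f y (g y)) \<le> c"
    unfolding feasible_def by blast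
  have "\<mu> x \<le> f x (g x)" if "x \<in> A" for x
  proof -
    have "f x (g x) \<le> N" using member_le_sum[OF that, of "\<lambda>y. f y (g y)"] assms(1) g(2) c by simp
    then show ?thesis using mu[OF that] g(1) that by blast
  qed
  then have "(\<Sum>x\<in>A. \<mu> x) \<le> (\<Sum>x\<in>A. f x (g x))" by (rule sum_mono)
  then show "(\<Sum>x\<in>A. \<mu> x) \<le> c" using g(2) by simp
next
  assume le: "(\<Sum>x\<in>A. \<mu> x) \<le> c"
  have "\<exists>j<M. f x j \<le> \<mu> x" if "x \<in> A" for x
  proof -
    have "\<mu> x \<le> N" using member_le_sum[OF that, of \<mu>] assms(1) le c by simp
    then show ?thesis using mu[OF that, of "\<mu> x"] by simp
  qed
  then obtain g where g: "\<And>x. x \<in> A \<Longrightarrow> g x < M \<and> f x (g x) \<le> \<mu> x" by metis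
  have "(\<Sum>x\<in>A. f x (g x)) \<le> (\<Sum>x\<in>A. \<mu> x)" using g by (intro sum_mono) auto
  then show "feasible adj consistent M A f c"
    unfolding feasible_def using g le assms(2) by (intro exI[of _ g]) auto
qed

text \<open>The thresholds violating an upward closed \<open>Q\<close> form an initial segment,
  whose length is the least solution, or \<open>N + 1\<close> if there is none up to
  \<open>N\<close>. This is how bounded sums express minima, and also the maximum degree.\<close>

lemma truncated_minimum_le_iff:
  fixes c N :: nat
  assumes mono: "\<And>c d. Q c \<Longrightarrow> c \<le> d \<Longrightarrow> Q d" and c: "c \<le> N"
  shows "(\<Sum>d<Suc N. of_bool (\<not> Q d)) \<le> c \<longleftrightarrow> Q c"
proof -
  have eq: "(\<Sum>d<Suc N. of_bool (\<not> Q d)) = card ({..<Suc N} \<inter> {d. \<not> Q d})"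
    by (simp add: of_bool_def sum.If_cases del: sum.lessThan_Suc)
  show ?thesis
  proof
    assume le: "(\<Sum>d<Suc N. of_bool (\<not> Q d)) \<le> c"
    show "Q c"
    proof (rule ccontr)
      assume "\<not> Q c"
      then have "{..c} \<subseteq> {..<Suc N} \<inter> {d. \<not> Q d}" using mono c by auto
      from card_mono[OF _ this] le eq show False by simp
    qed
  next
    assume "Q c"
    then have "{..<Suc N} \<inter> {d. \<not> Q d} \<subseteq> {..<c}"
      using mono[of c] by (auto simp: not_le[symmetric])
    from card_mono[OF _ this] show "(\<Sum>d<Suc N. of_bool (\<not> Q d)) \<le> c" using eq by simp
  qed
qed


section \<open>Vertex sets as digit strings\<close>

definition digit :: "nat \<Rightarrow> nat \<Rightarrow> nat \<Rightarrow> nat" where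
  "digit n j i = j div n ^ i mod n"

text \<open>Since digits may repeat, the numbers below \<open>n ^ l\<close> stand for the nonempty sets of at most \<open>l\<close>
  vertices.\<close>

definition digit_set :: "nat \<Rightarrow> nat \<Rightarrow> nat \<Rightarrow> nat set" where
  "digit_set n l j = digit n j ` {..<l}"

lemma digit_set_subset: "0 < n \<Longrightarrow> digit_set n l j \<subseteq> {..<n}"
  by (auto simp: digit_set_def digit_def)

lemma ex_number_with_digits:
  "set xs \<subseteq> {..<n} \<Longrightarrow> \<exists>j<n ^ length xs. \<forall>i<length xs. digit n j i = xs ! i"
proof (induction xs)
  case (Cons x xs)
  then obtain j where j: "j < n ^ length xs" "\<And>i. i < length xs \<Longrightarrow> digit n j i = xs ! i" by auto
  have x: "x < n" using Cons.prems by simp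
  have "digit n (x + n * j) i = (x # xs) ! i" if "i < length (x # xs)" for i
  proof (cases i)
    case (Suc k)
    have "(x + n * j) div n ^ Suc k = j div n ^ k"
      using x by (simp add: div_mult2_eq)
    then show ?thesis using j(2)[of k] that Suc by (simp add: digit_def)
  qed (use x in \<open>simp add: digit_def\<close>)
  moreover have "x + n * j < n ^ length (x # xs)"
  proof -
    have "x + n * j < n * Suc j" using x by simp
    also have "\<dots> \<le> n * n ^ length xs" using j(1) by (intro mult_left_mono) auto
    finally show ?thesis by simp
  qed
  ultimately show ?case by blast
qed simp

lemma ex_digit_set:
  assumes "D \<subseteq> {..<n}" "D \<noteq> {}" "card D \<le> l"
  shows "\<exists>j<n ^ l. digit_set n l j = D"
proof -
  have "finite D" using assms(1) finite_subset by blast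
  then obtain ys where ys: "set ys = D" "length ys = card D"
    by (metis finite_distinct_list distinct_card)
  obtain d where d: "d \<in> D" using assms(2) by auto
  \<comment> \<open>A repeated element pads the list to length exactly \<open>l\<close>; this needs
    \<open>D\<close> to be nonempty.\<close>
  define xs where "xs = ys @ replicate (l - card D) d"
  have xs: "set xs = D" "length xs = l" using ys d assms(3) by (auto simp: xs_def)
  obtain j where j: "j < n ^ l" "\<forall>i<l. digit n j i = xs ! i"
    using ex_number_with_digits[of xs n] xs assms(1) by auto
  have "digit_set n l j = (!) xs ` {..<l}" using j(2) unfolding digit_set_def by (intro image_cong) auto
  also have "\<dots> = D" using xs by (auto simp: set_conv_nth)
  finally show ?thesis using j(1) by blast
qed


section \<open>Domination as a constraint problem on the decomposition tree\<close>

text \<open>Acyclicity enters as \<open>ex_leaf\<close>: every set of nodes that spans an edge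
  contains a node with exactly one neighbour in the set. This is the form that leaf elimination
  consumes.\<close>

locale tree_partition =
  fixes n m :: nat and near adj :: "nat \<Rightarrow> nat \<Rightarrow> bool" and C :: "nat \<Rightarrow> nat set"
  assumes n_pos: "0 < n"
    and C_subset: "x < m \<Longrightarrow> C x \<subseteq> {..<n}"
    and C_nonempty: "x < m \<Longrightarrow> C x \<noteq> {}"
    and C_disjoint: "x < m \<Longrightarrow> y < m \<Longrightarrow> u \<in> C x \<Longrightarrow> u \<in> C y \<Longrightarrow> x = y"
    and C_cover: "u < n \<Longrightarrow> \<exists>x<m. u \<in> C x"
    and near_refl: "u < n \<Longrightarrow> near u u"
    and near_adj: "x < m \<Longrightarrow> y < m \<Longrightarrow> u \<in> C x \<Longrightarrow> v \<in> C y \<Longrightarrow> near u v \<Longrightarrow> x = y \<or> adj x y"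
    and adj_less: "adj x y \<Longrightarrow> x < m"
    and adj_sym: "adj x y \<Longrightarrow> adj y x"
    and adj_irrefl: "\<not> adj x x"
    and ex_leaf: "A \<subseteq> {..<m} \<Longrightarrow> x \<in> A \<Longrightarrow> y \<in> A \<Longrightarrow> adj x y \<Longrightarrow>
      \<exists>x\<in>A. \<exists>p\<in>A. adj x p \<and> (\<forall>q\<in>A. adj x q \<longrightarrow> q = p)"
begin

definition dominates :: "nat set \<Rightarrow> nat set \<Rightarrow> bool" where
  "dominates D A \<longleftrightarrow> D \<subseteq> {..<n} \<and> (\<forall>u\<in>A. \<exists>d\<in>D. near u d)"

definition closed_nbhd :: "nat \<Rightarrow> nat set" where
  "closed_nbhd x = insert x {y. adj x y}"

lemma adj_less': "adj x y \<Longrightarrow> y < m"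
  using adj_less adj_sym by blast

lemma finite_adj [simp]: "finite {y. adj x y}"
  by (rule finite_subset[of _ "{..<m}"]) (auto dest: adj_less')

lemma finite_C: "x < m \<Longrightarrow> finite (C x)"
  using C_subset finite_subset by blast

lemma finite_closed_nbhd [simp]: "finite (closed_nbhd x)"
  by (simp add: closed_nbhd_def)

lemma closed_nbhd_less: "x < m \<Longrightarrow> y \<in> closed_nbhd x \<Longrightarrow> y < m"
  by (auto simp: closed_nbhd_def dest: adj_less')

text \<open>If \<open>D\<close> had more elements in \<open>C x\<close>, they could be exchanged for small sets that dominate
  \<open>C y\<close> for the nodes \<open>y\<close> around \<open>x\<close>.\<close>

lemma minimum_dominating_bag:
  assumes D: "dominates D {..<n}" "\<And>D'. dominates D' {..<n} \<Longrightarrow> card D \<le> card D'"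
    and W: "\<And>x. x < m \<Longrightarrow> \<exists>D. dominates D (C x) \<and> card D \<le> W"
    and deg: "\<And>x. x < m \<Longrightarrow> card {y. adj x y} < d"
    and x: "x < m"
  shows "card (D \<inter> C x) \<le> W * d"
proof (rule ccontr)
  assume gt: "\<not> card (D \<inter> C x) \<le> W * d"
  obtain E where E: "\<And>y. y < m \<Longrightarrow> dominates (E y) (C y) \<and> card (E y) \<le> W" using W by metis
  let ?E = "\<Union>y\<in>closed_nbhd x. E y"
  let ?D = "(D - C x) \<union> ?E"
  have finD: "finite D" using D(1) finite_subset unfolding dominates_def by blast
  have "card ?E \<le> (\<Sum>y\<in>closed_nbhd x. card (E y))" by (rule card_UN_le) simp
  also have "\<dots> \<le> of_nat (card (closed_nbhd x)) * W"
    using E closed_nbhd_less[OF x] by (intro sum_bounded_above) auto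
  \<comment> \<open>The strict bound \<open>d\<close> on the degree also bounds the closed
    neighbourhood, which has one node more.\<close>
  also have "\<dots> \<le> d * W"
    using deg[OF x] by (intro mult_right_mono) (auto simp: closed_nbhd_def adj_irrefl)
  finally have cE: "card ?E \<le> W * d" by (simp add: mult.commute)
  have "dominates ?D {..<n}"
    unfolding dominates_def
  proof (intro conjI ballI)
    show "?D \<subseteq> {..<n}" using D(1) E closed_nbhd_less[OF x] unfolding dominates_def by blast
    fix u assume "u \<in> {..<n}"
    then obtain z e where z: "z < m" "u \<in> C z" and e: "e \<in> D" "near u e"
      using C_cover D(1) unfolding dominates_def by blast
    show "\<exists>e\<in>?D. near u e"
    proof (cases "e \<in> C x")
      case True
      then have "z = x \<or> adj z x" using near_adj z x e by blast
      then have "z \<in> closed_nbhd x" using adj_sym by (auto simp: closed_nbhd_def)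
      then show ?thesis using E[OF z(1)] z(2) unfolding dominates_def by blast
    qed (use e in blast)
  qed
  then have "card D \<le> card ?D" using D(2) by blast
  also have "\<dots> \<le> card (D - C x) + card ?E" by (rule card_Un_le)
  also have "card (D - C x) + card (D \<inter> C x) = card D"
    using finD by (metis card_Int_Diff add.commute)
  then have "card (D - C x) + card ?E < card D" using cE gt by linarith
  finally show False by simp
qed

definition valid :: "nat \<Rightarrow> nat \<Rightarrow> nat \<Rightarrow> bool" where
  "valid l x j \<longleftrightarrow> (\<forall>u\<in>C x. \<exists>d\<in>digit_set n l j. near u d)"

text \<open>The cost \<open>n + 1\<close> acts as infinity, because the domination number is at most \<open>n\<close>.\<close>

definition weight :: "nat \<Rightarrow> nat \<Rightarrow> nat \<Rightarrow> nat" where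
  "weight l x j = (if valid l x j then card (C x \<inter> digit_set n l j) else Suc n)"

text \<open>For adjacent nodes of a tree the two bags are all that their closed neighbourhoods
  share.\<close>

definition consistent :: "nat \<Rightarrow> nat \<Rightarrow> nat \<Rightarrow> nat \<Rightarrow> nat \<Rightarrow> bool" where
  "consistent l x y j k \<longleftrightarrow> (\<forall>v\<in>C x \<union> C y. v \<in> digit_set n l j \<longleftrightarrow> v \<in> digit_set n l k)"

lemma consistent_sym: "consistent l x y j k \<Longrightarrow> consistent l y x k j"
  by (auto simp: consistent_def)

lemma card_by_bags:
  assumes "D \<subseteq> {..<n}"
  shows "card D = (\<Sum>x<m. card (C x \<inter> D))"
proof -
  have "D = (\<Union>x<m. C x \<inter> D)" using assms C_cover by fastforce
  moreover have "card (\<Union>x<m. C x \<inter> D) = (\<Sum>x<m. card (C x \<inter> D))"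
    by (rule card_UN_disjoint) (auto simp: finite_C dest: C_disjoint)
  ultimately show ?thesis by simp
qed

text \<open>Each local set contributes only its part in its own bag, so the costs add up without
  double counting. A dominator chosen at \<open>x\<close> may lie in an adjacent bag
  \<open>C y\<close>; consistency puts it into the set at \<open>y\<close>, where it is kept. The
  assumption \<open>c \<le> n\<close> rules out the cost \<open>n + 1\<close> of invalid
  codes.\<close>

lemma feasible_weight_imp_dominating:
  assumes "feasible adj (consistent l) (n ^ l) {..<m} (weight l) c" "c \<le> n"
  shows "\<exists>D. dominates D {..<n} \<and> card D \<le> c"
proof -
  obtain g where g: "\<And>x y. x < m \<Longrightarrow> y < m \<Longrightarrow> adj x y \<Longrightarrow> consistent l x y (g x) (g y)"
    "(\<Sum>x<m. weight l x (g x)) \<le> c" using assms(1) unfolding feasible_def by auto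
  let ?S = "\<lambda>x. digit_set n l (g x)"
  let ?D = "\<Union>x<m. C x \<inter> ?S x"
  have valid: "valid l x (g x)" if "x < m" for x
    using member_le_sum[of x "{..<m}" "\<lambda>x. weight l x (g x)"] that g(2) assms(2)
    by (auto simp: weight_def split: if_splits)
  have "card ?D \<le> (\<Sum>x<m. card (C x \<inter> ?S x))" by (rule card_UN_le) simp
  also have "\<dots> = (\<Sum>x<m. weight l x (g x))" using valid by (intro sum.cong) (auto simp: weight_def)
  finally have "card ?D \<le> c" using g(2) by simp
  moreover have "dominates ?D {..<n}"
    unfolding dominates_def
  proof (intro conjI ballI)
    show "?D \<subseteq> {..<n}" using C_subset by blast
    fix u assume "u \<in> {..<n}"
    then obtain x where x: "x < m" "u \<in> C x" using C_cover by auto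
    then obtain d where d: "d \<in> ?S x" "near u d" using valid unfolding valid_def by blast
    obtain y where y: "y < m" "d \<in> C y" using C_cover d(1) digit_set_subset[OF n_pos] by blast
    have "d \<in> ?S y" using near_adj[OF x(1) y(1) x(2) y(2) d(2)] g(1)[OF x(1) y(1)] d(1) y(2)
      by (auto simp: consistent_def)
    then show "\<exists>d\<in>?D. near u d" using y d(2) by blast
  qed
  ultimately show ?thesis by blast
qed

text \<open>The given \<open>D\<close> may be too crowded in some bag, so a minimum dominating set
  \<open>M\<close> is restricted to the closed neighbourhoods instead: at most \<open>d\<close> bags
  with at most \<open>W * d\<close> elements each.\<close>

lemma dominating_imp_feasible_weight:
  assumes D: "dominates D {..<n}" "card D \<le> c"
    and W: "\<And>x. x < m \<Longrightarrow> \<exists>D. dominates D (C x) \<and> card D \<le> W"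
    and deg: "\<And>x. x < m \<Longrightarrow> card {y. adj x y} < d"
    and l: "l = W * (d * d)"
  shows "feasible adj (consistent l) (n ^ l) {..<m} (weight l) c"
proof -
  obtain M where M: "dominates M {..<n}" "\<And>D'. dominates D' {..<n} \<Longrightarrow> card M \<le> card D'"
    using ex_has_least_nat[of "\<lambda>D. dominates D {..<n}" D card] D(1) by blast
  have M_n: "M \<subseteq> {..<n}" using M(1) by (simp add: dominates_def)
  let ?M = "\<lambda>x. M \<inter> (\<Union>y\<in>closed_nbhd x. C y)"
  have dom: "\<exists>e\<in>?M x. near u e" if "x < m" "u \<in> C x" for x u
  proof -
    have "u \<in> {..<n}" using C_subset[OF that(1)] that(2) by auto
    then obtain e where e: "e \<in> M" "near u e" using M(1) unfolding dominates_def by blast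
    then obtain y where y: "y < m" "e \<in> C y" using C_cover M_n by blast
    then have "y \<in> closed_nbhd x"
      using near_adj[OF that(1) y(1) that(2) y(2) e(2)] by (auto simp: closed_nbhd_def)
    then show ?thesis using e y by blast
  qed
  have "\<exists>j<n ^ l. digit_set n l j = ?M x" if x: "x < m" for x
  proof (rule ex_digit_set)
    show "?M x \<subseteq> {..<n}" using M_n by blast
    \<comment> \<open>Codes stand for nonempty sets only; a nonempty bag has a dominator.\<close>
    show "?M x \<noteq> {}" using dom[OF x] C_nonempty[OF x] by blast
    have "?M x = (\<Union>y\<in>closed_nbhd x. M \<inter> C y)" by blast
    also have "card \<dots> \<le> (\<Sum>y\<in>closed_nbhd x. card (M \<inter> C y))" by (rule card_UN_le) simp
    also have "\<dots> \<le> of_nat (card (closed_nbhd x)) * (W * d)"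
      using minimum_dominating_bag[OF M W deg] closed_nbhd_less[OF x]
      by (intro sum_bounded_above) auto
    also have "\<dots> \<le> d * (W * d)"
      using deg[OF x] by (intro mult_right_mono) (auto simp: closed_nbhd_def adj_irrefl)
    finally show "card (?M x) \<le> l" by (simp add: l ac_simps)
  qed
  then obtain g where g: "\<And>x. x < m \<Longrightarrow> g x < n ^ l \<and> digit_set n l (g x) = ?M x" by metis
  have bag: "C x \<inter> ?M x = C x \<inter> M" if "x < m" for x by (auto simp: closed_nbhd_def)
  have "(\<Sum>x<m. weight l x (g x)) = (\<Sum>x<m. card (C x \<inter> M))"
  proof (intro sum.cong refl)
    fix x assume "x \<in> {..<m}"
    then have x: "x < m" by simp
    have "valid l x (g x)" using dom[OF x] g[OF x] by (simp add: valid_def)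
    then show "weight l x (g x) = card (C x \<inter> M)" using g[OF x] bag[OF x] by (simp add: weight_def)
  qed
  also have "\<dots> = card M" using card_by_bags[OF M_n] by simp
  also have "\<dots> \<le> c" using M(2)[OF D(1)] D(2) by simp
  finally have "(\<Sum>x<m. weight l x (g x)) \<le> c" .
  moreover have "consistent l x y (g x) (g y)" if "x < m" "y < m" "adj x y" for x y
    using that g adj_sym by (auto simp: consistent_def closed_nbhd_def)
  ultimately show ?thesis unfolding feasible_def using g by (intro exI[of _ g]) auto
qed

text \<open>Makes the search for the width an enumeration of codes. The empty set, which has no code
  of positive length, cannot dominate a nonempty bag.\<close>

lemma ex_valid_iff:
  assumes "x < m"
  shows "(\<exists>j<n ^ w. valid w x j) \<longleftrightarrow> (\<exists>D. dominates D (C x) \<and> card D \<le> w)"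
proof
  assume "\<exists>j<n ^ w. valid w x j"
  then obtain j where "valid w x j" by blast
  then have "dominates (digit_set n w j) (C x)"
    using digit_set_subset[OF n_pos] by (simp add: dominates_def valid_def)
  moreover have "card (digit_set n w j) \<le> w"
    using card_image_le[of "{..<w}" "digit n j"] by (simp add: digit_set_def)
  ultimately show "\<exists>D. dominates D (C x) \<and> card D \<le> w" by blast
next
  assume "\<exists>D. dominates D (C x) \<and> card D \<le> w"
  then obtain D where D: "dominates D (C x)" "card D \<le> w" by blast
  then have "D \<noteq> {}" using C_nonempty[OF assms] by (auto simp: dominates_def)
  with D obtain j where "j < n ^ w" "digit_set n w j = D"
    using ex_digit_set[of D n w] by (auto simp: dominates_def)
  with D show "\<exists>j<n ^ w. valid w x j" by (auto simp: valid_def dominates_def)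
qed

text \<open>The width of the decomposition, in the form in which the program tests
  candidates.\<close>

definition bag_width :: nat where
  "bag_width = (LEAST w. \<forall>x<m. \<exists>D. dominates D (C x) \<and> card D \<le> w)"

lemma dominates_all: "A \<subseteq> {..<n} \<Longrightarrow> dominates {..<n} A"
  using near_refl by (auto simp: dominates_def)

lemma dominates_bag_width: "x < m \<Longrightarrow> \<exists>D. dominates D (C x) \<and> card D \<le> bag_width"
proof -
  have "\<forall>x<m. \<exists>D. dominates D (C x) \<and> card D \<le> n"
    using dominates_all C_subset by (metis card_lessThan order_refl)
  then have "\<forall>x<m. \<exists>D. dominates D (C x) \<and> card D \<le> bag_width"
    unfolding bag_width_def by (rule LeastI)
  then show "x < m \<Longrightarrow> \<exists>D. dominates D (C x) \<and> card D \<le> bag_width" by blast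
qed

lemma bag_width_le:
  "(\<And>x. x < m \<Longrightarrow> \<exists>D. dominates D (C x) \<and> card D \<le> w) \<Longrightarrow> bag_width \<le> w"
  unfolding bag_width_def by (rule Least_le) blast

lemma bag_width_le_n: "bag_width \<le> n"
  using dominates_all C_subset by (intro bag_width_le) (metis card_lessThan order_refl)

text \<open>Gives \<open>0 < k\<close> in the end, so that additive constants in the exponent can be
  absorbed by a multiple of \<open>k\<close>.\<close>

lemma bag_width_pos: "0 < m \<Longrightarrow> 0 < bag_width"
proof (rule ccontr)
  assume m: "0 < m" and "\<not> 0 < bag_width"
  with dominates_bag_width[OF m] obtain D where D: "dominates D (C 0)" "card D = 0" by auto
  then have "D = {}" by (auto simp: dominates_def dest: finite_subset)
  with D C_nonempty[OF m] show False by (auto simp: dominates_def)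
qed

text \<open>One vertex chosen from each bag gives an injection, because the bags are disjoint and
  nonempty.\<close>

lemma m_le_n: "m \<le> n"
proof -
  have "\<exists>u. u \<in> C x" if "x < m" for x using C_nonempty[OF that] by blast
  then obtain f where f: "\<And>x. x < m \<Longrightarrow> f x \<in> C x" by metis
  have "inj_on f {..<m}" using f by (intro inj_onI) (metis C_disjoint lessThan_iff)
  moreover have "f ` {..<m} \<subseteq> {..<n}" using f C_subset by blast
  ultimately show ?thesis using card_inj_on_le[of f "{..<m}" "{..<n}"] by simp
qed

text \<open>The maximum degree, as the number of thresholds exceeded by some degree. Thresholds
  below \<open>m\<close> are enough because every degree is less than \<open>m\<close>.\<close>

definition max_adj :: nat where
  "max_adj = (\<Sum>c<m. of_bool (\<exists>x<m. c < card {y. adj x y}))"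

lemma card_adj_less: "x < m \<Longrightarrow> card {y. adj x y} < m"
proof -
  assume x: "x < m"
  have "{y. adj x y} \<subseteq> {..<m} - {x}" using adj_less' adj_irrefl by auto
  then have "card {y. adj x y} \<le> card ({..<m} - {x})" by (rule card_mono[rotated]) simp
  then show ?thesis using x by simp
qed

lemma max_adj_le_iff:
  assumes "c < m"
  shows "max_adj \<le> c \<longleftrightarrow> (\<forall>x<m. card {y. adj x y} \<le> c)"
proof -
  have "max_adj = (\<Sum>d<Suc (m - 1). of_bool (\<not> (\<forall>x<m. card {y. adj x y} \<le> d)))"
    using assms by (simp add: max_adj_def not_le)
  also have "\<dots> \<le> c \<longleftrightarrow> (\<forall>x<m. card {y. adj x y} \<le> c)"
    by (rule truncated_minimum_le_iff) (use assms le_trans in auto)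
  finally show ?thesis .
qed

lemma max_adj_less: "0 < m \<Longrightarrow> max_adj < m"
proof -
  assume m: "0 < m"
  then have "\<forall>x<m. card {y. adj x y} \<le> m - 1" using card_adj_less by fastforce
  then have "max_adj \<le> m - 1" using max_adj_le_iff[of "m - 1"] m by simp
  then show "max_adj < m" using m by simp
qed

lemma card_adj_le_max_adj: "x < m \<Longrightarrow> card {y. adj x y} < Suc max_adj"
  using max_adj_le_iff[OF max_adj_less] by (simp add: less_Suc_eq_le)

lemma max_adj_le: "0 < m \<Longrightarrow> (\<And>x. x < m \<Longrightarrow> card {y. adj x y} \<le> c) \<Longrightarrow> max_adj \<le> c"
  using max_adj_le_iff[of c] max_adj_less by (cases "c < m") auto

text \<open>One factor \<open>Suc max_adj\<close> counts the bags of a closed neighbourhood, the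
  other comes from the exchange bound for a single bag.\<close>

definition set_size :: nat where
  "set_size = bag_width * (Suc max_adj * Suc max_adj)"

text \<open>Tells how many powers of \<open>n\<close> to tabulate before the width and the degree
  are known.\<close>

lemma set_size_le: "0 < m \<Longrightarrow> set_size \<le> n * (n * n)"
  unfolding set_size_def using bag_width_le_n max_adj_less m_le_n by (intro mult_mono) auto

lemma bag_width_le_set_size: "bag_width \<le> set_size"
  by (simp add: set_size_def)

lemma feasible_weight_iff:
  assumes "c \<le> n"
  shows "feasible adj (consistent set_size) (n ^ set_size) {..<m} (weight set_size) c \<longleftrightarrow>
    (\<exists>D. dominates D {..<n} \<and> card D \<le> c)"
proof
  assume "\<exists>D. dominates D {..<n} \<and> card D \<le> c"
  then obtain D where "dominates D {..<n}" "card D \<le> c" by blast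
  then show "feasible adj (consistent set_size) (n ^ set_size) {..<m} (weight set_size) c"
    by (rule dominating_imp_feasible_weight
        [OF _ _ dominates_bag_width card_adj_le_max_adj set_size_def])
qed (rule feasible_weight_imp_dominating[OF _ assms])

end

section \<open>Distances, cycles and degrees\<close>

lemma awalk_iff_relpow:
  assumes "pair_wf_digraph G" "u \<in> pverts G"
  shows "(\<exists>p. pre_digraph.awalk (with_proj G) u p v \<and> length p = l) \<longleftrightarrow> (u, v) \<in> parcs G ^^ l"
  using assms(2)
proof (induction l arbitrary: u)
  case 0
  interpret pair_wf_digraph G by fact
  show ?case using 0 by (auto simp: awalk_Nil_iff)
next
  case (Suc l)
  interpret pair_wf_digraph G by fact
  show ?case
  proof
    assume "\<exists>p. awalk u p v \<and> length p = Suc l"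
    then obtain e p where e: "awalk u (e # p) v" "length p = l" by (auto simp: length_Suc_conv)
    then have "e \<in> parcs G" "fst e = u" "awalk (snd e) p v" by (auto simp: awalk_Cons_iff)
    moreover from this have "(snd e, v) \<in> parcs G ^^ l"
      using Suc.IH[of "snd e"] e(2) arc_snd_in_verts by blast
    ultimately show "(u, v) \<in> parcs G ^^ Suc l" by (metis prod.collapse relpow_Suc_I2)
  next
    assume "(u, v) \<in> parcs G ^^ Suc l"
    then obtain w where w: "(u, w) \<in> parcs G" "(w, v) \<in> parcs G ^^ l" by (meson relpow_Suc_D2)
    then obtain p where "awalk w p v" "length p = l" using Suc.IH[of w] in_arcsD2 by blast
    with w(1) have "awalk u ((u, w) # p) v \<and> length ((u, w) # p) = Suc l"
      by (simp add: awalk_Cons_iff)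
    then show "\<exists>p. awalk u p v \<and> length p = Suc l" by blast
  qed
qed

lemma gdist_le_iff:
  assumes "pair_wf_digraph G" "u \<in> pverts G"
  shows "gdist G u v \<le> ereal (real r) \<longleftrightarrow> (\<exists>l\<le>r. (u, v) \<in> parcs G ^^ l)"
proof -
  interpret pair_wf_digraph G by fact
  have cost: "awalk_cost (\<lambda>_. 1) p = real (length p)" for p
    by (induction p) auto
  have gdist: "gdist G u v = (INF p\<in>{p. awalk u p v}. ereal (real (length p)))"
    unfolding gdist_def \<mu>_def cost ..
  show ?thesis
  proof
    assume le: "gdist G u v \<le> ereal (real r)"
    have "\<exists>p. awalk u p v \<and> length p \<le> r"
    proof (rule ccontr)
      assume "\<nexists>p. awalk u p v \<and> length p \<le> r"
      \<comment> \<open>Lengths are integers, so a walk longer than \<open>r\<close> has length at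
        least \<open>Suc r\<close>; this gap survives the infimum.\<close>
      then have "ereal (real (Suc r)) \<le> gdist G u v"
        unfolding gdist by (intro INF_greatest) (auto simp: not_le)
      with le have "ereal (real (Suc r)) \<le> ereal (real r)" by (rule order_trans[rotated])
      then show False by simp
    qed
    then show "\<exists>l\<le>r. (u, v) \<in> parcs G ^^ l" using awalk_iff_relpow[OF assms] by blast
  next
    assume "\<exists>l\<le>r. (u, v) \<in> parcs G ^^ l"
    then obtain p where "awalk u p v" "length p \<le> r" using awalk_iff_relpow[OF assms] by metis
    then show "gdist G u v \<le> ereal (real r)" unfolding gdist by (auto intro!: INF_lower2[of p])
  qed
qed

definition within_steps :: "('a \<times> 'a) set \<Rightarrow> nat \<Rightarrow> 'a \<Rightarrow> 'a \<Rightarrow> bool" where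
  "within_steps E t u v \<longleftrightarrow> (\<exists>l\<le>t. (u, v) \<in> E ^^ l)"

lemma within_steps_0 [simp]: "within_steps E 0 u v \<longleftrightarrow> u = v"
  by (simp add: within_steps_def)

lemma within_steps_Suc:
  "within_steps E (Suc t) u v \<longleftrightarrow> (\<exists>w. within_steps E t u w \<and> (w = v \<or> (w, v) \<in> E))"
proof
  assume "within_steps E (Suc t) u v"
  then obtain l where l: "l \<le> Suc t" "(u, v) \<in> E ^^ l" by (auto simp: within_steps_def)
  show "\<exists>w. within_steps E t u w \<and> (w = v \<or> (w, v) \<in> E)"
  proof (cases l)
    case 0
    then show ?thesis using l by (auto simp: within_steps_def intro!: exI[of _ 0])
  next
    case (Suc k)
    then obtain w where "(u, w) \<in> E ^^ k" "(w, v) \<in> E" using l(2) by (meson relpow_Suc_E)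
    then show ?thesis using l(1) Suc by (auto simp: within_steps_def)
  qed
next
  assume "\<exists>w. within_steps E t u w \<and> (w = v \<or> (w, v) \<in> E)"
  then obtain w l where w: "l \<le> t" "(u, w) \<in> E ^^ l" "w = v \<or> (w, v) \<in> E"
    by (auto simp: within_steps_def)
  then show "within_steps E (Suc t) u v"
    unfolding within_steps_def by (metis Suc_le_mono le_SucI relpow_Suc_I)
qed

text \<open>The running time must not depend on \<rho>. In a finite relation, connected pairs are
  connected by at most as many steps as there are arcs, so \<rho> can be capped.\<close>

lemma within_steps_truncate:
  assumes "finite E" "card E \<le> K"
  shows "within_steps E (min t K) u v \<longleftrightarrow> within_steps E t u v"
proof
  assume "within_steps E t u v"
  then obtain l where l: "l \<le> t" "(u, v) \<in> E ^^ l" by (auto simp: within_steps_def)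
  show "within_steps E (min t K) u v"
  proof (cases "l \<le> K")
    case False
    obtain k where "k \<le> card E" "(u, v) \<in> E ^^ k"
      using relpow_finite_bounded[OF assms(1), of l] l(2) by auto
    moreover from this have "k \<le> min t K" using assms(2) l(1) False by simp
    ultimately show ?thesis by (auto simp: within_steps_def)
  qed (use l in \<open>auto simp: within_steps_def\<close>)
qed (auto simp: within_steps_def)

text \<open>Passes from vertex lists, which suit the longest path argument, to the arc lists by
  which the library describes cycles: each vertex is paired with its cyclic successor.\<close>

lemma ex_cycle_of_cyclic_list:
  assumes "pair_wf_digraph T"
    and xs: "successively (\<lambda>x y. (x, y) \<in> parcs T) xs" "distinct xs" "xs \<noteq> []"
      "(last xs, hd xs) \<in> parcs T"
  shows "\<exists>p. pre_digraph.cycle (with_proj T) p \<and> length p = length xs"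
proof -
  interpret pair_wf_digraph T by fact
  let ?p = "\<lambda>v xs. zip xs (tl xs @ [v])"
  have walk: "set (?p v xs) \<subseteq> parcs T \<and> pcas (hd xs) (?p v xs) v \<and>
      pawalk_verts (hd xs) (?p v xs) = xs @ [v]"
    if "successively (\<lambda>x y. (x, y) \<in> parcs T) xs" "xs \<noteq> []" "(last xs, v) \<in> parcs T" for v xs
    using that
  proof (induction xs)
    case (Cons x xs)
    then show ?case by (cases xs) auto
  qed simp
  let ?q = "?p (hd xs) xs"
  have "awalk (hd xs) ?q (hd xs)"
    using walk[OF xs(1,3,4)] in_arcsD2[OF xs(4)] by (simp add: awalk_def)
  moreover have "distinct (tl (awalk_verts (hd xs) ?q))"
    using walk[OF xs(1,3,4)] xs(2,3) by (cases xs) auto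
  moreover have "?q \<noteq> []" using xs(3) by (cases xs) auto
  ultimately have "cycle ?q" unfolding cycle_def by blast
  moreover have "length ?q = length xs" using xs(3) by simp
  ultimately show ?thesis by blast
qed

text \<open>An end of a longest path is a leaf.\<close>

lemma ex_leaf_if_no_cyclic_list:
  assumes "finite A" and sym: "\<And>x y. E x y \<Longrightarrow> E y x" and irrefl: "\<And>x. \<not> E x x"
    and no_cycle: "\<And>xs. successively E xs \<Longrightarrow> distinct xs \<Longrightarrow> 3 \<le> length xs \<Longrightarrow>
      E (last xs) (hd xs) \<Longrightarrow> False"
    and xy: "x \<in> A" "y \<in> A" "E x y"
  shows "\<exists>x\<in>A. \<exists>p\<in>A. E x p \<and> (\<forall>q\<in>A. E x q \<longrightarrow> q = p)"
proof -
  define P where "P xs \<longleftrightarrow> successively E xs \<and> distinct xs \<and> set xs \<subseteq> A" for xs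
  have bound: "length xs \<le> card A" if "P xs" for xs
    using that assms(1) card_mono[of A "set xs"] by (simp add: P_def distinct_card)
  have Pxy: "P [x, y]" using xy irrefl by (auto simp: P_def)
  have "\<exists>xs. P xs \<and> (\<forall>ys. P ys \<longrightarrow> length ys \<le> length xs)"
    by (rule ex_has_greatest_nat[of P "[x, y]" length "Suc (card A)"])
      (use Pxy bound in \<open>auto simp: less_Suc_eq_le\<close>)
  then obtain xs where xs: "P xs" and max: "\<And>ys. P ys \<Longrightarrow> length ys \<le> length xs"
    by auto
  have "2 \<le> length xs" using max[OF Pxy] by simp
  then obtain a b zs where xs_eq: "xs = a # b # zs"
    by (cases xs; cases "tl xs") auto
  have ab: "a \<in> A" "b \<in> A" "E a b" using xs by (auto simp: P_def xs_eq)
  have "q = b" if q: "q \<in> A" "E a q" for q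
  proof (rule ccontr)
    assume ne: "q \<noteq> b"
    have "q \<in> set xs"
    proof (rule ccontr)
      assume "q \<notin> set xs"
      then have "P (q # xs)" using xs q sym by (auto simp: P_def xs_eq)
      from max[OF this] show False by simp
    qed
    then obtain i where i: "i < length xs" "xs ! i = q" by (meson in_set_conv_nth)
    have "i \<noteq> 0" using i q(2) irrefl by (cases i) (auto simp: xs_eq)
    moreover have "i \<noteq> 1" using i ne by (auto simp: xs_eq)
    ultimately have i2: "2 \<le> i" by linarith
    \<comment> \<open>By maximality \<open>q\<close> lies on the path. The part from
      \<open>a\<close> to \<open>q\<close> closes up to a cycle, with at least three vertices
      because \<open>i\<close> is at least 2.\<close>
    let ?ys = "take (Suc i) xs"
    have "successively E (?ys @ drop (Suc i) xs)" using xs by (simp add: P_def)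
    then have "successively E ?ys" by (simp only: successively_append_iff)
    moreover have "last ?ys = q" using i by (simp add: take_Suc_conv_app_nth)
    moreover have "hd ?ys = a" by (simp add: xs_eq)
    moreover have "distinct ?ys" "3 \<le> length ?ys" using xs i i2 by (auto simp: P_def)
    ultimately show False using no_cycle[of ?ys] sym q(2) by simp
  qed
  then show ?thesis using ab by blast
qed

lemma out_degree_with_proj:
  "out_degree (with_proj T) x = card {y. (x, y) \<in> parcs T}"
proof -
  have "out_arcs (with_proj T) x = Pair x ` {y. (x, y) \<in> parcs T}"
    by (auto simp: out_arcs_def)
  then show ?thesis by (simp add: out_degree_def card_image inj_on_def)
qed

lemma tree_partition_of_decomposition:
  assumes G: "pair_graph G" "pverts G = {..<n}" and T: "pverts T = {..<m}"
    and dec: "tree_partition_decomposition \<rho> G T C"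
  shows "tree_partition n m (within_steps (parcs G) \<rho>) (\<lambda>x y. (x, y) \<in> parcs T) C" "0 < m"
proof -
  interpret G: pair_graph G by fact
  have tree: "undirected_tree T" and inj: "inj_on C {..<m}"
    and part: "partition_on {..<n} (C ` {..<m})"
    using dec G(2) T by (auto simp: tree_partition_decomposition_def)
  interpret T: pair_graph T using tree by (simp add: undirected_tree_def)
  have near: "gdist G u v \<le> ereal (real \<rho>) \<longleftrightarrow> within_steps (parcs G) \<rho> u v" if "u < n" for u v
    using gdist_le_iff[of G u v \<rho>] that G(2) by (auto simp: within_steps_def)
  have "Digraph_Component.connected (with_proj T)" using tree by (simp add: undirected_tree_def)
  then have "pverts T \<noteq> {}"
    by (auto simp: Digraph_Component.connected_def strongly_connected_def)
  then show m: "0 < m" using T by auto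
  have union: "(\<Union>x<m. C x) = {..<n}" using part by (simp add: partition_on_def)
  have nonempty: "C x \<noteq> {}" if "x < m" for x using part that by (force simp: partition_on_def)
  show "tree_partition n m (within_steps (parcs G) \<rho>) (\<lambda>x y. (x, y) \<in> parcs T) C"
  proof
    show "0 < n" using nonempty[OF m] m union by (cases "n = 0") auto
    show "C x \<subseteq> {..<n}" if "x < m" for x using union that by blast
    show "C x \<noteq> {}" if "x < m" for x using nonempty[OF that] .
    show "x = y" if "x < m" "y < m" "u \<in> C x" "u \<in> C y" for x y u
    proof -
      have "C x = C y" using part that by (auto simp: partition_on_def disjoint_def)
      then show ?thesis using inj that by (auto simp: inj_on_def)
    qed
    show "\<exists>x<m. u \<in> C x" if "u < n" for u using union that by blast
    show "within_steps (parcs G) \<rho> u u" if "u < n" for u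
      by (auto simp: within_steps_def intro!: exI[of _ 0])
    show "x = y \<or> (x, y) \<in> parcs T"
      if "x < m" "y < m" "u \<in> C x" "v \<in> C y" "within_steps (parcs G) \<rho> u v" for x y u v
    proof -
      have "u < n" using union that(1,3) by blast
      then have "gdist G u v \<le> ereal (real \<rho>)" using near that(5) by simp
      moreover have "x \<in> pverts T" "y \<in> pverts T" using that T by auto
      ultimately show ?thesis
        using dec that(3,4) unfolding tree_partition_decomposition_def by blast
    qed
    show "x < m" if "(x, y) \<in> parcs T" for x y using T.in_arcsD1[OF that] T by simp
    show "(y, x) \<in> parcs T" if "(x, y) \<in> parcs T" for x y using T.arcs_symmetric[OF that] .
    show "(x, x) \<notin> parcs T" for x using T.no_loops'[of x x] by blast
    show "\<exists>x\<in>A. \<exists>p\<in>A. (x, p) \<in> parcs T \<and> (\<forall>q\<in>A. (x, q) \<in> parcs T \<longrightarrow> q = p)"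
      if "A \<subseteq> {..<m}" "x \<in> A" "y \<in> A" "(x, y) \<in> parcs T" for A x y
    proof (rule ex_leaf_if_no_cyclic_list[where E = "\<lambda>x y. (x, y) \<in> parcs T"])
      show "finite A" using that(1) finite_subset by blast
      show False if xs: "successively (\<lambda>x y. (x, y) \<in> parcs T) xs" "distinct xs" "3 \<le> length xs"
        "(last xs, hd xs) \<in> parcs T" for xs
      proof -
        have "xs \<noteq> []" using xs(3) by auto
        then show False
          using ex_cycle_of_cyclic_list[OF T.pair_wf_digraph xs(1,2) _ xs(4)] xs(3) tree
          unfolding undirected_tree_def by metis
      qed
      show "(y, x) \<in> parcs T" if "(x, y) \<in> parcs T" for x y using T.arcs_symmetric[OF that] .
      show "(x, x) \<notin> parcs T" for x using T.no_loops'[of x x] by blast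
    qed (fact that(2-4))+
  qed
qed

section \<open>Logical and arithmetical expressions\<close>

abbreviation var :: "nat \<Rightarrow> tm" where "var a \<equiv> TCell a (TConst 0)"

text \<open>Every nonzero value counts as true; double negation normalises a value to 0 or
  1.\<close>

definition tNot :: "tm \<Rightarrow> tm" where "tNot t = TSub (TConst 1) t"
definition tAnd :: "tm \<Rightarrow> tm \<Rightarrow> tm" where "tAnd t u = TIte t (tNot (tNot u)) (TConst 0)"
definition tOr :: "tm \<Rightarrow> tm \<Rightarrow> tm" where "tOr t u = tNot (tNot (TAdd t u))"
definition tLe :: "tm \<Rightarrow> tm \<Rightarrow> tm" where "tLe t u = tNot (TSub t u)"
definition tEq :: "tm \<Rightarrow> tm \<Rightarrow> tm" where "tEq t u = tNot (TAdd (TSub t u) (TSub u t))"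
definition tIff :: "tm \<Rightarrow> tm \<Rightarrow> tm" where "tIff t u = TIte t (tNot (tNot u)) (tNot u)"
definition tEx :: "nat \<Rightarrow> tm \<Rightarrow> tm \<Rightarrow> tm" where "tEx i b t = tNot (tNot (TSum i b t))"
definition tAll :: "nat \<Rightarrow> tm \<Rightarrow> tm \<Rightarrow> tm" where "tAll i b t = tNot (TSum i b (tNot t))"
text \<open>A sum with constant summand \<open>u\<close>. The first factor is the loop bound, so it
  is the one that must not exceed \<open>X\<close>.\<close>

definition tMul :: "nat \<Rightarrow> tm \<Rightarrow> tm \<Rightarrow> tm" where "tMul i t u = TSum i t u"

lemma ev_tNot [simp]: "ev s (tNot t) = of_bool (ev s t = 0)"
  by (simp add: tNot_def)

lemma ev_logic [simp]:
  "ev s (tAnd t u) = of_bool (ev s t \<noteq> 0 \<and> ev s u \<noteq> 0)"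
  "ev s (tOr t u) = of_bool (ev s t \<noteq> 0 \<or> ev s u \<noteq> 0)"
  "ev s (tLe t u) = of_bool (ev s t \<le> ev s u)"
  "ev s (tEq t u) = of_bool (ev s t = ev s u)"
  "ev s (tIff t u) = of_bool (ev s t \<noteq> 0 \<longleftrightarrow> ev s u \<noteq> 0)"
  "ev s (tEx i b t) = of_bool (\<exists>j<ev s b. ev (upd s i 0 j) t \<noteq> 0)"
  "ev s (tAll i b t) = of_bool (\<forall>j<ev s b. ev (upd s i 0 j) t \<noteq> 0)"
  by (auto simp: tAnd_def tOr_def tLe_def tEq_def tIff_def tEx_def tAll_def)

lemma sums_bounded_logic [simp]:
  "sums_bounded X s (tNot t) \<longleftrightarrow> sums_bounded X s t"
  "sums_bounded X s (tAnd t u) \<longleftrightarrow> sums_bounded X s t \<and> (ev s t \<noteq> 0 \<longrightarrow> sums_bounded X s u)"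
  "sums_bounded X s (tOr t u) \<longleftrightarrow> sums_bounded X s t \<and> sums_bounded X s u"
  "sums_bounded X s (tLe t u) \<longleftrightarrow> sums_bounded X s t \<and> sums_bounded X s u"
  "sums_bounded X s (tEq t u) \<longleftrightarrow> sums_bounded X s t \<and> sums_bounded X s u"
  "sums_bounded X s (tIff t u) \<longleftrightarrow> sums_bounded X s t \<and> sums_bounded X s u"
  "sums_bounded X s (tEx i b t) \<longleftrightarrow> sums_bounded X s b \<and> ev s b \<le> X \<and>
     (\<forall>j<ev s b. sums_bounded X (upd s i 0 j) t)"
  "sums_bounded X s (tAll i b t) \<longleftrightarrow> sums_bounded X s b \<and> ev s b \<le> X \<and>
     (\<forall>j<ev s b. sums_bounded X (upd s i 0 j) t)"
  by (auto simp: tNot_def tAnd_def tOr_def tLe_def tEq_def tIff_def tEx_def tAll_def)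

lemma arrays_logic [simp]:
  "arrays (tNot t) = arrays t"
  "arrays (tAnd t u) = arrays t \<union> arrays u"
  "arrays (tOr t u) = arrays t \<union> arrays u"
  "arrays (tLe t u) = arrays t \<union> arrays u"
  "arrays (tEq t u) = arrays t \<union> arrays u"
  "arrays (tIff t u) = arrays t \<union> arrays u"
  "arrays (tEx i b t) = insert i (arrays b \<union> arrays t)"
  "arrays (tAll i b t) = insert i (arrays b \<union> arrays t)"
  "arrays (tMul i t u) = insert i (arrays t \<union> arrays u)"
  by (auto simp: tNot_def tAnd_def tOr_def tLe_def tEq_def tIff_def tEx_def tAll_def tMul_def)

lemma ev_tMul [simp]: "i \<notin> arrays u \<Longrightarrow> ev s (tMul i t u) = ev s t * ev s u"
  by (simp add: tMul_def ev_upd)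

lemma sums_bounded_tMul [simp]:
  "i \<notin> arrays u \<Longrightarrow> sums_bounded X s (tMul i t u) \<longleftrightarrow>
     sums_bounded X s t \<and> ev s t \<le> X \<and> (0 < ev s t \<longrightarrow> sums_bounded X s u)"
  by (auto simp: tMul_def sums_bounded_upd)

text \<open>Counts the positive multiples of \<open>u\<close> up to \<open>t\<close>, which for
  positive \<open>u\<close> is the quotient.\<close>

definition tDiv :: "tm \<Rightarrow> tm \<Rightarrow> tm" where
  "tDiv t u = TSum 38 t (tLe (tMul 39 (TAdd (var 38) (TConst 1)) u) t)"

lemma arrays_tDiv [simp]: "arrays (tDiv t u) = {38, 39} \<union> arrays t \<union> arrays u"
  by (auto simp: tDiv_def)

lemma ev_tDiv [simp]:
  assumes "38 \<notin> arrays t" "38 \<notin> arrays u" "39 \<notin> arrays u" "0 < ev s u"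
  shows "ev s (tDiv t u) = ev s t div ev s u"
proof -
  have "ev s (tDiv t u) = card {c. c < ev s t \<and> Suc c * ev s u \<le> ev s t}"
    using assms by (simp add: tDiv_def ev_upd of_bool_def sum.If_cases Int_def)
  also have "{c. c < ev s t \<and> Suc c * ev s u \<le> ev s t} = {..<ev s t div ev s u}"
    using assms(4) div_le_dividend[of "ev s t" "ev s u"]
    by (auto simp: less_eq_div_iff_mult_less_eq[symmetric] Suc_le_eq simp del: mult_Suc
        intro: less_le_trans)
  finally show ?thesis by simp
qed

lemma sums_bounded_tDiv [simp]:
  assumes "38 \<notin> arrays t" "38 \<notin> arrays u" "39 \<notin> arrays u"
    "sums_bounded X s t" "sums_bounded X s u" "ev s t \<le> X"
  shows "sums_bounded X s (tDiv t u)"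
  using assms by (simp add: tDiv_def ev_upd sums_bounded_upd)

text \<open>The remainder modulo \<open>n\<close> is taken by subtraction, since
  \<open>j div n ^ Suc i\<close> is the quotient of \<open>j div n ^ i\<close> by \<open>n\<close>.
  Array 4 supplies the powers.\<close>

definition tDigit :: "tm \<Rightarrow> tm \<Rightarrow> tm" where
  "tDigit j i = TSub (tDiv j (TCell 4 i))
     (tMul 37 (var 0) (tDiv j (TCell 4 (TAdd i (TConst 1)))))"

definition tMem :: "tm \<Rightarrow> tm \<Rightarrow> tm \<Rightarrow> tm" where
  "tMem l j v = tEx 36 l (tEq (tDigit j (var 36)) v)"

lemma arrays_tMem [simp]:
  "arrays (tMem l j v) = {0, 4, 36, 37, 38, 39} \<union> arrays l \<union> arrays j \<union> arrays v"
  by (auto simp: tMem_def tDigit_def)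

lemma ev_tDigit:
  assumes "arrays j \<inter> {37, 38, 39} = {}" "arrays i \<inter> {37, 38, 39} = {}"
    "0 < s 0 0" "s 4 (ev s i) = s 0 0 ^ ev s i" "s 4 (Suc (ev s i)) = s 0 0 ^ Suc (ev s i)"
  shows "ev s (tDigit j i) = digit (s 0 0) (ev s j) (ev s i)"
proof -
  have "ev s (tDigit j i) =
    ev s j div s 0 0 ^ ev s i - s 0 0 * (ev s j div (s 0 0 ^ Suc (ev s i)))"
    unfolding tDigit_def using assms by (subst ev.simps, subst ev_tDiv, auto)
  also have "\<dots> = digit (s 0 0) (ev s j) (ev s i)"
    by (simp add: digit_def div_mult2_eq minus_mult_div_eq_mod mult.commute[of "s 0 0" "s 0 0 ^ _"])
  finally show ?thesis .
qed

lemma sums_bounded_tDigit: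
  assumes "arrays j \<inter> {37, 38, 39} = {}" "arrays i \<inter> {37, 38, 39} = {}"
    "s 0 0 \<le> X" "sums_bounded X s j" "ev s j \<le> X" "sums_bounded X s i"
  shows "sums_bounded X s (tDigit j i)"
  using assms unfolding tDigit_def by auto

definition powers_stored :: "memory \<Rightarrow> nat \<Rightarrow> bool" where
  "powers_stored s l \<longleftrightarrow> 0 < s 0 0 \<and> (\<forall>i\<le>l. s 4 i = s 0 0 ^ i)"

lemma powers_stored_upd [simp]:
  "a \<noteq> 0 \<Longrightarrow> a \<noteq> 4 \<Longrightarrow> powers_stored (upd s a i v) l \<longleftrightarrow> powers_stored s l"
  by (simp add: powers_stored_def)

lemma ev_tMem [simp]:
  assumes "arrays l \<inter> {36..<40} = {}" "arrays j \<inter> {36..<40} = {}" "arrays v \<inter> {36..<40} = {}"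
    "powers_stored s (ev s l)"
  shows "ev s (tMem l j v) = of_bool (ev s v \<in> digit_set (s 0 0) (ev s l) (ev s j))"
proof -
  have "ev (upd s 36 0 i) (tDigit j (var 36)) = digit (s 0 0) (ev s j) i" if "i < ev s l" for i
  proof -
    have "36 \<notin> arrays j" "arrays j \<inter> {37, 38, 39} = {}" using assms(2) by auto
    then show ?thesis using assms(4) that by (subst ev_tDigit) (auto simp: powers_stored_def ev_upd)
  qed
  moreover have "36 \<notin> arrays v" using assms(3) by auto
  ultimately have "ev s (tMem l j v) = of_bool (\<exists>i<ev s l. digit (s 0 0) (ev s j) i = ev s v)"
    by (auto simp: tMem_def ev_upd)
  then show ?thesis by (simp add: digit_set_def image_iff Bex_def eq_commute)
qed

lemma sums_bounded_tMem [simp]: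
  assumes "arrays l \<inter> {36..<40} = {}" "arrays j \<inter> {36..<40} = {}" "arrays v \<inter> {36..<40} = {}"
    "s 0 0 \<le> X" "ev s l \<le> X" "ev s j \<le> X"
    "sums_bounded X s l" "sums_bounded X s j" "sums_bounded X s v"
  shows "sums_bounded X s (tMem l j v)"
proof -
  have "36 \<notin> arrays j" "36 \<notin> arrays v" "arrays j \<inter> {37, 38, 39} = {}" using assms(2,3) by auto
  then show ?thesis using assms(4-)
    by (auto simp: tMem_def ev_upd sums_bounded_upd intro!: sums_bounded_tDigit)
qed

section \<open>The algorithm\<close>

text \<open>
  Array 4 holds the powers of \<open>n\<close>, array 5 the relations of being at most \<open>t\<close> steps apart,
  array 6 the least size that suffices to dominate each bag, array 7 the maximum degree plus 1, array 8 the size of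
  the sets to be enumerated, array 9 the number of their codes, array 10 the costs, array 11 marks
  the eliminated nodes, and array 12 is the number of steps in question. Arrays from 20 on are loop
  variables, those from 30 on are summation variables.
\<close>

abbreviation "v_n \<equiv> TCell 0 (TConst 0)"
abbreviation "v_\<rho> \<equiv> TCell 0 (TConst 1)"
abbreviation "v_m \<equiv> TCell 0 (TConst 2)"
abbreviation "t_sq \<equiv> tMul 39 v_n v_n"
abbreviation "t_edge u v \<equiv> TCell 1 (TAdd (tMul 39 v_n u) v)"
abbreviation "t_adj x y \<equiv> TCell 2 (TAdd (tMul 39 v_m x) y)"
abbreviation "t_bag x v \<equiv> TCell 3 (TAdd (tMul 39 v_n x) v)"
text \<open>The summation variable of a product must not occur in its second factor, hence 38
  outside and 39 inside.\<close>

abbreviation "t_level_index t u v \<equiv> TAdd (tMul 38 v_n (TAdd (tMul 39 v_n t) u)) v"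

text \<open>The exponents go up to the cube of \<open>n\<close>, the bound of
  \<open>set_size_le\<close>.\<close>

definition p_powers :: prog where
  "p_powers = PSeq (PSet 4 (TConst 0) (TConst 1))
     (PFor 20 (tMul 38 v_n t_sq)
       (PSet 4 (TAdd (var 20) (TConst 1)) (tMul 39 v_n (TCell 4 (var 20)))))"

text \<open>The two truncated subtractions compute the minimum of \<rho> and \<open>n * n\<close>;
  the latter is at least the number of arcs.\<close>

definition p_near :: prog where
  "p_near = PSeq (PSet 12 (TConst 0) (TSub t_sq (TSub t_sq v_\<rho>)))
     (PSeq (PFor 21 v_n (PSet 5 (TAdd (tMul 39 v_n (var 21)) (var 21)) (TConst 1)))
       (PFor 20 (var 12) (PFor 21 v_n (PFor 22 v_n
         (PSet 5 (t_level_index (TAdd (var 20) (TConst 1)) (var 21) (var 22))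
           (tEx 30 v_n (tAnd (TCell 5 (t_level_index (var 20) (var 21) (var 30)))
             (tOr (tEq (var 30) (var 22)) (t_edge (var 30) (var 22))))))))))"

abbreviation "t_near u v \<equiv> TCell 5 (t_level_index (var 12) u v)"

definition t_valid :: "tm \<Rightarrow> tm \<Rightarrow> tm \<Rightarrow> tm" where
  "t_valid l x j = tAll 30 v_n (tOr (tNot (t_bag x (var 30)))
     (tEx 31 v_n (tAnd (tMem l j (var 31)) (t_near (var 30) (var 31)))))"

definition t_weight :: "tm \<Rightarrow> tm \<Rightarrow> tm \<Rightarrow> tm" where
  "t_weight l x j = TIte (t_valid l x j)
     (TSum 30 v_n (tAnd (t_bag x (var 30)) (tMem l j (var 30)))) (TAdd v_n (TConst 1))"

definition t_consistent :: "tm \<Rightarrow> tm \<Rightarrow> tm \<Rightarrow> tm \<Rightarrow> tm \<Rightarrow> tm" where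
  "t_consistent l x y j k = tAll 30 v_n (tOr (tNot (tOr (t_bag x (var 30)) (t_bag y (var 30))))
     (tIff (tMem l j (var 30)) (tMem l k (var 30))))"

text \<open>As the width is at most \<open>n\<close>, \<open>n\<close> rounds suffice. Once a size
  is sufficient, the remaining rounds leave it alone.\<close>

definition p_bag_width :: prog where
  "p_bag_width = PFor 20 v_n (PIf (tAll 32 v_m (tEx 33 (TCell 4 (var 6)) (t_valid (var 6) (var 32) (var 33))))
     PSkip (PSet 6 (TConst 0) (TAdd (var 6) (TConst 1))))"

section \<open>Correctness of the tables of powers and distances\<close>

lemma index_eq_iff [simp]:
  fixes n a b u v :: nat
  assumes "u < n" "v < n"
  shows "n * a + u = n * b + v \<longleftrightarrow> a = b \<and> u = v"
proof
  assume *: "n * a + u = n * b + v"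
  have "(n * a + u) div n = a" "(n * b + v) div n = b" using assms by simp_all
  then show "a = b \<and> u = v" using * by simp
qed simp

text \<open>\<open>X\<close> has to cover two kinds of loops: the polynomial ones, by
  \<open>X_cube\<close>, and the enumeration of codes, by \<open>X_power\<close>.\<close>

locale instance_data =
  tree_partition n m "within_steps E \<rho>" adj C
  for n m E \<rho> adj C +
  fixes X :: nat
  assumes m_pos: "0 < m"
    and edges: "E \<subseteq> {..<n} \<times> {..<n}"
    and X_cube: "Suc n * (Suc n * Suc n) \<le> X"
    and X_power: "n ^ set_size \<le> X"
begin

lemma X_bounds [simp]: "n \<le> X" "Suc n \<le> X" "n * n \<le> X" "n * (n * n) \<le> X" "m \<le> X"
proof -
  have "Suc n * (1 * 1) \<le> Suc n * (Suc n * Suc n)" by (intro mult_mono) auto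
  then show 1: "n \<le> X" "Suc n \<le> X" using X_cube by auto
  have "1 * (n * n) \<le> Suc n * (Suc n * Suc n)" by (intro mult_mono) auto
  then show "n * n \<le> X" using X_cube by simp
  have "n * (n * n) \<le> Suc n * (Suc n * Suc n)" by (intro mult_mono) auto
  then show "n * (n * n) \<le> X" using X_cube by simp
  show "m \<le> X" using m_le_n 1 by simp
qed

definition input_stored :: "memory \<Rightarrow> bool" where
  "input_stored s \<longleftrightarrow> s 0 0 = n \<and> s 0 (Suc 0) = \<rho> \<and> s 0 2 = m \<and>
     (\<forall>u<n. \<forall>v<n. 0 < s 1 (n * u + v) \<longleftrightarrow> (u, v) \<in> E) \<and>
     (\<forall>x<m. \<forall>y<m. 0 < s 2 (m * x + y) \<longleftrightarrow> adj x y) \<and>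
     (\<forall>x<m. \<forall>v<n. 0 < s 3 (n * x + v) \<longleftrightarrow> v \<in> C x)"

lemma input_storedD:
  assumes "input_stored s"
  shows "s 0 0 = n" "s 0 (Suc 0) = \<rho>" "s 0 2 = m"
    "u < n \<Longrightarrow> v < n \<Longrightarrow> 0 < s (Suc 0) (n * u + v) \<longleftrightarrow> (u, v) \<in> E"
    "x < m \<Longrightarrow> y < m \<Longrightarrow> 0 < s 2 (m * x + y) \<longleftrightarrow> adj x y"
    "x < m \<Longrightarrow> v < n \<Longrightarrow> 0 < s 3 (n * x + v) \<longleftrightarrow> v \<in> C x"
  using assms by (auto simp: input_stored_def)

lemma input_stored_upd [simp]:
  "3 < a \<Longrightarrow> input_stored (upd s a i v) \<longleftrightarrow> input_stored s"
  by (simp add: input_stored_def)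

lemma input_stored_cong: "input_stored s \<Longrightarrow> (\<And>a. a < 4 \<Longrightarrow> s' a = s a) \<Longrightarrow> input_stored s'"
  by (simp add: input_stored_def)

lemma wp_powers:
  assumes s: "input_stored s"
  shows "wp X p_powers s (\<lambda>s'. powers_stored s' (n * (n * n)))"
proof -
  note [simp] = input_storedD[OF s]
  let ?s = "upd s 4 0 1"
  have "wp X (PFor 20 (tMul 38 v_n t_sq)
       (PSet 4 (TAdd (var 20) (TConst 1)) (tMul 39 v_n (TCell 4 (var 20))))) ?s
       (\<lambda>s'. powers_stored s' (n * (n * n)))"
  proof (rule wp_PFor[where N = "n * (n * n)" and I = "\<lambda>j s'. \<forall>i\<le>j. s' 4 i = n ^ i"])
    fix j s' assume *: "\<forall>i\<le>j. s' 4 i = n ^ i"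
      "\<And>a. a \<notin> insert 20 (written (PSet 4 (TAdd (var 20) (TConst 1)) (tMul 39 v_n (TCell 4 (var 20)))))
        \<Longrightarrow> s' a = ?s a"
    have "s' 0 = s 0" using *(2)[of 0] by simp
    then show "wp X (PSet 4 (TAdd (var 20) (TConst 1)) (tMul 39 v_n (TCell 4 (var 20)))) (upd s' 20 0 j)
       (\<lambda>s'. \<forall>i\<le>Suc j. s' 4 i = n ^ i)"
      using *(1) by (auto simp: le_Suc_eq)
  next
    fix s' assume *: "\<forall>i\<le>n * (n * n). s' 4 i = n ^ i"
      "\<And>a. a \<notin> insert 20 (written (PSet 4 (TAdd (var 20) (TConst 1)) (tMul 39 v_n (TCell 4 (var 20)))))
        \<Longrightarrow> s' a = ?s a"
    have "s' 0 = s 0" using *(2)[of 0] by simp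
    then show "powers_stored s' (n * (n * n))" using *(1) n_pos by (simp add: powers_stored_def)
  qed auto
  then show ?thesis by (simp add: p_powers_def)
qed

definition near_stored :: "memory \<Rightarrow> bool" where
  "near_stored s \<longleftrightarrow> s 12 0 \<le> n * n \<and>
     (\<forall>u<n. \<forall>v<n. 0 < s 5 (n * (n * s 12 0 + u) + v) \<longleftrightarrow> within_steps E \<rho> u v)"

lemma near_storedD:
  assumes "near_stored s"
  shows "s 12 0 \<le> n * n"
    "u < n \<Longrightarrow> v < n \<Longrightarrow> 0 < s 5 (n * (n * s 12 0 + u) + v) \<longleftrightarrow> within_steps E \<rho> u v"
  using assms by (auto simp: near_stored_def)

lemma near_stored_upd [simp]:
  "a \<noteq> 5 \<Longrightarrow> a \<noteq> 12 \<Longrightarrow> near_stored (upd s a i v) \<longleftrightarrow> near_stored s"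
  by (simp add: near_stored_def)

lemma within_steps_less: "within_steps E t u v \<Longrightarrow> u < n \<Longrightarrow> v < n"
proof (induction t arbitrary: v)
  case (Suc t)
  then show ?case using edges by (auto simp: within_steps_Suc)
qed simp

lemma within_steps_Suc_less:
  "u < n \<Longrightarrow> within_steps E (Suc t) u v \<longleftrightarrow>
    (\<exists>w<n. within_steps E t u w \<and> (w = v \<or> (w, v) \<in> E))"
  using within_steps_less by (auto simp: within_steps_Suc)

lemma wp_near:
  assumes s: "input_stored s" "s 5 = (\<lambda>_. 0)"
  shows "wp X p_near s near_stored"
proof -
  note [simp] = input_storedD[OF s(1)]
  define K where "K = min \<rho> (n * n)"
  have K_eq: "n * n - (n * n - \<rho>) = K" by (simp add: K_def)
  have K_X: "K \<le> n * n" "K \<le> X" using X_bounds(3) by (auto simp: K_def min_le_iff_disj)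
  let ?level = "\<lambda>s t u v. 0 < s 5 (n * (n * t + u) + v)"
  \<comment> \<open>Levels up to \<open>t\<close> are final. The next round writes level
    \<open>Suc t\<close> only, and distinct triples have distinct indices.\<close>
  define L where "L t s' \<longleftrightarrow> (\<forall>t'\<le>t. \<forall>u<n. \<forall>v<n. ?level s' t' u v \<longleftrightarrow> within_steps E t' u v)"
    for t and s' :: memory
  let ?set = "PSet 5 (t_level_index (TAdd (var 20) (TConst 1)) (var 21) (var 22))
    (tEx 30 v_n (tAnd (TCell 5 (t_level_index (var 20) (var 21) (var 30)))
      (tOr (tEq (var 30) (var 22)) (t_edge (var 30) (var 22)))))"
  let ?init = "PSet 5 (TAdd (tMul 39 v_n (var 21)) (var 21)) (TConst 1)"
  let ?s1 = "upd s 12 0 K"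
  have loop: "wp X (PFor 20 (var 12) (PFor 21 v_n (PFor 22 v_n ?set))) s2 near_stored"
    if s2: "L 0 s2" "input_stored s2" "s2 12 0 = K" for s2
  proof (rule wp_PFor[where N = K and I = L])
    fix t s3 assume t: "t < K" and L3: "L t s3"
      and "\<And>a. a \<notin> insert 20 (written (PFor 21 v_n (PFor 22 v_n ?set))) \<Longrightarrow> s3 a = s2 a"
    then have i3: "input_stored (upd s3 20 0 t)" using s2(2) by (auto intro: input_stored_cong)
    show "wp X (PFor 21 v_n (PFor 22 v_n ?set)) (upd s3 20 0 t) (L (Suc t))"
    proof (rule wp_PFor[where N = n and I = "\<lambda>u s'. L t s' \<and>
          (\<forall>u'<u. \<forall>v<n. ?level s' (Suc t) u' v \<longleftrightarrow> within_steps E (Suc t) u' v)"])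
      fix u s4 assume u: "u < n" and L4: "L t s4 \<and>
          (\<forall>u'<u. \<forall>v<n. ?level s4 (Suc t) u' v \<longleftrightarrow> within_steps E (Suc t) u' v)"
        and f4: "\<And>a. a \<notin> insert 21 (written (PFor 22 v_n ?set)) \<Longrightarrow> s4 a = upd s3 20 0 t a"
      have i4: "input_stored (upd s4 21 0 u)"
        using f4 i3 by (auto intro!: input_stored_cong[OF i3])
      have t4: "s4 20 0 = t" using f4[of 20] by simp
      show "wp X (PFor 22 v_n ?set) (upd s4 21 0 u) (\<lambda>s'. L t s' \<and>
          (\<forall>u'<Suc u. \<forall>v<n. ?level s' (Suc t) u' v \<longleftrightarrow> within_steps E (Suc t) u' v))"
      proof (rule wp_PFor[where N = n and I = "\<lambda>v s'. L t s' \<and>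
          (\<forall>u'<u. \<forall>v<n. ?level s' (Suc t) u' v \<longleftrightarrow> within_steps E (Suc t) u' v) \<and>
          (\<forall>v'<v. ?level s' (Suc t) u v' \<longleftrightarrow> within_steps E (Suc t) u v')"])
        fix v s5 assume v: "v < n" and L5: "L t s5 \<and>
          (\<forall>u'<u. \<forall>v<n. ?level s5 (Suc t) u' v \<longleftrightarrow> within_steps E (Suc t) u' v) \<and>
          (\<forall>v'<v. ?level s5 (Suc t) u v' \<longleftrightarrow> within_steps E (Suc t) u v')"
          and f5: "\<And>a. a \<notin> insert 22 (written ?set) \<Longrightarrow> s5 a = upd s4 21 0 u a"
        have i5: "input_stored s5" using f5 i4 by (auto intro!: input_stored_cong[OF i4])
        note [simp] = input_storedD[OF i5]
        have t5: "s5 20 0 = t" "s5 21 0 = u" using f5[of 20] f5[of 21] t4 by simp_all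
        have L: "?level s5 t u w \<longleftrightarrow> within_steps E t u w" if "w < n" for w
          using L5 that u unfolding L_def by blast
        let ?new = "of_bool (within_steps E (Suc t) u v)"
        let ?i = "n * (n * Suc t + u) + v"
        have step: "(\<exists>w<n. ?level s5 t u w \<and> (w = v \<or> 0 < s5 1 (n * w + v))) \<longleftrightarrow>
            within_steps E (Suc t) u v"
          using L v by (simp add: within_steps_Suc_less[OF u] cong: conj_cong)
        have "L t (upd s6 5 ?i ?new) \<and>
          (\<forall>u'<u. \<forall>v<n. ?level (upd s6 5 ?i ?new) (Suc t) u' v \<longleftrightarrow> within_steps E (Suc t) u' v) \<and>
          (\<forall>v'<Suc v. ?level (upd s6 5 ?i ?new) (Suc t) u v' \<longleftrightarrow> within_steps E (Suc t) u v')"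
          if "s6 5 = s5 5" for s6 :: memory
          using L5 u v that unfolding L_def by (auto simp: less_Suc_eq simp del: mult_Suc_right)
        moreover have "ev (upd s5 22 0 v) (tEx 30 v_n
           (tAnd (TCell 5 (t_level_index (var 20) (var 21) (var 30)))
             (tOr (tEq (var 30) (var 22)) (t_edge (var 30) (var 22))))) = ?new"
          using t5 step by simp
        moreover have "sums_bounded X (upd s5 22 0 v) (tEx 30 v_n
           (tAnd (TCell 5 (t_level_index (var 20) (var 21) (var 30)))
             (tOr (tEq (var 30) (var 22)) (t_edge (var 30) (var 22)))))"
          by simp
        ultimately show "wp X ?set (upd s5 22 0 v) (\<lambda>s'. L t s' \<and>
          (\<forall>u'<u. \<forall>v<n. ?level s' (Suc t) u' v \<longleftrightarrow> within_steps E (Suc t) u' v) \<and>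
          (\<forall>v'<Suc v. ?level s' (Suc t) u v' \<longleftrightarrow> within_steps E (Suc t) u v'))"
          using t5 by simp
      qed (use L4 input_storedD[OF i4] in \<open>auto simp: L_def less_Suc_eq\<close>)
    qed (use L3 input_storedD[OF i3] in \<open>auto simp: L_def le_Suc_eq\<close>)
  next
    fix s3 assume "L K s3"
      and f: "\<And>a. a \<notin> insert 20 (written (PFor 21 v_n (PFor 22 v_n ?set))) \<Longrightarrow> s3 a = s2 a"
    moreover have "s3 12 0 = K" using f[of 12] s2(3) by simp
    moreover have "card E \<le> n * n" "finite E"
      using card_mono[OF _ edges] finite_subset[OF edges] by (auto simp: card_cartesian_product)
    ultimately show "near_stored s3"
      using K_X(1) within_steps_truncate[of E "n * n" \<rho>] by (auto simp: near_stored_def L_def K_def)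
  qed (use s2 K_X in auto)
  \<comment> \<open>Level 0 is equality: the diagonal is written, and the other entries are 0
    because array 5 is still empty.\<close>
  have "wp X (PFor 21 v_n ?init) ?s1 (\<lambda>s2. wp X (PFor 20 (var 12) (PFor 21 v_n (PFor 22 v_n ?set))) s2 near_stored)"
  proof (rule wp_PFor[where N = n and I = "\<lambda>u s'. \<forall>v<n. \<forall>w<n. 0 < s' 5 (n * v + w) \<longleftrightarrow> v = w \<and> v < u"])
    fix u s2 assume u: "u < n" and I: "\<forall>v<n. \<forall>w<n. 0 < s2 5 (n * v + w) \<longleftrightarrow> v = w \<and> v < u"
      and f: "\<And>a. a \<notin> insert 21 (written ?init) \<Longrightarrow> s2 a = ?s1 a"
    have "s2 0 = s 0" using f[of 0] by simp
    then show "wp X ?init (upd s2 21 0 u) (\<lambda>s'. \<forall>v<n. \<forall>w<n. 0 < s' 5 (n * v + w) \<longleftrightarrow> v = w \<and> v < Suc u)"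
      using u I by auto
  next
    fix s2 assume I: "\<forall>v<n. \<forall>w<n. 0 < s2 5 (n * v + w) \<longleftrightarrow> v = w \<and> v < n"
      and f: "\<And>a. a \<notin> insert 21 (written ?init) \<Longrightarrow> s2 a = ?s1 a"
    have "input_stored s2" using f s(1) by (auto intro!: input_stored_cong[OF s(1)])
    moreover have "s2 12 0 = K" using f[of 12] by simp
    moreover have "L 0 s2" using I by (simp add: L_def)
    ultimately show "wp X (PFor 20 (var 12) (PFor 21 v_n (PFor 22 v_n ?set))) s2 near_stored"
      by (rule loop[rotated])
  qed (use s(2) in auto)
  then show ?thesis by (simp add: p_near_def K_eq del: wp.simps(5))
qed

end

section \<open>Programs for set sizes, cost tables, leaf elimination and the result\<close>

definition p_sizes :: prog where
  "p_sizes = PSeq (PSet 7 (TConst 0) (TAdd (TConst 1)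
      (TSum 30 v_m (tEx 31 v_m (tNot (tLe (TSum 32 v_m (tNot (tNot (t_adj (var 31) (var 32))))) (var 30)))))))
    (PSeq (PSet 8 (TConst 0) (tMul 39 (var 6) (tMul 38 (var 7) (var 7))))
      (PSet 9 (TConst 0) (TCell 4 (var 8))))"

abbreviation "t_cost x j \<equiv> TCell 10 (TAdd (tMul 39 (var 9) x) j)"

definition p_costs :: prog where
  "p_costs = PFor 20 v_m (PFor 21 (var 9)
     (PSet 10 (TAdd (tMul 39 (var 9) (var 20)) (var 21)) (t_weight (var 8) (var 20) (var 21))))"

definition t_leaf :: tm where
  "t_leaf = tAnd (tNot (TCell 11 (var 21))) (tAnd (tNot (TCell 11 (var 22)))
     (tAnd (t_adj (var 21) (var 22)) (tAll 30 v_m (tOr (TCell 11 (var 30))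
       (tOr (tNot (t_adj (var 21) (var 30))) (tEq (var 30) (var 22)))))))"

text \<open>The minimum of \<open>n + 1\<close> and the values \<open>v\<close> is the number of \<open>c \<le> n\<close> that are less than all \<open>v\<close>.\<close>

definition t_message :: tm where
  "t_message = TSum 34 (TAdd v_n (TConst 1)) (tNot (tEx 35 (var 9)
     (tAnd (t_consistent (var 8) (var 21) (var 22) (var 35) (var 23))
       (tLe (t_cost (var 21) (var 35)) (var 34)))))"

definition p_eliminate_leaf :: prog where
  "p_eliminate_leaf = PSeq
     (PFor 23 (var 9) (PSet 10 (TAdd (tMul 39 (var 9) (var 22)) (var 23))
       (TAdd (t_cost (var 22) (var 23)) t_message)))
     (PSet 11 (var 21) (TConst 1))"

text \<open>No elimination order is computed in advance; every round rescans all pairs of nodes for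
  leaves.\<close>

definition p_eliminate :: prog where
  "p_eliminate = PFor 20 v_m (PFor 21 v_m (PFor 22 v_m (PIf t_leaf p_eliminate_leaf PSkip)))"

definition p_result :: prog where
  "p_result = PSet 0 (TConst 0) (TSum 32 v_m (TIte (TCell 11 (var 32)) (TConst 0)
     (TSum 34 (TAdd v_n (TConst 1)) (tNot (tEx 35 (var 9) (tLe (t_cost (var 32) (var 35)) (var 34)))))))"

section \<open>Correctness of validity, weights, consistency and the sizes\<close>

context instance_data
begin

text \<open>Arguments are evaluated under the summation variables 30 and 31 and those of the digit
  arithmetic, so they must not mention them.\<close>

definition safe :: "tm \<Rightarrow> bool" where
  "safe t \<longleftrightarrow> arrays t \<inter> ({30, 31} \<union> {36..<40}) = {}"

lemma safe_var [simp]: "safe (var a) \<longleftrightarrow> a \<notin> {30, 31} \<union> {36..<40}"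
  by (auto simp: safe_def)

lemma safeD:
  assumes "safe t"
  shows "30 \<notin> arrays t" "31 \<notin> arrays t" "36 \<notin> arrays t" "37 \<notin> arrays t" "38 \<notin> arrays t"
    "39 \<notin> arrays t" "arrays t \<inter> {36..<40} = {}"
  using assms by (auto simp: safe_def)

definition data_stored :: "memory \<Rightarrow> bool" where
  "data_stored s \<longleftrightarrow> input_stored s \<and> near_stored s \<and> powers_stored s (n * (n * n))"

lemma data_storedD:
  assumes "data_stored s"
  shows "input_stored s" "near_stored s" "l \<le> n * (n * n) \<Longrightarrow> powers_stored s l"
  using assms by (auto simp: data_stored_def powers_stored_def)

lemma data_stored_upd [simp]: "5 < a \<Longrightarrow> a \<noteq> 12 \<Longrightarrow> data_stored (upd s a i v) \<longleftrightarrow> data_stored s"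
  by (simp add: data_stored_def)

lemma data_stored_cong:
  "data_stored s \<Longrightarrow> (\<And>a. a < 6 \<Longrightarrow> s' a = s a) \<Longrightarrow> s' 12 = s 12 \<Longrightarrow> data_stored s'"
  by (auto simp: data_stored_def near_stored_def powers_stored_def intro: input_stored_cong)

text \<open>The code itself must be at most \<open>X\<close> because its digits come from divisions,
  which sum over as many terms as the dividend says.\<close>

lemma t_valid:
  assumes s: "data_stored s" and safe: "safe l" "safe x" "safe j"
    and l: "ev s l \<le> n * (n * n)" and x: "ev s x < m" and j: "ev s j \<le> X"
    and bounded: "sums_bounded X s l" "sums_bounded X s x" "sums_bounded X s j"
  shows "ev s (t_valid l x j) = of_bool (valid (ev s l) (ev s x) (ev s j))"
    "sums_bounded X s (t_valid l x j)"
proof -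
  note [simp] = input_storedD[OF data_storedD(1)[OF s]] near_storedD[OF data_storedD(2)[OF s]]
    data_storedD(3)[OF s l] safe[THEN safeD(1)] safe[THEN safeD(2)] safe[THEN safeD(3)]
    safe[THEN safeD(4)] safe[THEN safeD(5)] safe[THEN safeD(6)] safe[THEN safeD(7)] ev_upd
    sums_bounded_upd l x j bounded
  have l_X: "ev s l \<le> X" using l X_bounds(4) by linarith
  have sub: "\<And>u. u \<in> C (ev s x) \<Longrightarrow> u < n" "\<And>v. v \<in> digit_set n (ev s l) (ev s j) \<Longrightarrow> v < n"
    using C_subset[OF x] digit_set_subset[OF n_pos] by auto
  have "ev s (t_valid l x j) = of_bool (\<forall>u<n. u \<notin> C (ev s x) \<or>
      (\<exists>v<n. v \<in> digit_set n (ev s l) (ev s j) \<and> within_steps E \<rho> u v))"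
    by (simp add: t_valid_def cong: conj_cong)
  also have "\<dots> = of_bool (valid (ev s l) (ev s x) (ev s j))"
    unfolding valid_def using sub by (intro arg_cong[where f = of_bool]) blast
  finally show "ev s (t_valid l x j) = of_bool (valid (ev s l) (ev s x) (ev s j))" .
  show "sums_bounded X s (t_valid l x j)" using l_X by (simp add: t_valid_def)
qed

lemma t_weight:
  assumes s: "data_stored s" and safe: "safe l" "safe x" "safe j"
    and l: "ev s l \<le> n * (n * n)" and x: "ev s x < m" and j: "ev s j \<le> X"
    and bounded: "sums_bounded X s l" "sums_bounded X s x" "sums_bounded X s j"
  shows "ev s (t_weight l x j) = weight (ev s l) (ev s x) (ev s j)"
    "sums_bounded X s (t_weight l x j)"
proof -
  note [simp] = input_storedD[OF data_storedD(1)[OF s]]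
    data_storedD(3)[OF s l] safe[THEN safeD(1)] safe[THEN safeD(3)]
    safe[THEN safeD(4)] safe[THEN safeD(5)] safe[THEN safeD(6)] safe[THEN safeD(7)] ev_upd
    sums_bounded_upd l x j bounded t_valid[OF assms]
  have l_X: "ev s l \<le> X" using l X_bounds(4) by linarith
  have "(\<Sum>v<n. of_bool (v \<in> C (ev s x) \<and> v \<in> digit_set n (ev s l) (ev s j))) =
      card ({..<n} \<inter> {v. v \<in> C (ev s x) \<and> v \<in> digit_set n (ev s l) (ev s j)})"
    by (simp add: of_bool_def sum.If_cases)
  also have "{..<n} \<inter> {v. v \<in> C (ev s x) \<and> v \<in> digit_set n (ev s l) (ev s j)} =
      C (ev s x) \<inter> digit_set n (ev s l) (ev s j)"
    using C_subset[OF x] by auto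
  finally show "ev s (t_weight l x j) = weight (ev s l) (ev s x) (ev s j)"
    by (simp add: t_weight_def weight_def)
  show "sums_bounded X s (t_weight l x j)" using l_X by (simp add: t_weight_def)
qed

lemma t_consistent:
  assumes s: "data_stored s" and safe: "safe l" "safe x" "safe y" "safe j" "safe k"
    and l: "ev s l \<le> n * (n * n)" and x: "ev s x < m" "ev s y < m"
    and j: "ev s j \<le> X" "ev s k \<le> X"
    and bounded: "sums_bounded X s l" "sums_bounded X s x" "sums_bounded X s y"
      "sums_bounded X s j" "sums_bounded X s k"
  shows "ev s (t_consistent l x y j k) =
      of_bool (consistent (ev s l) (ev s x) (ev s y) (ev s j) (ev s k))"
    "sums_bounded X s (t_consistent l x y j k)"
proof -
  note [simp] = input_storedD[OF data_storedD(1)[OF s]]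
    data_storedD(3)[OF s l] safe[THEN safeD(1)] safe[THEN safeD(3)]
    safe[THEN safeD(4)] safe[THEN safeD(5)] safe[THEN safeD(6)] safe[THEN safeD(7)] ev_upd
    sums_bounded_upd l x j bounded
  have l_X: "ev s l \<le> X" using l X_bounds(4) by linarith
  have "ev s (t_consistent l x y j k) = of_bool (\<forall>v<n. \<not> (v \<in> C (ev s x) \<or> v \<in> C (ev s y)) \<or>
      (v \<in> digit_set n (ev s l) (ev s j) \<longleftrightarrow> v \<in> digit_set n (ev s l) (ev s k)))"
    by (simp add: t_consistent_def)
  also have "\<dots> = of_bool (consistent (ev s l) (ev s x) (ev s y) (ev s j) (ev s k))"
    using C_subset[OF x(1)] C_subset[OF x(2)]
    by (intro arg_cong[where f = of_bool]) (auto simp: consistent_def)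
  finally show "ev s (t_consistent l x y j k) =
      of_bool (consistent (ev s l) (ev s x) (ev s y) (ev s j) (ev s k))" .
  show "sums_bounded X s (t_consistent l x y j k)" using l_X by (simp add: t_consistent_def)
qed

lemma bag_width_le_iff: "bag_width \<le> w \<longleftrightarrow> (\<forall>x<m. \<exists>j<n ^ w. valid w x j)"
proof
  assume "bag_width \<le> w"
  then show "\<forall>x<m. \<exists>j<n ^ w. valid w x j"
    using dominates_bag_width ex_valid_iff le_trans by metis
next
  assume "\<forall>x<m. \<exists>j<n ^ w. valid w x j"
  then show "bag_width \<le> w" using ex_valid_iff by (intro bag_width_le) blast
qed

lemma power_le_X: "l \<le> set_size \<Longrightarrow> n ^ l \<le> X"
  using power_increasing[of l set_size n] n_pos X_power by linarith

lemma le_cube: "l \<le> n \<Longrightarrow> l \<le> n * (n * n)"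
  using n_pos by (metis le_trans le_square mult_le_mono2 nat_mult_1_right One_nat_def Suc_leI)

lemma wp_bag_width:
  assumes s: "data_stored s" "s 6 0 = 0"
  shows "wp X p_bag_width s (\<lambda>s'. s' 6 0 = bag_width)"
proof -
  let ?t = "tAll 32 v_m (tEx 33 (TCell 4 (var 6)) (t_valid (var 6) (var 32) (var 33)))"
  let ?c = "PIf ?t PSkip (PSet 6 (TConst 0) (TAdd (var 6) (TConst 1)))"
  note [simp] = input_storedD[OF data_storedD(1)[OF s(1)]]
  show ?thesis unfolding p_bag_width_def
  proof (rule wp_PFor[where N = n and I = "\<lambda>j s'. s' 6 0 = min j bag_width"])
    fix j s' assume j: "j < n" and s': "s' 6 0 = min j bag_width"
      and f: "\<And>a. a \<notin> insert 20 (written ?c) \<Longrightarrow> s' a = s a"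
    \<comment> \<open>The tested size never exceeds the width; otherwise the \<open>n ^ w\<close>
      codes might be more than \<open>X\<close>.\<close>
    define w where "w = min j bag_width"
    have d: "data_stored s'" using f by (auto intro!: data_stored_cong[OF s(1)])
    note [simp] = input_storedD[OF data_storedD(1)[OF d]]
    have w: "w \<le> n" "w \<le> bag_width" "w \<le> n * (n * n)" using j le_cube[of w] by (auto simp: w_def)
    have pw: "s' 4 w = n ^ w" using data_storedD(3)[OF d w(3)] by (simp add: powers_stored_def)
    have wX: "n ^ w \<le> X" using w(2) bag_width_le_set_size by (intro power_le_X) simp
    let ?s = "upd s' 20 0 j"
    have val: "ev (upd (upd ?s 32 0 x) 33 0 k) (t_valid (var 6) (var 32) (var 33)) =
        of_bool (valid w x k)"
      "sums_bounded X (upd (upd ?s 32 0 x) 33 0 k) (t_valid (var 6) (var 32) (var 33))"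
      if "x < m" "k < n ^ w" for x k
      using t_valid[of "upd (upd ?s 32 0 x) 33 0 k" "var 6" "var 32" "var 33"] that d s' w(3) wX
      by (auto simp: w_def[symmetric])
    have "ev ?s ?t = of_bool (\<forall>x<m. \<exists>k<n ^ w. valid w x k)"
      using s' pw val(1) by (simp add: w_def[symmetric] cong: conj_cong)
    then have "ev ?s ?t = of_bool (bag_width \<le> w)" by (simp add: bag_width_le_iff)
    moreover have "sums_bounded X ?s ?t" using s' pw val(2) wX by (simp add: w_def[symmetric])
    ultimately show "wp X ?c ?s (\<lambda>s'. s' 6 0 = min (Suc j) bag_width)"
      using s' by (auto simp: w_def min_def)
  qed (use s bag_width_le_n in \<open>auto simp: min_def\<close>)
qed

definition sizes_stored :: "memory \<Rightarrow> bool" where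
  "sizes_stored s \<longleftrightarrow> s 8 0 = set_size \<and> s 9 0 = n ^ set_size"

lemma sizes_stored_upd [simp]:
  "a \<noteq> 8 \<Longrightarrow> a \<noteq> 9 \<Longrightarrow> sizes_stored (upd s a i v) \<longleftrightarrow> sizes_stored s"
  by (simp add: sizes_stored_def)

lemma wp_sizes:
  assumes s: "data_stored s" "s 6 0 = bag_width"
  shows "wp X p_sizes s sizes_stored"
proof -
  note [simp] = input_storedD[OF data_storedD(1)[OF s(1)]]
  have deg: "card ({..<m} \<inter> {y. 0 < s 2 (m * x + y)}) = card {y. adj x y}" if "x < m" for x
    using that adj_less' by (intro arg_cong[where f = card]) auto
  have max: "card ({..<m} \<inter> {c. \<exists>x<m. c < card ({..<m} \<inter> {y. 0 < s 2 (m * x + y)})}) = max_adj"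
    by (simp add: max_adj_def deg cong: conj_cong)
  have size: "bag_width * (Suc max_adj * Suc max_adj) = set_size" by (simp add: set_size_def)
  have pw: "s 4 set_size = n ^ set_size"
    using data_storedD(3)[OF s(1) set_size_le[OF m_pos]] by (simp add: powers_stored_def)
  have "bag_width \<le> X" "Suc max_adj \<le> X"
    using bag_width_le_n max_adj_less[OF m_pos] X_bounds le_trans Suc_leI by metis+
  then show ?thesis
    using s(2) max size pw by (simp add: p_sizes_def sizes_stored_def not_le del: mult_Suc mult_Suc_right)
qed

abbreviation codes :: nat where "codes \<equiv> n ^ set_size"

abbreviation stored_cost :: "memory \<Rightarrow> nat \<Rightarrow> nat \<Rightarrow> nat" where
  "stored_cost s x j \<equiv> s 10 (codes * x + j)"

lemma wp_costs:
  assumes s: "data_stored s" "sizes_stored s"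
  shows "wp X p_costs s (\<lambda>s'. \<forall>x<m. \<forall>j<codes. stored_cost s' x j = weight set_size x j)"
proof -
  note [simp] = input_storedD[OF data_storedD(1)[OF s(1)]]
  have sz: "s 8 0 = set_size" "s 9 0 = codes" using s(2) by (auto simp: sizes_stored_def)
  let ?set = "PSet 10 (TAdd (tMul 39 (var 9) (var 20)) (var 21)) (t_weight (var 8) (var 20) (var 21))"
  let ?I = "\<lambda>x s'. \<forall>x'<x. \<forall>j<codes. stored_cost s' x' j = weight set_size x' j"
  show ?thesis unfolding p_costs_def
  proof (rule wp_PFor[where N = m and I = ?I])
    fix x s1 assume x: "x < m" and I1: "?I x s1"
      and f1: "\<And>a. a \<notin> insert 20 (written (PFor 21 (var 9) ?set)) \<Longrightarrow> s1 a = s a"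
    have d1: "data_stored (upd s1 20 0 x)" using f1 by (auto intro!: data_stored_cong[OF s(1)])
    have z1: "s1 8 0 = set_size" "s1 9 0 = codes" using f1[of 8] f1[of 9] sz by simp_all
    show "wp X (PFor 21 (var 9) ?set) (upd s1 20 0 x) (?I (Suc x))"
    proof (rule wp_PFor[where N = codes and I = "\<lambda>j s'. ?I x s' \<and>
          (\<forall>j'<j. stored_cost s' x j' = weight set_size x j')"])
      fix j s2 assume j: "j < codes"
        and I2: "?I x s2 \<and> (\<forall>j'<j. stored_cost s2 x j' = weight set_size x j')"
        and f2: "\<And>a. a \<notin> insert 21 (written ?set) \<Longrightarrow> s2 a = upd s1 20 0 x a"
      let ?s2 = "upd s2 21 0 j"
      have d2: "data_stored ?s2" using f2 by (auto intro!: data_stored_cong[OF d1])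
      have v2: "s2 8 0 = set_size" "s2 9 0 = codes" "s2 20 0 = x"
        using f2[of 8] f2[of 9] f2[of 20] z1 by simp_all
      have "ev ?s2 (t_weight (var 8) (var 20) (var 21)) = weight set_size x j"
        "sums_bounded X ?s2 (t_weight (var 8) (var 20) (var 21))"
        using t_weight[OF d2, of "var 8" "var 20" "var 21"] v2 x j X_power set_size_le[OF m_pos]
        by auto
      then show "wp X ?set ?s2 (\<lambda>s'. ?I x s' \<and> (\<forall>j'<Suc j. stored_cost s' x j' = weight set_size x j'))"
        using v2 I2 j X_power by (auto simp: less_Suc_eq)
    qed (use I1 z1 X_power in \<open>auto simp: less_Suc_eq\<close>)
  qed (use X_power in auto)
qed

section \<open>Leaf elimination\<close>

definition alive :: "memory \<Rightarrow> nat set" where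
  "alive s = {x. x < m \<and> s 11 x = 0}"

lemma alive_subset: "alive s \<subseteq> {..<m}"
  by (auto simp: alive_def)

lemma finite_alive [simp]: "finite (alive s)"
  using finite_subset[OF alive_subset] by blast

text \<open>The invariant of the elimination. It is restricted to \<open>c \<le> n\<close> because
  messages are truncated at \<open>n + 1\<close>.\<close>

definition represents :: "memory \<Rightarrow> bool" where
  "represents s \<longleftrightarrow> data_stored s \<and> sizes_stored s \<and>
     (\<forall>c\<le>n. feasible adj (consistent set_size) codes (alive s) (stored_cost s) c \<longleftrightarrow>
       (\<exists>D. dominates D {..<n} \<and> card D \<le> c))"

definition leaf_pair :: "nat set \<Rightarrow> nat \<Rightarrow> nat \<Rightarrow> bool" where
  "leaf_pair A x p \<longleftrightarrow> x \<in> A \<and> p \<in> A \<and> adj x p \<and> (\<forall>q\<in>A. adj x q \<longrightarrow> q = p)"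

lemma represents_upd [simp]: "12 < a \<Longrightarrow> represents (upd s a i v) \<longleftrightarrow> represents s"
  by (simp add: represents_def alive_def)

lemma alive_upd [simp]: "a \<noteq> 11 \<Longrightarrow> alive (upd s a i v) = alive s"
  by (simp add: alive_def)

definition message :: "memory \<Rightarrow> nat \<Rightarrow> nat \<Rightarrow> nat \<Rightarrow> nat" where
  "message s x p k = (\<Sum>c<Suc n. of_bool (\<not> (\<exists>j<codes. consistent set_size x p j k \<and> stored_cost s x j \<le> c)))"

lemma message_le_iff:
  "c \<le> n \<Longrightarrow> message s x p k \<le> c \<longleftrightarrow> (\<exists>j<codes. consistent set_size x p j k \<and> stored_cost s x j \<le> c)"
  unfolding message_def by (rule truncated_minimum_le_iff) (auto intro: le_trans)

lemma t_message:
  assumes s: "data_stored s" "sizes_stored s"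
    and vars: "s 21 0 = x" "s 22 0 = p" "s 23 0 = k" "x < m" "p < m" "k < codes"
  shows "ev s t_message = message s x p k" "sums_bounded X s t_message"
proof -
  note [simp] = input_storedD[OF data_storedD(1)[OF s(1)]]
  have sz: "s 8 0 = set_size" "s 9 0 = codes" using s(2) by (auto simp: sizes_stored_def)
  let ?s = "\<lambda>c j. upd (upd s 34 0 c) 35 0 j"
  have c: "ev (?s c j) (t_consistent (var 8) (var 21) (var 22) (var 35) (var 23)) =
      of_bool (consistent set_size x p j k)"
    "sums_bounded X (?s c j) (t_consistent (var 8) (var 21) (var 22) (var 35) (var 23))"
    if "j < codes" for c j
    using t_consistent[of "?s c j" "var 8" "var 21" "var 22" "var 35" "var 23"] s sz vars that
      X_power set_size_le[OF m_pos] by auto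
  show "ev s t_message = message s x p k"
    using c(1) vars sz
    by (simp add: t_message_def message_def del: sum_of_bool_eq sum.lessThan_Suc cong: conj_cong)
  show "sums_bounded X s t_message"
    using c sz X_power by (simp add: t_message_def)
qed

text \<open>The costs at \<open>p\<close> may be updated in place: the messages read only the costs
  at \<open>x\<close>, and \<open>x\<close> differs from \<open>p\<close>.\<close>

lemma wp_eliminate_leaf:
  assumes s: "represents s" "s 21 0 = x" "s 22 0 = p" and leaf: "leaf_pair (alive s) x p"
  shows "wp X p_eliminate_leaf s (\<lambda>s'. represents s' \<and> alive s' = alive s - {x})"
proof -
  have xp: "x \<in> alive s" "p \<in> alive s" "adj x p" "x < m" "p < m" "x \<noteq> p"
    using leaf adj_irrefl by (auto simp: leaf_pair_def alive_def)
  have data: "data_stored s" "sizes_stored s" using s(1) by (auto simp: represents_def)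
  let ?set = "PSet 10 (TAdd (tMul 39 (var 9) (var 22)) (var 23))
       (TAdd (t_cost (var 22) (var 23)) t_message)"
  let ?I = "\<lambda>k s'. \<forall>y<m. \<forall>j<codes. stored_cost s' y j =
    (if y = p \<and> j < k then stored_cost s p j + message s x p j else stored_cost s y j)"
  have sz: "s 9 0 = codes" using data(2) by (simp add: sizes_stored_def)
  have "wp X (PFor 23 (var 9) ?set) s (\<lambda>s1. wp X (PSet 11 (var 21) (TConst 1)) s1
      (\<lambda>s'. represents s' \<and> alive s' = alive s - {x}))"
  proof (rule wp_PFor[where N = codes and I = ?I])
    fix k s1 assume k: "k < codes" and I: "?I k s1"
      and f: "\<And>a. a \<notin> insert 23 (written ?set) \<Longrightarrow> s1 a = s a"
    let ?s1 = "upd s1 23 0 k"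
    have d1: "data_stored ?s1" "sizes_stored ?s1"
      using f data by (auto intro!: data_stored_cong[OF data(1)] simp: sizes_stored_def)
    have v1: "s1 21 0 = x" "s1 22 0 = p" "s1 9 0 = codes"
      using f[of 21] f[of 22] f[of 9] s sz by simp_all
    have "message ?s1 x p k = message s x p k"
      using I xp by (simp add: message_def del: sum_of_bool_eq sum.lessThan_Suc cong: conj_cong)
    then have "ev ?s1 t_message = message s x p k" "sums_bounded X ?s1 t_message"
      using t_message[OF d1, of x p k] v1 xp k by auto
    then show "wp X ?set ?s1 (?I (Suc k))"
      using I v1 k xp X_power by (auto simp: less_Suc_eq)
  next
    fix s1 assume I: "?I codes s1"
      and f: "\<And>a. a \<notin> insert 23 (written ?set) \<Longrightarrow> s1 a = s a"
    let ?s2 = "upd s1 11 x 1"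
    have "s1 21 0 = x" using f[of 21] s by simp
    moreover have alive: "alive ?s2 = alive s - {x}" using f[of 11] by (auto simp: alive_def)
    moreover have "data_stored ?s2" "sizes_stored ?s2"
      using f data by (auto intro!: data_stored_cong[OF data(1)] simp: sizes_stored_def)
    moreover have "feasible adj (consistent set_size) codes (alive ?s2) (stored_cost ?s2) c \<longleftrightarrow>
        feasible adj (consistent set_size) codes (alive s) (stored_cost s) c" if "c \<le> n" for c
      unfolding alive
    proof (rule feasible_eliminate[where p = p and N = n and \<mu> = "message s x p"])
      show "q = p" if "q \<in> alive s" "adj x q" for q using leaf that by (simp add: leaf_pair_def)
      show "stored_cost ?s2 p k = stored_cost s p k + message s x p k" if "k < codes" for k
        using I that xp by simp
      show "stored_cost ?s2 y k = stored_cost s y k"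
        if "y \<in> alive s" "y \<noteq> x" "y \<noteq> p" "k < codes" for y k
        using I that by (auto simp: alive_def)
      show "message s x p k \<le> c \<longleftrightarrow>
          (\<exists>j<codes. consistent set_size x p j k \<and> stored_cost s x j \<le> c)" if "c \<le> n" for k c
        by (rule message_le_iff[OF that])
    qed (use xp that adj_sym consistent_sym in auto)
    ultimately show "wp X (PSet 11 (var 21) (TConst 1)) s1
      (\<lambda>s'. represents s' \<and> alive s' = alive s - {x})"
      using s(1) by (simp add: represents_def)
  qed (use sz X_power in auto)
  then show ?thesis by (simp add: p_eliminate_leaf_def del: wp.simps(5))
qed

lemma t_leaf:
  assumes s: "data_stored s" and vars: "s 21 0 = x" "s 22 0 = p" "x < m" "p < m"
  shows "ev s t_leaf = of_bool (leaf_pair (alive s) x p)" "sums_bounded X s t_leaf"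
proof -
  note [simp] = input_storedD[OF data_storedD(1)[OF s(1)]]
  have "ev s t_leaf = of_bool (s 11 x = 0 \<and> s 11 p = 0 \<and> adj x p \<and>
      (\<forall>q<m. 0 < s 11 q \<or> \<not> adj x q \<or> q = p))"
    using vars by (simp add: t_leaf_def) blast
  also have "(\<forall>q<m. 0 < s 11 q \<or> \<not> adj x q \<or> q = p) \<longleftrightarrow> (\<forall>q\<in>alive s. adj x q \<longrightarrow> q = p)"
    by (auto simp: alive_def)
  also have "s 11 x = 0 \<and> s 11 p = 0 \<and> adj x p \<and> (\<forall>q\<in>alive s. adj x q \<longrightarrow> q = p) \<longleftrightarrow>
      leaf_pair (alive s) x p"
    using vars(3,4) unfolding leaf_pair_def by (simp add: alive_def)
  finally show "ev s t_leaf = of_bool (leaf_pair (alive s) x p)" .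
  show "sums_bounded X s t_leaf" by (simp add: t_leaf_def)
qed

text \<open>As long as two live nodes are adjacent there is a leaf among the live nodes, so each
  round removes at least one node and \<open>m\<close> rounds are enough.\<close>

lemma wp_eliminate:
  assumes s: "represents s"
  shows "wp X p_eliminate s (\<lambda>s'. represents s' \<and> (\<forall>x\<in>alive s'. \<forall>y\<in>alive s'. \<not> adj x y))"
proof -
  have m_eq: "s' 0 2 = m" if "represents s'" for s'
    using that by (auto simp: represents_def dest: input_storedD data_storedD)
  let ?body = "PIf t_leaf p_eliminate_leaf PSkip"
  define isolated where "isolated A \<longleftrightarrow> (\<forall>x\<in>A. \<forall>y\<in>A. \<not> adj x y)" for A
  let ?I = "\<lambda>r s'. represents s' \<and> (isolated (alive s') \<or> card (alive s') + r \<le> m)"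
  have "wp X (PFor 20 v_m (PFor 21 v_m (PFor 22 v_m ?body))) s
      (\<lambda>s'. represents s' \<and> isolated (alive s'))"
  proof (rule wp_PFor[where N = m and I = ?I])
    have "card (alive s) \<le> card {..<m}" by (intro card_mono alive_subset) simp
    then show "?I 0 s" using s by simp
  next
    fix r s1 assume I1: "?I r s1"
    define A where "A = alive s1"
    \<comment> \<open>Either this scan has already removed a node, or the live set is still
      \<open>A\<close> and no pair scanned so far is a leaf of \<open>A\<close> with its neighbour.
      A complete scan without removal thus leaves \<open>A\<close> without leaves, hence without
      edges.\<close>
    let ?J = "\<lambda>x s'. represents s' \<and> (alive s' \<subset> A \<or> alive s' = A \<and> (\<forall>x'<x. \<forall>p<m. \<not> leaf_pair A x' p))"
    show "wp X (PFor 21 v_m (PFor 22 v_m ?body)) (upd s1 20 0 r) (?I (Suc r))"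
    proof (rule wp_PFor[where N = m and I = ?J])
      fix x s2 assume x: "x < m" and J2: "?J x s2"
      show "wp X (PFor 22 v_m ?body) (upd s2 21 0 x) (?J (Suc x))"
      proof (rule wp_PFor[where N = m and I = "\<lambda>p s'. represents s' \<and>
            (alive s' \<subset> A \<or> alive s' = A \<and> (\<forall>x'<x. \<forall>p<m. \<not> leaf_pair A x' p) \<and>
              (\<forall>p'<p. \<not> leaf_pair A x p'))"])
        fix p s3 assume p: "p < m" and K3: "represents s3 \<and>
            (alive s3 \<subset> A \<or> alive s3 = A \<and> (\<forall>x'<x. \<forall>p<m. \<not> leaf_pair A x' p) \<and>
              (\<forall>p'<p. \<not> leaf_pair A x p'))"
          and f: "\<And>a. a \<notin> insert 22 (written ?body) \<Longrightarrow> s3 a = upd s2 21 0 x a"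
        let ?s3 = "upd s3 22 0 p"
        let ?K = "\<lambda>s'. represents s' \<and>
            (alive s' \<subset> A \<or> alive s' = A \<and> (\<forall>x'<x. \<forall>p<m. \<not> leaf_pair A x' p) \<and>
              (\<forall>p'<Suc p. \<not> leaf_pair A x p'))"
        have r3: "represents ?s3" "data_stored ?s3" using K3 by (auto simp: represents_def)
        have v3: "?s3 21 0 = x" "?s3 22 0 = p"
          using f[of 21] by (simp_all add: p_eliminate_leaf_def)
        note leaf = t_leaf[OF r3(2) v3 x p]
        have "wp X p_eliminate_leaf ?s3 ?K" if "leaf_pair (alive ?s3) x p"
        proof (rule wp_mono[OF wp_eliminate_leaf[OF r3(1) v3 that]])
          fix s4 assume 4: "represents s4 \<and> alive s4 = alive ?s3 - {x}"
          have "x \<in> alive s3" "alive s3 \<subseteq> A" using that K3 by (auto simp: leaf_pair_def)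
          then show "?K s4" using 4 by auto
        qed
        moreover have "?K ?s3" if "\<not> leaf_pair (alive ?s3) x p"
          using that K3 by (auto simp: less_Suc_eq)
        ultimately show "wp X ?body ?s3 ?K" using leaf by simp
      qed (use J2 m_eq in \<open>auto simp: less_Suc_eq\<close>)
    next
      fix s2 assume J: "?J m s2"
      show "?I (Suc r) s2"
      proof (cases "alive s2 \<subset> A")
        case True
        then have "card (alive s2) < card A" by (intro psubset_card_mono) (auto simp: A_def)
        moreover have "isolated (alive s2)" if "isolated A" using True that by (auto simp: isolated_def)
        ultimately show ?thesis using J I1 by (auto simp: A_def)
      next
        case False
        then have A: "alive s2 = A" "\<And>x p. x < m \<Longrightarrow> p < m \<Longrightarrow> \<not> leaf_pair A x p" using J by auto
        have "A \<subseteq> {..<m}" unfolding A_def by (rule alive_subset)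
        have "isolated A"
          unfolding isolated_def
        proof (intro ballI notI)
          fix x y assume "x \<in> A" "y \<in> A" "adj x y"
          with ex_leaf[OF \<open>A \<subseteq> {..<m}\<close>] obtain x p where "leaf_pair A x p"
            unfolding leaf_pair_def by meson
          moreover from this have "x < m" "p < m"
            using \<open>A \<subseteq> {..<m}\<close> by (auto simp: leaf_pair_def)
          ultimately show False using A(2) by blast
        qed
        then show ?thesis using J A(1) by simp
      qed
    qed (use I1 m_eq in \<open>auto simp: A_def\<close>)
  next
    fix s1 assume I: "?I m s1"
    \<comment> \<open>After \<open>m\<close> rounds the count leaves no live node in the second
      case.\<close>
    then have "isolated (alive s1) \<or> alive s1 = {}" by auto
    then show "represents s1 \<and> isolated (alive s1)" using I by (auto simp: isolated_def)
  qed (use s m_eq in auto)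
  then show ?thesis by (simp add: p_eliminate_def isolated_def del: wp.simps(5))
qed

lemma wp_result:
  assumes s: "represents s" and isolated: "\<forall>x\<in>alive s. \<forall>y\<in>alive s. \<not> adj x y"
  shows "wp X p_result s (\<lambda>s'. \<forall>c\<le>n. s' 0 0 \<le> c \<longleftrightarrow> (\<exists>D. dominates D {..<n} \<and> card D \<le> c))"
proof -
  have data: "data_stored s" "sizes_stored s" using s by (auto simp: represents_def)
  note [simp] = input_storedD[OF data_storedD(1)[OF data(1)]]
  have sz: "s 9 0 = codes" using data(2) by (simp add: sizes_stored_def)
  define \<mu> where "\<mu> x = (\<Sum>c<Suc n. of_bool (\<not> (\<exists>j<codes. stored_cost s x j \<le> c)) :: nat)" for x
  have mu: "\<mu> x \<le> c \<longleftrightarrow> (\<exists>j<codes. stored_cost s x j \<le> c)" if "c \<le> n" for x c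
    unfolding \<mu>_def by (rule truncated_minimum_le_iff) (use that in \<open>auto intro: le_trans\<close>)
  let ?t = "TSum 32 v_m (TIte (TCell 11 (var 32)) (TConst 0)
     (TSum 34 (TAdd v_n (TConst 1)) (tNot (tEx 35 (var 9) (tLe (t_cost (var 32) (var 35)) (var 34))))))"
  have "ev s ?t = (\<Sum>x<m. if 0 < s 11 x then 0 else \<mu> x)"
    using sz by (simp add: \<mu>_def del: sum_of_bool_eq sum.lessThan_Suc cong: if_cong)
  also have "\<dots> = (\<Sum>x\<in>alive s. \<mu> x)"
    by (rule sum.mono_neutral_cong_right) (auto simp: alive_def)
  finally have ev: "ev s ?t = (\<Sum>x\<in>alive s. \<mu> x)" .
  have "(\<Sum>x\<in>alive s. \<mu> x) \<le> c \<longleftrightarrow> (\<exists>D. dominates D {..<n} \<and> card D \<le> c)" if "c \<le> n" for c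
  proof -
    have "feasible adj (consistent set_size) codes (alive s) (stored_cost s) c \<longleftrightarrow>
        (\<Sum>x\<in>alive s. \<mu> x) \<le> c"
      by (rule feasible_no_edges[where N = n]) (use isolated mu that in auto)
    then show ?thesis using s that by (simp add: represents_def)
  qed
  moreover have "sums_bounded X s ?t" using sz X_power by simp
  ultimately show ?thesis using ev by (simp add: p_result_def del: ev.simps(6) sums_bounded.simps(6))
qed

end

section \<open>The whole program, its output and its running time\<close>

definition p_main :: prog where
  "p_main = PSeq p_powers (PSeq p_near (PSeq p_bag_width (PSeq p_sizes
     (PSeq p_costs (PSeq p_eliminate p_result)))))"

lemma written_parts [simp]:
  "written p_powers = {4, 20}"
  "written p_near = {5, 12, 20, 21, 22}"
  "written p_bag_width = {6, 20}"
  "written p_sizes = {7, 8, 9}"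
  "written p_costs = {10, 20, 21}"
  by (auto simp: p_powers_def p_near_def p_bag_width_def p_sizes_def p_costs_def)

lemma p_main_arrays: "prog_arrays p_main \<subseteq> {..<50}"
  by (simp add: p_main_def p_powers_def p_near_def p_bag_width_def p_sizes_def p_costs_def
      p_eliminate_def p_eliminate_leaf_def p_result_def t_valid_def t_weight_def t_consistent_def
      t_leaf_def t_message_def)

context instance_data
begin

lemma wp_main:
  assumes s: "input_stored s" "\<And>a. 3 < a \<Longrightarrow> s a = (\<lambda>_. 0)"
  shows "wp X p_main s (\<lambda>s'. \<forall>c\<le>n. s' 0 0 \<le> c \<longleftrightarrow> (\<exists>D. dominates D {..<n} \<and> card D \<le> c))"
  unfolding p_main_def
proof (rule wp_PSeq_frame[OF wp_powers[OF s(1)]])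
  fix s1 assume p1: "powers_stored s1 (n * (n * n))"
    and f1: "\<And>a. a \<notin> written p_powers \<Longrightarrow> s1 a = s a"
  have i1: "input_stored s1" using f1 by (auto intro: input_stored_cong[OF s(1)])
  have z1: "s1 a = (\<lambda>_. 0)" if "4 < a" "a \<noteq> 20" for a using f1[of a] s(2)[of a] that by simp
  show "wp X (PSeq p_near (PSeq p_bag_width (PSeq p_sizes (PSeq p_costs (PSeq p_eliminate p_result))))) s1
    (\<lambda>s'. \<forall>c\<le>n. s' 0 0 \<le> c \<longleftrightarrow> (\<exists>D. dominates D {..<n} \<and> card D \<le> c))"
  proof (rule wp_PSeq_frame[OF wp_near[OF i1 z1]])
    fix s2 assume n2: "near_stored s2" and f2: "\<And>a. a \<notin> written p_near \<Longrightarrow> s2 a = s1 a"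
    have "input_stored s2" using f2 by (auto intro: input_stored_cong[OF i1])
    moreover have "powers_stored s2 (n * (n * n))" using f2 p1 by (simp add: powers_stored_def)
    ultimately have d2: "data_stored s2" using n2 by (simp add: data_stored_def)
    have z2: "s2 6 0 = 0" "s2 11 = (\<lambda>_. 0)" using f2 z1 by simp_all
    show "wp X (PSeq p_bag_width (PSeq p_sizes (PSeq p_costs (PSeq p_eliminate p_result)))) s2
      (\<lambda>s'. \<forall>c\<le>n. s' 0 0 \<le> c \<longleftrightarrow> (\<exists>D. dominates D {..<n} \<and> card D \<le> c))"
    proof (rule wp_PSeq_frame[OF wp_bag_width[OF d2 z2(1)]])
      fix s3 assume w3: "s3 6 0 = bag_width" and f3: "\<And>a. a \<notin> written p_bag_width \<Longrightarrow> s3 a = s2 a"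
      have d3: "data_stored s3" using f3 by (auto intro: data_stored_cong[OF d2])
      show "wp X (PSeq p_sizes (PSeq p_costs (PSeq p_eliminate p_result))) s3
        (\<lambda>s'. \<forall>c\<le>n. s' 0 0 \<le> c \<longleftrightarrow> (\<exists>D. dominates D {..<n} \<and> card D \<le> c))"
      proof (rule wp_PSeq_frame[OF wp_sizes[OF d3 w3]])
        fix s4 assume sz4: "sizes_stored s4" and f4: "\<And>a. a \<notin> written p_sizes \<Longrightarrow> s4 a = s3 a"
        have d4: "data_stored s4" using f4 by (auto intro: data_stored_cong[OF d3])
        show "wp X (PSeq p_costs (PSeq p_eliminate p_result)) s4
          (\<lambda>s'. \<forall>c\<le>n. s' 0 0 \<le> c \<longleftrightarrow> (\<exists>D. dominates D {..<n} \<and> card D \<le> c))"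
        proof (rule wp_PSeq_frame[OF wp_costs[OF d4 sz4]])
          fix s5 assume c5: "\<forall>x<m. \<forall>j<codes. stored_cost s5 x j = weight set_size x j"
            and f5: "\<And>a. a \<notin> written p_costs \<Longrightarrow> s5 a = s4 a"
          have "s5 11 = (\<lambda>_. 0)" using f5 f4 f3 z2 by simp
          then have "alive s5 = {..<m}" by (auto simp: alive_def)
          moreover have "feasible adj (consistent set_size) codes {..<m} (stored_cost s5) c \<longleftrightarrow>
              feasible adj (consistent set_size) codes {..<m} (weight set_size) c" for c
            by (rule feasible_cong) (use c5 in auto)
          moreover have "data_stored s5" "sizes_stored s5"
            using f5 sz4 by (auto intro: data_stored_cong[OF d4] simp: sizes_stored_def)
          ultimately have "represents s5" by (simp add: represents_def feasible_weight_iff)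
          from wp_mono[OF wp_eliminate[OF this] wp_result]
          show "wp X (PSeq p_eliminate p_result) s5
            (\<lambda>s'. \<forall>c\<le>n. s' 0 0 \<le> c \<longleftrightarrow> (\<exists>D. dominates D {..<n} \<and> card D \<le> c))" by simp
        qed
      qed
    qed
  qed simp_all
qed

end

lemma dominating_iff:
  assumes "pair_wf_digraph G" "A \<subseteq> pverts G"
  shows "dominating \<rho> G A D \<longleftrightarrow>
    D \<subseteq> pverts G \<and> (\<forall>u\<in>A. \<exists>d\<in>D. within_steps (parcs G) \<rho> u d)"
proof -
  have "gdist G u d \<le> ereal (real \<rho>) \<longleftrightarrow> within_steps (parcs G) \<rho> u d" if "u \<in> A" for u d
    using gdist_le_iff[OF assms(1), of u] assms(2) that by (auto simp: within_steps_def)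
  then show ?thesis by (simp add: dominating_def)
qed

text \<open>Comparisons with thresholds up to \<open>N\<close> determine the number, since
  \<open>D\<close> shows that it is at most \<open>N\<close>; taking \<open>N\<close> as threshold
  also gives \<open>r \<le> N\<close>.\<close>

lemma decide_dom_number:
  fixes r :: nat
  assumes "dominating \<rho> G A D" "card D \<le> N"
    and r: "\<And>c. c \<le> N \<Longrightarrow> r \<le> c \<longleftrightarrow> (\<exists>D. dominating \<rho> G A D \<and> card D \<le> c)"
  shows "dom_number_of \<rho> A G = r"
proof -
  let ?P = "\<lambda>c. \<exists>D. dominating \<rho> G A D \<and> card D = c"
  let ?g = "dom_number_of \<rho> A G"
  have "?P (card D)" using assms(1) by blast
  then have g: "?P ?g" "?g \<le> card D"
    unfolding dom_number_of_def by (rule LeastI, rule Least_le)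
  then have "r \<le> ?g" using r[of ?g] assms(2) by auto
  moreover have "?g \<le> r"
  proof -
    have "r \<le> N" using r[of N] assms by blast
    with r[of r] obtain D' where "dominating \<rho> G A D'" "card D' \<le> r" by auto
    moreover from this have "?g \<le> card D'" unfolding dom_number_of_def by (intro Least_le) blast
    ultimately show ?thesis by simp
  qed
  ultimately show ?thesis by simp
qed

text \<open>For \<open>n \<ge> 2\<close>, \<open>Suc n \<le> n ^ 2\<close> and
  \<open>2 * (l + 3) \<le> 14 * q\<close> give the exponent \<open>14 * d * q\<close>. For
  \<open>n = 1\<close> the power of \<open>n\<close> is 1, but then \<open>l \<le> 1\<close>, and
  the factor \<open>16 ^ d\<close> pays for everything. The sum of both serves as the one
  constant.\<close>

lemma time_bound:
  fixes n k q l d :: nat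
  assumes "0 < n" "0 < q" "l \<le> 4 * q" "l \<le> n * (n * n)"
  shows "(Suc n ^ (l + 3)) ^ d \<le> (16 ^ d + 14 * d) * n ^ ((16 ^ d + 14 * d) * q)"
proof (cases "n = 1")
  case True
  then have "l + 3 \<le> 4" using assms(4) by simp
  then have "(2 :: nat) ^ (l + 3) \<le> 2 ^ 4" by (intro power_increasing) auto
  then have "((2 :: nat) ^ (l + 3)) ^ d \<le> 16 ^ d" by (intro power_mono) auto
  then show ?thesis using True by (simp add: numeral_2_eq_2[symmetric])
next
  case False
  then have n: "2 \<le> n" using assms(1) by simp
  have "Suc n \<le> 2 * n" using n by simp
  also have "\<dots> \<le> n ^ 2" using n by (simp add: power2_eq_square)
  finally have "(Suc n ^ (l + 3)) ^ d \<le> ((n ^ 2) ^ (l + 3)) ^ d" by (intro power_mono) auto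
  also have "\<dots> = n ^ (2 * (l + 3) * d)" by (simp only: power_mult)
  also have "\<dots> \<le> n ^ ((16 ^ d + 14 * d) * q)"
  proof (intro power_increasing)
    have "2 * (l + 3) \<le> 14 * q" using assms(2,3) by simp
    then have "2 * (l + 3) * d \<le> 14 * q * d" by (rule mult_le_mono1)
    then show "2 * (l + 3) * d \<le> (16 ^ d + 14 * d) * q" by (simp add: algebra_simps)
  qed (use n in simp)
  also have "\<dots> \<le> (16 ^ d + 14 * d) * n ^ ((16 ^ d + 14 * d) * q)"
  proof -
    have "1 \<le> (16 :: nat) ^ d + 14 * d" by (simp add: add_increasing2 Suc_le_eq)
    from mult_right_mono[OF this, of "n ^ ((16 ^ d + 14 * d) * q)"] show ?thesis
      by (simp only: mult_1 le0)
  qed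
  finally show ?thesis .
qed

text \<open>A tree with a single node has degree 0, for which the exponent
  \<open>\<Delta>\<^sup>2 * k\<close> would vanish; hence \<open>max 1 \<Delta>\<close>.\<close>

theorem theorem1p4:
  shows "\<exists>(p :: com) (c :: nat).
    \<forall>(G :: nat pair_pre_digraph) (n :: nat) (\<rho> :: nat)
      (T :: nat pair_pre_digraph) (m :: nat) (C :: nat \<Rightarrow> nat set) (k :: nat) (\<Delta> :: nat).
      pair_graph G \<and> pverts G = {..<n} \<and> pverts T = {..<m} \<and> 0 < \<rho> \<and>
      tree_partition_decomposition \<rho> G T C \<and>
      decomposition_width \<rho> G T C \<le> k \<and> max_degree T \<le> \<Delta>
      \<longrightarrow> (\<exists>t s. exec p (instance_memory G \<rho> T C) t s \<and>
             result s = dom_number \<rho> G \<and>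
             t \<le> c * n ^ (c * ((max 1 \<Delta>)\<^sup>2 * k)))"
proof -
  let ?p = "compile 50 p_main"
  let ?d = "time_exponent ?p"
  let ?c = "16 ^ ?d + 14 * ?d"
  have "\<exists>t s. exec ?p (instance_memory G \<rho> T C) t s \<and> result s = dom_number \<rho> G \<and>
      t \<le> ?c * n ^ (?c * ((max 1 \<Delta>)\<^sup>2 * k))"
    if "pair_graph G" and n: "pverts G = {..<n}" and m: "pverts T = {..<m}"
      and dec: "tree_partition_decomposition \<rho> G T C"
      and width: "decomposition_width \<rho> G T C \<le> k" and degree: "max_degree T \<le> \<Delta>"
    for G T :: "nat pair_pre_digraph" and n \<rho> m k \<Delta> :: nat and C :: "nat \<Rightarrow> nat set"
  proof -
    interpret G: pair_graph G by fact
    note tree = tree_partition_of_decomposition[OF that(1) n m dec]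
    interpret tree_partition n m "within_steps (parcs G) \<rho>" "\<lambda>x y. (x, y) \<in> parcs T" C
      by (rule tree(1))
    have m_pos: "0 < m" by (rule tree(2))
    \<comment> \<open>Three factors cover the polynomial loops and \<open>set_size\<close> factors
      the codes; the base \<open>Suc n\<close> makes \<open>X\<close> at least 2 even for
      \<open>n = 1\<close>.\<close>
    define X where "X = Suc n ^ (set_size + 3)"
    interpret instance_data n m "parcs G" \<rho> "\<lambda>x y. (x, y) \<in> parcs T" C X
    proof
      show "0 < m" by fact
      show "parcs G \<subseteq> {..<n} \<times> {..<n}" using G.in_arcsD1 G.in_arcsD2 n by auto
      have "Suc n ^ 3 \<le> X" unfolding X_def by (intro power_increasing) auto
      then show "Suc n * (Suc n * Suc n) \<le> X" by (simp only: power3_eq_cube mult.assoc)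
      have "n ^ set_size \<le> Suc n ^ set_size" by (intro power_mono) auto
      also have "\<dots> \<le> X" unfolding X_def by (intro power_increasing) auto
      finally show "n ^ set_size \<le> X" .
    qed
    have dominates: "dominating \<rho> G A D \<longleftrightarrow> dominates D A" if "A \<subseteq> {..<n}" for A D
      using dominating_iff[OF G.pair_wf_digraph, of A] that n by (simp add: dominates_def)
    have "bag_width \<le> k"
    proof (rule bag_width_le)
      fix x assume x: "x < m"
      have "\<exists>c D. dominating \<rho> G (C x) D \<and> card D = c"
        using dominates_all dominates C_subset[OF x] by blast
      then have "\<exists>D. dominating \<rho> G (C x) D \<and> card D = dom_number_of \<rho> (C x) G"
        unfolding dom_number_of_def by (rule LeastI_ex)
      moreover have "dom_number_of \<rho> (C x) G \<le> decomposition_width \<rho> G T C"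
        unfolding decomposition_width_def using x m by (intro Max_ge) auto
      ultimately show "\<exists>D. dominates D (C x) \<and> card D \<le> k"
        using width dominates C_subset[OF x] by auto
    qed
    moreover have "max_adj \<le> \<Delta>"
    proof (rule max_adj_le[OF m_pos])
      fix x assume "x < m"
      then have "out_degree (with_proj T) x \<le> max_degree T"
        unfolding max_degree_def using m by (intro Max_ge) auto
      then show "card {y. (x, y) \<in> parcs T} \<le> \<Delta>" using degree by (simp add: out_degree_with_proj)
    qed
    \<comment> \<open>Squaring this factor 2 yields the 4 in the hypothesis
      \<open>l \<le> 4 * q\<close> of \<open>time_bound\<close>.\<close>
    then have "Suc max_adj \<le> 2 * max 1 \<Delta>" by simp
    ultimately have "set_size \<le> k * ((2 * max 1 \<Delta>) * (2 * max 1 \<Delta>))"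
      unfolding set_size_def by (intro mult_mono) auto
    then have size: "set_size \<le> 4 * ((max 1 \<Delta>)\<^sup>2 * k)" by (simp add: power2_eq_square ac_simps)
    have q: "0 < (max 1 \<Delta>)\<^sup>2 * k" using bag_width_pos[OF m_pos] \<open>bag_width \<le> k\<close> by simp
    have X2: "2 \<le> X"
    proof -
      have "2 ^ 1 \<le> Suc n ^ 1" using n_pos by simp
      also have "\<dots> \<le> X" unfolding X_def by (intro power_increasing) auto
      finally show ?thesis by simp
    qed
    let ?s = "instance_memory G \<rho> T C"
    have "input_stored ?s"
      using n m n_pos m_pos C_subset by (auto simp: input_stored_def instance_memory_def Let_def)
    moreover have "?s a = (\<lambda>_. 0)" if "3 < a" for a
      using that by (auto simp: instance_memory_def Let_def)
    ultimately have "wp X p_main ?s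
        (\<lambda>s'. \<forall>c\<le>n. s' 0 0 \<le> c \<longleftrightarrow> (\<exists>D. dominates D {..<n} \<and> card D \<le> c))"
      by (rule wp_main)
    from runs_compile[OF X2 this p_main_arrays agree_refl order_refl]
    obtain t s s' where t: "exec ?p ?s t s" "t \<le> X ^ ?d" and s': "agree 50 s' s"
      "\<And>c. c \<le> n \<Longrightarrow> s' 0 0 \<le> c \<longleftrightarrow> (\<exists>D. dominates D {..<n} \<and> card D \<le> c)"
      unfolding runs_def by auto
    have "dom_number_of \<rho> {..<n} G = s' 0 0"
    proof (rule decide_dom_number)
      show "dominating \<rho> G {..<n} {..<n}" "card {..<n} \<le> n" using dominates dominates_all by auto
    qed (use s'(2) dominates in auto)
    then have "result s = dom_number \<rho> G"
      using s'(1) n by (simp add: result_def dom_number_def agree_def)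
    moreover have "t \<le> ?c * n ^ (?c * ((max 1 \<Delta>)\<^sup>2 * k))"
      using t(2) time_bound[OF n_pos q size set_size_le[OF m_pos], of ?d] unfolding X_def by linarith
    ultimately show ?thesis using t(1) by blast
  qed
  then show ?thesis by (intro exI[of _ ?p] exI[of _ ?c]) blast
qed

end
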